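(* Let $\mathsf{M}$ be a matroid of rank $r$ on $[n]$. Then \[ \operatorname{Hilb}\Big(\operatorname{Tor}_{\bullet}^{S^{\circ}_{\mathsf{M}}}\big(\mathbb{C}[\Sigma_{\mathsf{M},\emptyset}]\big)_{\bullet}\Big)=\sum_{i=0}^{r-1}y^i+xy^{r-1}\sum_{B\in\mathcal{B}(\mathsf{M})\setminus\{B_{\max}\}}(1+x)^{\mathrm{ep}(B)-1}. \]
   Context: A matroid $\mathsf{M}$ on $[n]$ has rank $r>0$ and set of bases $\mathcal{B}(\mathsf{M})$. For a basis $B$ and $x\notin B$, $C_{B\cup x}$ is the unique circuit in $B\cup x$; $x$ is externally passive w.r.t. $B$ if it is not the smallest element of $C_{B\cup x}$; $\mathrm{ep}(B)$ is the number of externally passive elements. Bases are ordered lexicographically: for distinct bases $B\neq B'$, $B<B'$ iff the smallest element of the symmetric difference $B\triangle B'$ lies in $B$; $B_{\max}$ is the maximum. $S_{\mathsf{M}}=\mathbb{C}[x_1,\dots,x_n]$, $S^{\circ}_{\mathsf{M}}=\mathbb{C}[x_1-x_n,\dots,x_{n-1}-x_n]$ with degree-one part $V=\{\sum c_ix_i:\sum c_i=0\}$. $\mathbb{C}[\Sigma_{\mathsf{M},\emptyset}]=S_{\mathsf{M}}/\langle\prod_{i\in B}x_i : B\in\mathcal{B}(\mathsf{M})\rangle$ with its quotient module structure, graded by polynomial degree. For a graded module $A=\bigoplus_sA_s$, the Koszul complex $A\otimes\bigwedge^\bullet V$ has $d(a\otimes\ell_1\wedge\cdots\wedge\ell_t)=\sum_j(-1)^j(\ell_ja)\otimes\ell_1\wedge\cdots\widehat{\ell_j}\cdots\wedge\ell_t$,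 and $\operatorname{Tor}^{S^\circ_{\mathsf{M}}}_t(A)_s$ is its homology at $A_s\otimes\bigwedge^tV$. $\operatorname{Hilb}=\sum_{t,s}\dim\operatorname{Tor}_t(A)_s\,x^ty^s$. *)

theory Defs
  imports
    "HOL-Library.Poly_Mapping"
    "HOL-Algebra.QuotRing"
    "HOL-Algebra.Module"
    "HOL-Computational_Algebra.Formal_Power_Series"
begin

section \<open>Matroids\<close>

locale matroid =
  fixes E :: "'a set" and \<I> :: "'a set set"
  assumes finite_ground: "finite E"
    and indep_subset_ground: "X \<in> \<I> \<Longrightarrow> X \<subseteq> E"
    and empty_indep: "{} \<in> \<I>"
    and indep_subset: "X \<in> \<I> \<Longrightarrow> Y \<subseteq> X \<Longrightarrow> Y \<in> \<I>"
    and augment: "X \<in> \<I> \<Longrightarrow> Y \<in> \<I> \<Longrightarrow> card X < card Y \<Longrightarrow> \<exists>y\<in>Y - X. insert y X \<in> \<I>"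

definition bases :: "'a set set \<Rightarrow> 'a set set" where
  "bases \<I> = {B \<in> \<I>. \<forall>X\<in>\<I>. B \<subseteq> X \<longrightarrow> X = B}"

definition matroid_rank :: "'a set set \<Rightarrow> nat" where
  "matroid_rank \<I> = Max (card ` \<I>)"

definition circuits :: "'a set \<Rightarrow> 'a set set \<Rightarrow> 'a set set" where
  "circuits E \<I> = {C. C \<subseteq> E \<and> C \<notin> \<I> \<and> (\<forall>X. X \<subset> C \<longrightarrow> X \<in> \<I>)}"

definition fundamental_circuit :: "'a set \<Rightarrow> 'a set set \<Rightarrow> 'a set \<Rightarrow> 'a \<Rightarrow> 'a set" where
  "fundamental_circuit E \<I> B x = (THE C. C \<in> circuits E \<I> \<and> C \<subseteq> insert x B)"

definition externally_passive ::
    "'a::linorder set \<Rightarrow> 'a set set \<Rightarrow> 'a set \<Rightarrow> 'a set" where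
  "externally_passive E \<I> B = {x \<in> E - B. x \<noteq> Min (fundamental_circuit E \<I> B x)}"

definition ep :: "'a::linorder set \<Rightarrow> 'a set set \<Rightarrow> 'a set \<Rightarrow> nat" where
  "ep E \<I> B = card (externally_passive E \<I> B)"

definition lex_less :: "'a::linorder set \<Rightarrow> 'a set \<Rightarrow> bool" where
  "lex_less B B' \<longleftrightarrow> B \<noteq> B' \<and> Min ((B - B') \<union> (B' - B)) \<in> B"

definition max_basis :: "'a::linorder set set \<Rightarrow> 'a set" where
  "max_basis \<I> = (THE B. B \<in> bases \<I> \<and> (\<forall>B'\<in>bases \<I> - {B}. lex_less B' B))"

section \<open>Free complex vector spaces and dimensions of quotients\<close>

definition csc :: "complex \<Rightarrow> ('a \<Rightarrow>\<^sub>0 complex) \<Rightarrow> ('a \<Rightarrow>\<^sub>0 complex)" where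
  "csc c p = Poly_Mapping.map ((*) c) p"

lemma lookup_csc [simp]: "Poly_Mapping.lookup (csc c p) m = c * Poly_Mapping.lookup p m"
  by (simp add: csc_def Poly_Mapping.map.rep_eq when_def)

global_interpretation cvs: vector_space "csc :: complex \<Rightarrow> ('a \<Rightarrow>\<^sub>0 complex) \<Rightarrow> _"
  by unfold_locales (simp_all add: poly_mapping_eq_iff fun_eq_iff lookup_add algebra_simps)

text \<open>A finite set of representatives of a basis of the quotient \<open>U / W\<close> of subspaces \<open>W \<subseteq> U\<close>:
  its elements are linearly independent modulo \<open>W\<close> (so their classes are distinct), and their
  classes span the quotient.\<close>

definition quotient_basis ::
    "('a \<Rightarrow>\<^sub>0 complex) set \<Rightarrow> ('a \<Rightarrow>\<^sub>0 complex) set \<Rightarrow> ('a \<Rightarrow>\<^sub>0 complex) set \<Rightarrow> bool" where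
  "quotient_basis U W T \<longleftrightarrow> finite T \<and> T \<subseteq> U
     \<and> (\<forall>c. (\<Sum>b\<in>T. csc (c b) b) \<in> W \<longrightarrow> (\<forall>b\<in>T. c b = 0))
     \<and> (\<forall>u\<in>U. \<exists>c. u - (\<Sum>b\<in>T. csc (c b) b) \<in> W)"

definition quotient_dim :: "('a \<Rightarrow>\<^sub>0 complex) set \<Rightarrow> ('a \<Rightarrow>\<^sub>0 complex) set \<Rightarrow> nat" where
  "quotient_dim U W = (THE d. \<exists>T. quotient_basis U W T \<and> card T = d)"

section \<open>The polynomial ring and its subspace of linear forms with coefficient sum zero\<close>

type_synonym mpoly = "(nat \<Rightarrow>\<^sub>0 nat) \<Rightarrow>\<^sub>0 complex"

definition Var :: "nat \<Rightarrow> mpoly" where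
  "Var i = Poly_Mapping.single (Poly_Mapping.single i 1) 1"

definition Const :: "complex \<Rightarrow> mpoly" where
  "Const c = Poly_Mapping.single 0 c"

definition monom_degree :: "(nat \<Rightarrow>\<^sub>0 nat) \<Rightarrow> nat" where
  "monom_degree m = (\<Sum>i\<in>Poly_Mapping.keys m. Poly_Mapping.lookup m i)"

text \<open>The ring \<open>\<complex>[x\<^sub>1, \<dots>, x\<^sub>n]\<close>.\<close>

definition poly_ring :: "nat \<Rightarrow> mpoly ring" where
  "poly_ring n =
    \<lparr>carrier = {p. \<forall>m\<in>Poly_Mapping.keys p. Poly_Mapping.keys m \<subseteq> {1..n}},
     monoid.mult = (*), one = 1, zero = 0, add = (+)\<rparr>"

definition homogeneous :: "nat \<Rightarrow> nat \<Rightarrow> mpoly set" where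
  "homogeneous n s =
    {p \<in> carrier (poly_ring n). \<forall>m\<in>Poly_Mapping.keys p. monom_degree m = s}"

text \<open>The degree-one part of the subalgebra \<open>S\<degree> = \<complex>[x\<^sub>1 - x\<^sub>n, \<dots>, x\<^sub>n\<^sub>-\<^sub>1 - x\<^sub>n]\<close>.\<close>

definition diff_forms :: "nat \<Rightarrow> mpoly set" where
  "diff_forms n = {(\<Sum>i=1..n. Const (c i) * Var i) | c. (\<Sum>i=1..n. c i) = 0}"

section \<open>Graded Koszul homology\<close>

text \<open>
  \<open>A\<close> is a module over a ring of polynomials (containing the constants and \<open>V\<close>), \<open>gr s\<close> is its
  homogeneous part of degree \<open>s\<close>, and \<open>V\<close> is a space of linear forms.  The vector space
  \<open>A\<^sub>s \<otimes> \<And>\<^sup>t V\<close> is presented by generators and relations: the generators are the symbols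
  \<open>a \<otimes> l\<^sub>1 \<and> \<dots> \<and> l\<^sub>t\<close> with \<open>a \<in> A\<^sub>s\<close> and \<open>l\<^sub>1, \<dots>, l\<^sub>t \<in> V\<close>, encoded as pairs
  \<open>(a, [l\<^sub>1, \<dots>, l\<^sub>t])\<close>; the relations say that a symbol is linear in each of its entries
  and alternating in the \<open>l\<^sub>i\<close>.  So \<open>A\<^sub>s \<otimes> \<And>\<^sup>t V\<close> is the quotient of
  \<open>koszul_free\<close> by \<open>koszul_null\<close>.
\<close>

definition symb :: "'b \<Rightarrow> mpoly list \<Rightarrow> ('b \<times> mpoly list) \<Rightarrow>\<^sub>0 complex" where
  "symb a ls = Poly_Mapping.single (a, ls) 1"

definition koszul_free ::
    "(nat \<Rightarrow> 'b set) \<Rightarrow> mpoly set \<Rightarrow> nat \<Rightarrow> nat \<Rightarrow> (('b \<times> mpoly list) \<Rightarrow>\<^sub>0 complex) set" where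
  "koszul_free gr V t s =
    {z. Poly_Mapping.keys z \<subseteq> gr s \<times> {ls. length ls = t \<and> set ls \<subseteq> V}}"

inductive_set koszul_rels ::
    "(mpoly, 'b) module \<Rightarrow> (nat \<Rightarrow> 'b set) \<Rightarrow> mpoly set \<Rightarrow> nat \<Rightarrow> nat
      \<Rightarrow> (('b \<times> mpoly list) \<Rightarrow>\<^sub>0 complex) set"
  for A gr V t s where
  coeff_add: "\<lbrakk>a \<in> gr s; b \<in> gr s; length ls = t; set ls \<subseteq> V\<rbrakk> \<Longrightarrow>
     symb (a \<oplus>\<^bsub>A\<^esub> b) ls - symb a ls - symb b ls \<in> koszul_rels A gr V t s"
| coeff_scale: "\<lbrakk>a \<in> gr s; length ls = t; set ls \<subseteq> V\<rbrakk> \<Longrightarrow>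
     symb (Const c \<odot>\<^bsub>A\<^esub> a) ls - csc c (symb a ls) \<in> koszul_rels A gr V t s"
| form_add: "\<lbrakk>a \<in> gr s; length ls = t; set ls \<subseteq> V; i < t; l \<in> V; l' \<in> V\<rbrakk> \<Longrightarrow>
     symb a (ls[i := l + l']) - symb a (ls[i := l]) - symb a (ls[i := l']) \<in> koszul_rels A gr V t s"
| form_scale: "\<lbrakk>a \<in> gr s; length ls = t; set ls \<subseteq> V; i < t; l \<in> V\<rbrakk> \<Longrightarrow>
     symb a (ls[i := Const c * l]) - csc c (symb a (ls[i := l])) \<in> koszul_rels A gr V t s"
| alternating: "\<lbrakk>a \<in> gr s; length ls = t; set ls \<subseteq> V; i < j; j < t; ls ! i = ls ! j\<rbrakk> \<Longrightarrow>
     symb a ls \<in> koszul_rels A gr V t s"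

definition koszul_null ::
    "(mpoly, 'b) module \<Rightarrow> (nat \<Rightarrow> 'b set) \<Rightarrow> mpoly set \<Rightarrow> nat \<Rightarrow> nat
      \<Rightarrow> (('b \<times> mpoly list) \<Rightarrow>\<^sub>0 complex) set" where
  "koszul_null A gr V t s = cvs.span (koszul_rels A gr V t s)"

text \<open>The differential, first on symbols (list positions count from 0, whence the exponent
  \<open>Suc j\<close>), then extended linearly to the free vector space on the symbols.\<close>

definition koszul_diff_symb ::
    "(mpoly, 'b) module \<Rightarrow> 'b \<Rightarrow> mpoly list \<Rightarrow> ('b \<times> mpoly list) \<Rightarrow>\<^sub>0 complex" where
  "koszul_diff_symb A a ls =
    (\<Sum>j<length ls. csc ((- 1) ^ Suc j) (symb ((ls ! j) \<odot>\<^bsub>A\<^esub> a) (take j ls @ drop (Suc j) ls)))"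

definition koszul_diff ::
    "(mpoly, 'b) module \<Rightarrow> (('b \<times> mpoly list) \<Rightarrow>\<^sub>0 complex) \<Rightarrow> (('b \<times> mpoly list) \<Rightarrow>\<^sub>0 complex)" where
  "koszul_diff A z =
    (\<Sum>(a, ls)\<in>Poly_Mapping.keys z. csc (Poly_Mapping.lookup z (a, ls)) (koszul_diff_symb A a ls))"

text \<open>Preimages in \<open>koszul_free\<close> of the cycles and of the boundaries at \<open>A\<^sub>s \<otimes> \<And>\<^sup>t V\<close>.
  In homological degree \<open>t = 0\<close> the differential is \<open>0\<close>, so every element is a cycle; in
  internal degree \<open>s = 0\<close> there is no incoming differential.\<close>

definition koszul_cycles ::
    "(mpoly, 'b) module \<Rightarrow> (nat \<Rightarrow> 'b set) \<Rightarrow> mpoly set \<Rightarrow> nat \<Rightarrow> nat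
      \<Rightarrow> (('b \<times> mpoly list) \<Rightarrow>\<^sub>0 complex) set" where
  "koszul_cycles A gr V t s =
    {z \<in> koszul_free gr V t s. t = 0 \<or> koszul_diff A z \<in> koszul_null A gr V (t - 1) (Suc s)}"

definition koszul_boundaries ::
    "(mpoly, 'b) module \<Rightarrow> (nat \<Rightarrow> 'b set) \<Rightarrow> mpoly set \<Rightarrow> nat \<Rightarrow> nat
      \<Rightarrow> (('b \<times> mpoly list) \<Rightarrow>\<^sub>0 complex) set" where
  "koszul_boundaries A gr V t s =
    {w + koszul_diff A z | w z. w \<in> koszul_null A gr V t s \<and>
       (case s of 0 \<Rightarrow> z = 0 | Suc s' \<Rightarrow> z \<in> koszul_free gr V (Suc t) s')}"

definition tor_dim ::
    "(mpoly, 'b) module \<Rightarrow> (nat \<Rightarrow> 'b set) \<Rightarrow> mpoly set \<Rightarrow> nat \<Rightarrow> nat \<Rightarrow> nat" where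
  "tor_dim A gr V t s = quotient_dim (koszul_cycles A gr V t s) (koszul_boundaries A gr V t s)"

text \<open>Formal power series in two variables: \<open>x\<close> is the outer and \<open>y\<close> the inner variable.\<close>

definition hilb_x :: "int fps fps" where "hilb_x = fps_X"

definition hilb_y :: "int fps fps" where "hilb_y = fps_const fps_X"

definition tor_hilb ::
    "(mpoly, 'b) module \<Rightarrow> (nat \<Rightarrow> 'b set) \<Rightarrow> mpoly set \<Rightarrow> int fps fps" where
  "tor_hilb A gr V = Abs_fps (\<lambda>t. Abs_fps (\<lambda>s. int (tor_dim A gr V t s)))"

section \<open>The graded module attached to a matroid on \<open>{1..n}\<close>\<close>

definition basis_ideal :: "nat \<Rightarrow> nat set set \<Rightarrow> mpoly set" where
  "basis_ideal n \<I> = Idl\<^bsub>poly_ring n\<^esub> ((\<lambda>B. \<Prod>i\<in>B. Var i) ` bases \<I>)"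

text \<open>The quotient of the polynomial ring by the ideal of the basis monomials.  A polynomial acts by
  multiplication with its class; only the actions of constants and of elements of \<open>diff_forms n\<close>
  enter into the Koszul complex.\<close>

definition fan_module :: "nat \<Rightarrow> nat set set \<Rightarrow> (mpoly, mpoly set) module" where
  "fan_module n \<I> =
    (let S = poly_ring n; J = basis_ideal n \<I>; Q = S Quot J in
     \<lparr>carrier = carrier Q, monoid.mult = monoid.mult Q, one = one Q, zero = zero Q, add = add Q,
      module.smult = (\<lambda>f X. (J +>\<^bsub>S\<^esub> f) \<otimes>\<^bsub>Q\<^esub> X)\<rparr>)"

definition fan_grading :: "nat \<Rightarrow> nat set set \<Rightarrow> nat \<Rightarrow> mpoly set set" where
  "fan_grading n \<I> s = (\<lambda>p. basis_ideal n \<I> +>\<^bsub>poly_ring n\<^esub> p) ` homogeneous n s"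

end

(*
Order the bases by the lexicographic order, the largest one first, and let I_k be the ideal of the
first k basis monomials.  By basis exchange (I_(k-1) : x^B) is generated by the variables that are
externally passive for the k-th basis B, so S/I_k is filtered by the modules S/(x_i : i in EP(B)),
shifted by r.  If p lies in EP(B), then V is spanned by the x_i - x_p; on S/(x_i : i in EP(B)) these
act as the variables x_i outside EP(B) and as 0 for i in EP(B).  Hence the Koszul homology of this
module is an exterior algebra on ep(B) - 1 generators, placed in internal degree 0.  As the homology
of S/I_(k-1) vanishes in internal degrees >= r, all maps between the homology of the shifted
submodule and that of S/I_(k-1) are zero, and the long exact sequence adds x y^(r-1) (1+x)^(ep(B)-1).
The case k = 1 is treated in the same way, adding one variable of the monomial at a time.
*)
theory Submission
  imports Defs
begin

section \<open>Dimensions of quotients\<close>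

text \<open>The obstacle is the root: describing the homology of a filtration step uses the basis
  \<open>x_i - x_p\<close> of \<open>V\<close> with \<open>p\<close> externally passive for the
  basis \<open>B\<close> at hand, and in general no single \<open>p\<close> serves all
  \<open>B\<close>. The concrete complexes of two roots are not mapped to each other; each is
  compared with the presented complex, which knows no root, and \<open>tor_is\<close> records a
  dimension for all roots at once. The exponent r - 1 is due to the connecting map: the differential
  lowers the exterior degree and raises the polynomial degree, so a class of the step at (t, r)
  shows up in the new quotient at (t + 1, r - 1). In the concrete complex no quotient space is
  formed. Monomial ideals are sets of exponent vectors, boundaries include all chains of the right
  degrees with coefficients in the ideal, and dimension formulas take the place of long exact
  sequences.\<close>

abbreviation clinear :: "(('a \<Rightarrow>\<^sub>0 complex) \<Rightarrow> ('b \<Rightarrow>\<^sub>0 complex)) \<Rightarrow> bool" where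
  "clinear \<equiv> Vector_Spaces.linear csc csc"

global_interpretation cvp: vector_space_pair
  "csc :: complex \<Rightarrow> ('a \<Rightarrow>\<^sub>0 complex) \<Rightarrow> _" "csc :: complex \<Rightarrow> ('b \<Rightarrow>\<^sub>0 complex) \<Rightarrow> _"
  by unfold_locales

lemma clinearI:
  assumes "\<And>x y. f (x + y) = f x + f y" "\<And>c x. f (csc c x) = csc c (f x)"
  shows "clinear f"
  using assms by unfold_locales auto

lemma poly_mapping_expand:
  fixes z :: "'a \<Rightarrow>\<^sub>0 complex"
  shows "z = (\<Sum>k\<in>Poly_Mapping.keys z. csc (Poly_Mapping.lookup z k) (Poly_Mapping.single k 1))"
proof (rule poly_mapping_eqI)
  fix k
  have "Poly_Mapping.lookup (\<Sum>k\<in>Poly_Mapping.keys z. csc (Poly_Mapping.lookup z k) (Poly_Mapping.single k 1)) k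
      = (\<Sum>j\<in>Poly_Mapping.keys z. if j = k then Poly_Mapping.lookup z k else 0)"
    unfolding lookup_sum by (intro sum.cong) (auto simp: lookup_single when_def)
  also have "\<dots> = Poly_Mapping.lookup z k"
    by (simp add: in_keys_iff)
  finally show "Poly_Mapping.lookup z k = Poly_Mapping.lookup (\<Sum>k\<in>Poly_Mapping.keys z. csc (Poly_Mapping.lookup z k) (Poly_Mapping.single k 1)) k" ..
qed

text \<open>The characteristic is not 2. This turns antisymmetry into vanishing, both for the square
  of the differential and for the wedge of a form with itself.\<close>

lemma eq_neg_self:
  fixes z :: "'a \<Rightarrow>\<^sub>0 complex"
  assumes "z = - z"
  shows "z = 0"
proof (rule poly_mapping_eqI)
  fix k
  from arg_cong[OF assms, of "\<lambda>z. Poly_Mapping.lookup z k"] show "Poly_Mapping.lookup z k = Poly_Mapping.lookup 0 k" by simp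
qed

text \<open>The linear extension of a map given on basis vectors. The operators below are built from
  such extensions, so identities between them need only be checked on single basis elements.\<close>

definition lin :: "('a \<Rightarrow> ('b \<Rightarrow>\<^sub>0 complex)) \<Rightarrow> ('a \<Rightarrow>\<^sub>0 complex) \<Rightarrow> ('b \<Rightarrow>\<^sub>0 complex)" where
  "lin f z = (\<Sum>k\<in>Poly_Mapping.keys z. csc (Poly_Mapping.lookup z k) (f k))"

lemma lin_superset:
  assumes "finite A" "Poly_Mapping.keys z \<subseteq> A"
  shows "lin f z = (\<Sum>k\<in>A. csc (Poly_Mapping.lookup z k) (f k))"
  unfolding lin_def using assms by (intro sum.mono_neutral_left) (auto simp: in_keys_iff)

lemma clinear_lin: "clinear (lin f)"
proof (rule clinearI)
  fix x y :: "'a \<Rightarrow>\<^sub>0 complex" and c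
  let ?A = "Poly_Mapping.keys x \<union> Poly_Mapping.keys y"
  have "lin f (x + y) = (\<Sum>k\<in>?A. csc (Poly_Mapping.lookup (x + y) k) (f k))"
    by (rule lin_superset) (auto simp: keys_add)
  also have "\<dots> = lin f x + lin f y"
    by (simp add: lin_superset[of ?A x] lin_superset[of ?A y] lookup_add cvs.scale_left_distrib sum.distrib)
  finally show "lin f (x + y) = lin f x + lin f y" .
  have "lin f (csc c x) = (\<Sum>k\<in>Poly_Mapping.keys x. csc (Poly_Mapping.lookup (csc c x) k) (f k))"
    by (rule lin_superset) (auto simp: in_keys_iff)
  then show "lin f (csc c x) = csc c (lin f x)"
    by (simp add: lin_def cvs.scale_sum_right)
qed

lemma lin_single [simp]: "lin f (Poly_Mapping.single k 1) = f k"
  by (simp add: lin_def)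

lemma lin_0 [simp]: "lin f 0 = 0"
  by (simp add: lin_def)

lemma clinear_in_subspace:
  assumes "clinear f" "cvs.subspace W" "\<And>k. k \<in> Poly_Mapping.keys z \<Longrightarrow> f (Poly_Mapping.single k 1) \<in> W"
  shows "f z \<in> W"
proof -
  have "f z = (\<Sum>k\<in>Poly_Mapping.keys z. csc (Poly_Mapping.lookup z k) (f (Poly_Mapping.single k 1)))"
    by (subst poly_mapping_expand[of z]) (simp add: cvp.linear_sum[OF assms(1)] cvp.linear_scale[OF assms(1)])
  also have "\<dots> \<in> W" using assms by (intro cvs.subspace_sum cvs.subspace_scale) auto
  finally show ?thesis .
qed

lemma clinear_eqI:
  assumes "clinear f" "clinear g" "\<And>k. k \<in> Poly_Mapping.keys z \<Longrightarrow> f (Poly_Mapping.single k 1) = g (Poly_Mapping.single k 1)"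
  shows "f z = g z"
  using clinear_in_subspace[of "\<lambda>z. f z - g z" "{0}" z] assms
  by (simp add: cvp.linear_compose_sub)

text \<open>A relation rather than the value \<open>quotient_dim\<close>: it includes the existence
  of a finite basis and so passes through inductions without separate finiteness claims. The
  definite description is resolved only by \<open>quotient_dim_eq\<close>.\<close>

definition qdim :: "('a \<Rightarrow>\<^sub>0 complex) set \<Rightarrow> ('a \<Rightarrow>\<^sub>0 complex) set \<Rightarrow> nat \<Rightarrow> bool" where
  "qdim U W d \<longleftrightarrow> (\<exists>T. quotient_basis U W T \<and> card T = d)"

text \<open>Independence modulo \<open>W\<close> already forces \<open>e\<close> to be injective, so
  counting indices counts basis elements.\<close>

lemma qdimI_family:
  assumes W: "cvs.subspace W" and I: "finite I" and eU: "e ` I \<subseteq> U"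
    and ind: "\<And>c. (\<Sum>i\<in>I. csc (c i) (e i)) \<in> W \<Longrightarrow> \<forall>i\<in>I. c i = 0"
    and gen: "\<And>u. u \<in> U \<Longrightarrow> \<exists>c. u - (\<Sum>i\<in>I. csc (c i) (e i)) \<in> W"
  shows "qdim U W (card I)"
proof -
  have inj: "inj_on e I"
  proof (rule inj_onI, rule ccontr)
    fix i j assume ij: "i \<in> I" "j \<in> I" "e i = e j" "i \<noteq> j"
    \<comment> \<open>If two members coincide, their difference is a nontrivial relation with value
      0, hence in \<open>W\<close>.\<close>
    let ?c = "\<lambda>k. if k = i then 1 else if k = j then - 1 else (0::complex)"
    have "(\<Sum>k\<in>I. csc (?c k) (e k)) = (\<Sum>k\<in>{i,j}. csc (?c k) (e k))"
      using ij I by (intro sum.mono_neutral_right) auto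
    also have "\<dots> = 0" using ij by simp
    finally have "(\<Sum>k\<in>I. csc (?c k) (e k)) \<in> W" using W by (simp add: cvs.subspace_0)
    from ind[OF this] ij show False by auto
  qed
  have reindex: "(\<Sum>b\<in>e ` I. csc (c b) b) = (\<Sum>i\<in>I. csc ((c \<circ> e) i) (e i))" for c
    using inj by (simp add: sum.reindex)
  have "quotient_basis U W (e ` I)"
    unfolding quotient_basis_def
  proof (intro conjI ballI allI impI)
    show "finite (e ` I)" using I by simp
    show "e ` I \<subseteq> U" by fact
    show "c b = 0" if "(\<Sum>b\<in>e ` I. csc (c b) b) \<in> W" "b \<in> e ` I" for c b
      using ind[of "c \<circ> e"] that unfolding reindex by auto
    show "\<exists>c. u - (\<Sum>b\<in>e ` I. csc (c b) b) \<in> W" if "u \<in> U" for u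
    proof -
      from gen[OF that] obtain c where c: "u - (\<Sum>i\<in>I. csc (c i) (e i)) \<in> W" by blast
      have "(\<Sum>b\<in>e ` I. csc ((c \<circ> inv_into I e) b) b) = (\<Sum>i\<in>I. csc (c i) (e i))"
        unfolding reindex using inj by (intro sum.cong) auto
      with c show ?thesis by metis
    qed
  qed
  then show ?thesis unfolding qdim_def using inj card_image by blast
qed

text \<open>Reduction to the ordinary exchange bound: each element of \<open>T'\<close> is congruent
  modulo \<open>W\<close> to some \<open>g b\<close> in the span of \<open>T\<close>, and a linear
  relation among the \<open>g b\<close> is a relation modulo \<open>W\<close> among the elements of
  \<open>T'\<close>, hence trivial.\<close>

lemma quotient_basis_card_le:
  assumes W: "cvs.subspace W" and T: "quotient_basis U W T" and T': "quotient_basis U W T'"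
  shows "card T' \<le> card T"
proof -
  from T T' have "\<forall>b\<in>T'. \<exists>c. b - (\<Sum>x\<in>T. csc (c x) x) \<in> W"
    unfolding quotient_basis_def by blast
  then obtain c where c: "\<And>b. b \<in> T' \<Longrightarrow> b - (\<Sum>x\<in>T. csc (c b x) x) \<in> W" by metis
  define g where "g b = (\<Sum>x\<in>T. csc (c b x) x)" for b
  have fin: "finite T" "finite T'" using T T' by (auto simp: quotient_basis_def)
  have ind: "\<forall>b\<in>T'. a b = 0" if "(\<Sum>b\<in>T'. csc (a b) (g b)) \<in> {0}" for a
  proof -
    have "(\<Sum>b\<in>T'. csc (a b) b) = (\<Sum>b\<in>T'. csc (a b) (b - g b))"
      using that by (simp add: cvs.scale_right_diff_distrib sum_subtractf)
    also have "\<dots> \<in> W" using c W by (intro cvs.subspace_sum cvs.subspace_scale) (auto simp: g_def)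
    finally show ?thesis using T' by (auto simp: quotient_basis_def)
  qed
  \<comment> \<open>The bound is for independent sets, and \<open>g\<close> is not yet known to be
    injective; the family lemma over the zero subspace supplies an independent set of the right
    size.\<close>
  have "qdim (cvs.span (g ` T')) {0} (card T')"
  proof (rule qdimI_family[of _ T' g])
    fix u assume "u \<in> cvs.span (g ` T')"
    then show "\<exists>c. u - (\<Sum>i\<in>T'. csc (c i) (g i)) \<in> {0}"
    proof (induction rule: cvs.span_induct_alt)
      case base
      show ?case by (rule exI[of _ "\<lambda>_. 0"]) simp
    next
      case (step k x y)
      then obtain i d where "i \<in> T'" "x = g i" "y = (\<Sum>i\<in>T'. csc (d i) (g i))" by auto
      then show ?case using fin
        by (intro exI[of _ "\<lambda>j. (if j = i then k else 0) + d j"])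
           (simp add: cvs.scale_left_distrib sum.distrib if_distrib[where f = "\<lambda>c. csc c _"] cong: if_cong)
    qed
  qed (use fin ind in \<open>auto intro: cvs.span_base\<close>)
  then obtain S where S: "quotient_basis (cvs.span (g ` T')) {0} S" "card S = card T'"
    unfolding qdim_def by blast
  have "cvs.independent S"
    using S(1) unfolding quotient_basis_def cvs.dependent_finite by (auto simp: cvs.dependent_finite)
  moreover have "S \<subseteq> cvs.span T"
  proof -
    have "g b \<in> cvs.span T" for b
      unfolding g_def by (intro cvs.span_sum cvs.span_scale cvs.span_base)
    then have "cvs.span (g ` T') \<subseteq> cvs.span T"
      by (intro cvs.span_minimal) auto
    with S(1) show ?thesis by (auto simp: quotient_basis_def)
  qed
  ultimately show ?thesis using cvs.independent_span_bound[of T S] fin S(2) by simp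
qed

lemma qdim_unique:
  assumes "cvs.subspace W" "qdim U W d" "qdim U W d'"
  shows "d = d'"
  using assms quotient_basis_card_le unfolding qdim_def by (metis le_antisym)

lemma quotient_dim_eq:
  assumes "cvs.subspace W" "qdim U W d"
  shows "quotient_dim U W = d"
  unfolding quotient_dim_def using assms qdim_unique[OF assms(1)]
  by (intro the_equality) (auto simp: qdim_def)

lemma qdim_0_iff: "qdim U W 0 \<longleftrightarrow> U \<subseteq> W"
proof
  assume "qdim U W 0"
  then have "quotient_basis U W {}"
    unfolding qdim_def using quotient_basis_def card_0_eq by metis
  then show "U \<subseteq> W" by (auto simp: quotient_basis_def)
next
  assume "U \<subseteq> W"
  then have "quotient_basis U W {}" by (auto simp: quotient_basis_def)
  then show "qdim U W 0" unfolding qdim_def by (metis card.empty)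
qed

text \<open>The assumptions say that \<open>f\<close> induces an exact sequence
  \<open>0 \<rightarrow> U1/W1 \<rightarrow> U/W \<rightarrow> U2/W2 \<rightarrow> 0\<close>.\<close>

lemma qdim_exact:
  assumes f: "clinear f" and sub: "cvs.subspace U" "cvs.subspace W" "cvs.subspace W1" "cvs.subspace W2"
    and q1: "qdim U1 W1 d1" and q2: "qdim U2 W2 d2"
    and WU: "W \<subseteq> U" "U1 \<subseteq> U" "W1 \<subseteq> W"
    and zero: "\<And>a. a \<in> U1 \<Longrightarrow> f a \<in> W2" "\<And>a. a \<in> W \<Longrightarrow> f a \<in> W2"
    and inj: "\<And>a. a \<in> cvs.span U1 \<Longrightarrow> a \<in> W \<Longrightarrow> a \<in> W1"
    and mid: "\<And>u. u \<in> U \<Longrightarrow> f u \<in> W2 \<Longrightarrow> \<exists>a\<in>U1. u - a \<in> W"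
    and into: "\<And>u. u \<in> U \<Longrightarrow> f u \<in> U2"
    and surj: "\<And>v. v \<in> U2 \<Longrightarrow> \<exists>u\<in>U. v - f u \<in> W2"
  shows "qdim U W (d1 + d2)"
proof -
  from q1 obtain T1 where T1: "quotient_basis U1 W1 T1" "card T1 = d1" by (auto simp: qdim_def)
  from q2 obtain T2 where T2: "quotient_basis U2 W2 T2" "card T2 = d2" by (auto simp: qdim_def)
  have fin: "finite T1" "finite T2" and T1U: "T1 \<subseteq> U1" using T1 T2 by (auto simp: quotient_basis_def)
  have "\<forall>b\<in>T2. \<exists>u\<in>U. b - f u \<in> W2" using T2 surj by (auto simp: quotient_basis_def)
  then obtain g where g: "\<And>b. b \<in> T2 \<Longrightarrow> g b \<in> U" "\<And>b. b \<in> T2 \<Longrightarrow> b - f (g b) \<in> W2" by metis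
  \<comment> \<open>Indexing by the disjoint sum keeps the two families apart even where they share
    elements.\<close>
  define e where "e = case_sum (\<lambda>b. b) g"
  have sum_e: "(\<Sum>i\<in>T1 <+> T2. csc (c i) (e i)) = (\<Sum>b\<in>T1. csc (c (Inl b)) b) + (\<Sum>b\<in>T2. csc (c (Inr b)) (g b))" for c
    using fin by (simp add: sum.Plus e_def)
  have fsum: "f (\<Sum>b\<in>T. csc (c b) (h b)) = (\<Sum>b\<in>T. csc (c b) (f (h b)))" for T :: "'c set" and c h
    by (simp add: cvp.linear_sum[OF f] cvp.linear_scale[OF f])
  have f2: "(\<Sum>b\<in>T2. csc (c b) b) - f (\<Sum>b\<in>T2. csc (c b) (g b)) \<in> W2" for c
  proof -
    have "(\<Sum>b\<in>T2. csc (c b) b) - f (\<Sum>b\<in>T2. csc (c b) (g b)) = (\<Sum>b\<in>T2. csc (c b) (b - f (g b)))"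
      unfolding fsum by (simp add: cvs.scale_right_diff_distrib sum_subtractf)
    also have "\<dots> \<in> W2" using g sub by (intro cvs.subspace_sum cvs.subspace_scale) auto
    finally show ?thesis .
  qed
  have f1: "f (\<Sum>b\<in>T1. csc (c b) b) \<in> W2" for c
  proof -
    have "f (\<Sum>b\<in>T1. csc (c b) b) = (\<Sum>b\<in>T1. csc (c b) (f b))"
      by (simp add: cvp.linear_sum[OF f] cvp.linear_scale[OF f])
    also have "\<dots> \<in> W2" using T1U zero(1) sub(4) by (intro cvs.subspace_sum cvs.subspace_scale) auto
    finally show ?thesis .
  qed
  have W2_iff: "x \<in> W2 \<longleftrightarrow> y \<in> W2" if "x - y \<in> W2" for x y
    using cvs.subspace_diff[OF sub(4) _ that, of x] cvs.subspace_add[OF sub(4) that, of y] by auto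
  have "qdim U W (card (T1 <+> T2))"
  proof (rule qdimI_family[of W "T1 <+> T2" e U])
    show "e ` (T1 <+> T2) \<subseteq> U" using T1U WU g by (auto simp: e_def)
    show "\<forall>i\<in>T1 <+> T2. c i = 0" if "(\<Sum>i\<in>T1 <+> T2. csc (c i) (e i)) \<in> W" for c
    proof -
      let ?x = "\<Sum>b\<in>T1. csc (c (Inl b)) b" and ?y = "\<Sum>b\<in>T2. csc (c (Inr b)) (g b)"
      have xy: "?x + ?y \<in> W" using that unfolding sum_e .
      then have "f ?x + f ?y \<in> W2" using zero(2)[OF xy] by (simp only: cvp.linear_add[OF f])
      then have "f ?y \<in> W2" using cvs.subspace_diff[OF sub(4) _ f1[of "\<lambda>b. c (Inl b)"]]
        by fastforce
      then have "(\<Sum>b\<in>T2. csc (c (Inr b)) b) \<in> W2" using W2_iff[OF f2[of "\<lambda>b. c (Inr b)"]] by simp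
      then have c2: "\<forall>b\<in>T2. c (Inr b) = 0" using T2(1)
        by (auto simp: quotient_basis_def dest: spec[of _ "\<lambda>b. c (Inr b)"])
      then have "?y = 0" by simp
      with xy have "?x \<in> W" by simp
      moreover have "?x \<in> cvs.span U1" using T1U by (intro cvs.span_sum cvs.span_scale cvs.span_base) auto
      ultimately have "?x \<in> W1" using inj by blast
      then have "\<forall>b\<in>T1. c (Inl b) = 0" using T1(1)
        by (auto simp: quotient_basis_def dest: spec[of _ "\<lambda>b. c (Inl b)"])
      with c2 show ?thesis by auto
    qed
    show "\<exists>c. u - (\<Sum>i\<in>T1 <+> T2. csc (c i) (e i)) \<in> W" if u: "u \<in> U" for u
    proof -
      from into[OF u] T2(1) obtain c2 where c2: "f u - (\<Sum>b\<in>T2. csc (c2 b) b) \<in> W2"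
        by (auto simp: quotient_basis_def)
      let ?y = "\<Sum>b\<in>T2. csc (c2 b) (g b)"
      \<comment> \<open>Subtracting the lift of its image from \<open>u\<close> leaves an element
        with trivial image modulo \<open>W2\<close>; by \<open>mid\<close> it is congruent to an
        element of \<open>U1\<close>.\<close>
      have "f (u - ?y) = (f u - (\<Sum>b\<in>T2. csc (c2 b) b)) + ((\<Sum>b\<in>T2. csc (c2 b) b) - f ?y)"
        by (simp add: cvp.linear_diff[OF f])
      also have "\<dots> \<in> W2" using c2 f2 cvs.subspace_add[OF sub(4)] by blast
      finally have "f (u - ?y) \<in> W2" .
      moreover have "?y \<in> U" using g sub(1) by (intro cvs.subspace_sum cvs.subspace_scale) auto
      then have "u - ?y \<in> U" using u cvs.subspace_diff[OF sub(1)] by blast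
      ultimately obtain a where a: "a \<in> U1" "u - ?y - a \<in> W" using mid by blast
      from a(1) T1(1) obtain c1 where c1: "a - (\<Sum>b\<in>T1. csc (c1 b) b) \<in> W1"
        by (auto simp: quotient_basis_def)
      have "(u - ?y - a) + (a - (\<Sum>b\<in>T1. csc (c1 b) b)) \<in> W"
        using a c1 WU cvs.subspace_add[OF sub(2)] by blast
      then show ?thesis unfolding sum_e
        by (intro exI[of _ "case_sum c1 c2"]) (simp add: algebra_simps)
    qed
  qed (use sub fin in auto)
  then show ?thesis using fin T1 T2 by (simp add: card_Plus)
qed

text \<open>The case of a zero left-hand term: \<open>f\<close> induces an isomorphism of
  \<open>U/W\<close> onto \<open>U'/W'\<close>, and the dimension is carried back to its
  source.\<close>

corollary qdim_transfer:
  assumes "clinear f" "cvs.subspace U" "cvs.subspace W" "cvs.subspace W'"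
    and "qdim U' W' d" "W \<subseteq> U"
    and "\<And>a. a \<in> W \<Longrightarrow> f a \<in> W'" "\<And>u. u \<in> U \<Longrightarrow> f u \<in> W' \<Longrightarrow> u \<in> W"
    and "\<And>u. u \<in> U \<Longrightarrow> f u \<in> U'" "\<And>v. v \<in> U' \<Longrightarrow> \<exists>u\<in>U. v - f u \<in> W'"
  shows "qdim U W d"
proof -
  have "qdim U W (0 + d)"
    by (rule qdim_exact[where f = f and ?U1.0 = "{0}" and ?W1.0 = "{0}" and ?U2.0 = U' and ?W2.0 = W'])
       (use assms in \<open>auto simp: qdim_0_iff cvs.subspace_0 cvp.linear_0\<close>)
  then show ?thesis by simp
qed

section \<open>A concrete Koszul complex\<close>

abbreviation keys :: "('a \<Rightarrow>\<^sub>0 'b::zero) \<Rightarrow> 'a set" where "keys \<equiv> Poly_Mapping.keys"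
abbreviation lookup :: "('a \<Rightarrow>\<^sub>0 'b::zero) \<Rightarrow> 'a \<Rightarrow> 'b" where "lookup \<equiv> Poly_Mapping.lookup"
abbreviation sng :: "'a \<Rightarrow> ('a \<Rightarrow>\<^sub>0 complex)" where "sng k \<equiv> Poly_Mapping.single k 1"

section \<open>Monomials and their degrees\<close>

definition xm :: "nat \<Rightarrow> (nat \<Rightarrow>\<^sub>0 nat)" where "xm i = Poly_Mapping.single i 1"

definition mons :: "nat \<Rightarrow> nat \<Rightarrow> (nat \<Rightarrow>\<^sub>0 nat) set" where
  "mons n s = {u. keys u \<subseteq> {1..n} \<and> monom_degree u = s}"

lemma keys_xm [simp]: "keys (xm i) = {i}"
  by (simp add: xm_def)

lemma monom_degree_superset:
  assumes "finite A" "keys u \<subseteq> A"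
  shows "monom_degree u = (\<Sum>i\<in>A. lookup u i)"
  unfolding monom_degree_def using assms by (intro sum.mono_neutral_left) (auto simp: in_keys_iff)

lemma monom_degree_add [simp]: "monom_degree (u + v) = monom_degree u + monom_degree v"
proof -
  let ?A = "keys u \<union> keys v"
  have "monom_degree (u + v) = (\<Sum>i\<in>?A. lookup (u + v) i)"
    by (rule monom_degree_superset) (auto simp: keys_add)
  then show ?thesis
    by (simp add: monom_degree_superset[of ?A u] monom_degree_superset[of ?A v] lookup_add sum.distrib)
qed

lemma monom_degree_xm [simp]: "monom_degree (xm i) = 1"
  by (simp add: monom_degree_def xm_def)

lemma monom_degree_0 [simp]: "monom_degree 0 = 0"
  by (simp add: monom_degree_def)

lemma monom_degree_eq_0_iff: "monom_degree u = 0 \<longleftrightarrow> u = 0"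
  by (auto simp: monom_degree_def in_keys_iff poly_mapping_eq_iff fun_eq_iff)

lemma keys_add_nat [simp]: "keys (u + v :: nat \<Rightarrow>\<^sub>0 nat) = keys u \<union> keys v"
  by (auto simp: in_keys_iff lookup_add)

lemma mons_xm: "i \<in> {1..n} \<Longrightarrow> u \<in> mons n s \<Longrightarrow> u + xm i \<in> mons n (Suc s)"
  by (auto simp: mons_def)

lemma monom_split_var:
  assumes "i \<in> keys (u :: nat \<Rightarrow>\<^sub>0 nat)"
  obtains v where "u = v + xm i"
proof
  show "u = (u - xm i) + xm i"
    using assms by (intro poly_mapping_eqI) (auto simp: lookup_add lookup_minus xm_def lookup_single when_def in_keys_iff)
qed

text \<open>For a root \<open>p\<close>, the pair \<open>(u, F)\<close> stands for the monomial \<open>u\<close> tensored with the wedge product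
  of the forms \<open>x\<^sub>i - x\<^sub>p\<close>, \<open>i \<in> F\<close>, in increasing order.  Monomial ideals are encoded by their sets
  of monomials, and quotients by working modulo chains with coefficients in the ideal.\<close>

type_synonym chain = "((nat \<Rightarrow>\<^sub>0 nat) \<times> nat set) \<Rightarrow>\<^sub>0 complex"

section \<open>Chains, contraction, exterior multiplication and the Koszul differential\<close>

definition supported_on :: "'a set \<Rightarrow> ('a \<Rightarrow>\<^sub>0 complex) set" where "supported_on P = {z. keys z \<subseteq> P}"

lemma subspace_supported_on [simp]: "cvs.subspace (supported_on P)"
proof (rule cvs.subspaceI)
  show "0 \<in> supported_on P" by (simp add: supported_on_def)
  show "x + y \<in> supported_on P" if "x \<in> supported_on P" "y \<in> supported_on P" for x y
    using that keys_add[of x y] by (auto simp: supported_on_def)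
  show "csc c x \<in> supported_on P" if "x \<in> supported_on P" for c x
    using that by (auto simp: supported_on_def in_keys_iff)
qed

lemmas supported_on_add = cvs.subspace_add[OF subspace_supported_on]
lemmas supported_on_diff = cvs.subspace_diff[OF subspace_supported_on]
lemmas supported_on_neg = cvs.subspace_neg[OF subspace_supported_on]
lemmas supported_on_csc = cvs.subspace_scale[OF subspace_supported_on]
lemmas supported_on_sum = cvs.subspace_sum[OF subspace_supported_on]

lemma supported_on_0 [simp]: "0 \<in> supported_on P" by (simp add: supported_on_def)
lemma supported_on_sng [simp]: "sng k \<in> supported_on P \<longleftrightarrow> k \<in> P" by (simp add: supported_on_def)

lemma clinear_supported_on:
  assumes "clinear f" "z \<in> supported_on P" "\<And>k. k \<in> P \<Longrightarrow> f (sng k) \<in> W" "cvs.subspace W"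
  shows "f z \<in> W"
  by (rule clinear_in_subspace) (use assms in \<open>auto simp: supported_on_def\<close>)

text \<open>The sign of moving a factor with index \<open>i\<close> past the factors of
  \<open>F\<close> with smaller index.\<close>

definition sg :: "nat \<Rightarrow> nat set \<Rightarrow> complex" where
  "sg i F = (- 1) ^ card {j \<in> F. j < i}"

lemma sg_sg [simp]: "sg i F * sg i F = 1"
  by (simp add: sg_def flip: power_add mult_2)

lemma sg_insert_self [simp]: "sg i (insert i F) = sg i F"
  unfolding sg_def by (rule arg_cong[where f = "\<lambda>A. (- 1) ^ card A"]) auto

lemma sg_remove_self [simp]: "sg i (F - {i}) = sg i F"
  unfolding sg_def by (rule arg_cong[where f = "\<lambda>A. (- 1) ^ card A"]) auto

lemma sg_insert: "j \<notin> F \<Longrightarrow> sg i (insert j F) = (if j < i then - sg i F else sg i F)"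
proof (cases "j < i")
  case True
  assume "j \<notin> F"
  have "{k \<in> insert j F. k < i} = insert j {k \<in> F. k < i}" using True by auto
  then show ?thesis using True \<open>j \<notin> F\<close> by (simp add: sg_def)
next
  case False
  then have "{k \<in> insert j F. k < i} = {k \<in> F. k < i}" by auto
  then show ?thesis using False by (simp add: sg_def)
qed

lemma sg_remove: "j \<in> F \<Longrightarrow> sg i (F - {j}) = (if j < i then - sg i F else sg i F)"
  using sg_insert[of j "F - {j}" i] by (auto simp: insert_absorb)

definition mulm :: "(nat \<Rightarrow>\<^sub>0 nat) \<Rightarrow> chain \<Rightarrow> chain" where
  "mulm e = lin (\<lambda>(u, F). sng (u + e, F))"

text \<open>Contraction with the vector dual to \<open>x_i - x_p\<close>.\<close>

definition iota :: "nat \<Rightarrow> chain \<Rightarrow> chain" where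
  "iota i = lin (\<lambda>(u, F). if i \<in> F then csc (sg i F) (sng (u, F - {i})) else 0)"

text \<open>Exterior multiplication from the left by \<open>x_i - x_p\<close>; the sign sorts the
  new factor into increasing order.\<close>

definition eps :: "nat \<Rightarrow> chain \<Rightarrow> chain" where
  "eps i = lin (\<lambda>(u, F). if i \<in> F then 0 else csc (sg i F) (sng (u, insert i F)))"

definition ymul :: "nat \<Rightarrow> nat \<Rightarrow> chain \<Rightarrow> chain" where
  "ymul p i z = mulm (xm i) z - mulm (xm p) z"

text \<open>Written through commuting multiplications and anticommuting contractions, so that its
  identities follow from theirs. Its sign is opposite to that of \<open>koszul_diff\<close>, which
  starts with a minus.\<close>

definition kdiff :: "nat \<Rightarrow> nat \<Rightarrow> chain \<Rightarrow> chain" where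
  "kdiff n p z = (\<Sum>i\<in>{1..n} - {p}. ymul p i (iota i z))"

lemma clinear_mulm: "clinear (mulm e)" unfolding mulm_def by (rule clinear_lin)
lemma clinear_iota: "clinear (iota i)" unfolding iota_def by (rule clinear_lin)
lemma clinear_eps: "clinear (eps i)" unfolding eps_def by (rule clinear_lin)
lemma clinear_ymul: "clinear (ymul p i)"
  unfolding ymul_def by (intro cvp.linear_compose_sub clinear_mulm)

lemma clinear_comp: "clinear f \<Longrightarrow> clinear g \<Longrightarrow> clinear (\<lambda>z. g (f z))"
  using Vector_Spaces.linear_compose[of csc csc f csc g] by (simp add: o_def)

lemma clinear_kdiff: "clinear (kdiff n p)"
  unfolding kdiff_def
  by (intro cvp.linear_compose_sum ballI clinear_comp[OF clinear_iota clinear_ymul])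

lemma clinear_id: "clinear (\<lambda>z. z)" by (rule clinearI) auto

lemmas kdiff_add = cvp.linear_add[OF clinear_kdiff]
lemmas kdiff_diff = cvp.linear_diff[OF clinear_kdiff]
lemmas kdiff_0 = cvp.linear_0[OF clinear_kdiff]

lemma mulm_sng [simp]: "mulm e (sng (u, F)) = sng (u + e, F)"
  by (simp add: mulm_def)
lemma iota_sng: "iota i (sng (u, F)) = (if i \<in> F then csc (sg i F) (sng (u, F - {i})) else 0)"
  by (simp add: iota_def)
lemma eps_sng: "eps i (sng (u, F)) = (if i \<in> F then 0 else csc (sg i F) (sng (u, insert i F)))"
  by (simp add: eps_def)

lemmas lin_simps = cvp.linear_scale[OF clinear_mulm] cvp.linear_scale[OF clinear_iota]
  cvp.linear_scale[OF clinear_eps] cvp.linear_0[OF clinear_mulm] cvp.linear_0[OF clinear_iota]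
  cvp.linear_0[OF clinear_eps]

lemma clinear_ext:
  assumes "clinear f" "clinear g" "\<And>k. f (sng k) = g (sng k)"
  shows "f = g"
  using clinear_eqI[OF assms(1,2)] assms(3) by blast

lemma mulm_mulm: "mulm a (mulm b z) = mulm b (mulm a z)"
proof -
  have "(\<lambda>z. mulm a (mulm b z)) = (\<lambda>z. mulm b (mulm a z))"
    by (rule clinear_ext[OF clinear_comp[OF clinear_mulm clinear_mulm] clinear_comp[OF clinear_mulm clinear_mulm]])
       (auto simp: ac_simps)
  then show ?thesis by (rule fun_cong)
qed

lemma iota_mulm: "iota i (mulm a z) = mulm a (iota i z)"
proof -
  have "(\<lambda>z. iota i (mulm a z)) = (\<lambda>z. mulm a (iota i z))"
    by (rule clinear_ext[OF clinear_comp[OF clinear_mulm clinear_iota] clinear_comp[OF clinear_iota clinear_mulm]])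
       (auto simp: iota_sng lin_simps)
  then show ?thesis by (rule fun_cong)
qed

lemma eps_mulm: "eps i (mulm a z) = mulm a (eps i z)"
proof -
  have "(\<lambda>z. eps i (mulm a z)) = (\<lambda>z. mulm a (eps i z))"
    by (rule clinear_ext[OF clinear_comp[OF clinear_mulm clinear_eps] clinear_comp[OF clinear_eps clinear_mulm]])
       (auto simp: eps_sng lin_simps)
  then show ?thesis by (rule fun_cong)
qed

lemma iota_iota: "iota i (iota j z) = - iota j (iota i z)"
proof -
  have "(\<lambda>z. iota i (iota j z)) = (\<lambda>z. - iota j (iota i z))"
  proof (rule clinear_ext[OF clinear_comp[OF clinear_iota clinear_iota]
        cvp.linear_compose_neg[OF clinear_comp[OF clinear_iota clinear_iota]]])
    fix k :: "(nat \<Rightarrow>\<^sub>0 nat) \<times> nat set"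
    obtain u F where k: "k = (u, F)" by fastforce
    have "F - {i} - {j} = F - {j} - {i}" by auto
    then show "iota i (iota j (sng k)) = - iota j (iota i (sng k))"
      unfolding k by (cases i j rule: linorder_cases) (auto simp: iota_sng lin_simps sg_remove mult.commute)
  qed
  then show ?thesis by (rule fun_cong)
qed

lemma eps_eps: "eps i (eps j z) = - eps j (eps i z)"
proof -
  have "(\<lambda>z. eps i (eps j z)) = (\<lambda>z. - eps j (eps i z))"
  proof (rule clinear_ext[OF clinear_comp[OF clinear_eps clinear_eps]
        cvp.linear_compose_neg[OF clinear_comp[OF clinear_eps clinear_eps]]])
    fix k :: "(nat \<Rightarrow>\<^sub>0 nat) \<times> nat set"
    obtain u F where k: "k = (u, F)" by fastforce
    have "insert i (insert j F) = insert j (insert i F)" by auto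
    then show "eps i (eps j (sng k)) = - eps j (eps i (sng k))"
      unfolding k by (cases i j rule: linorder_cases) (auto simp: eps_sng lin_simps sg_insert mult.commute)
  qed
  then show ?thesis by (rule fun_cong)
qed

text \<open>The Clifford relation; it is what makes \<open>kdiff\<close> an antiderivation in
  \<open>kdiff_form_wedge\<close>.\<close>

lemma iota_eps: "iota j (eps i z) = (if i = j then z else 0) - eps i (iota j z)"
proof -
  have lin: "clinear (\<lambda>z. if i = j then z else 0 :: chain)"
    by (auto intro!: clinearI)
  have "(\<lambda>z. iota j (eps i z)) = (\<lambda>z. (if i = j then z else 0) - eps i (iota j z))"
  proof (rule clinear_ext[OF clinear_comp[OF clinear_eps clinear_iota]
        cvp.linear_compose_sub[OF lin clinear_comp[OF clinear_iota clinear_eps]]])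
    fix k :: "(nat \<Rightarrow>\<^sub>0 nat) \<times> nat set"
    obtain u F where k: "k = (u, F)" by fastforce
    have "i \<noteq> j \<Longrightarrow> insert i F - {j} = insert i (F - {j})" by auto
    then show "iota j (eps i (sng k)) = (if i = j then sng k else 0) - eps i (iota j (sng k))"
      unfolding k by (cases i j rule: linorder_cases)
        (auto simp: eps_sng iota_sng lin_simps sg_insert sg_remove mult.commute insert_absorb)
  qed
  then show ?thesis by (rule fun_cong)
qed

lemma iota_ymul: "iota i (ymul p j z) = ymul p j (iota i z)"
  by (simp add: ymul_def iota_mulm cvp.linear_diff[OF clinear_iota])

lemma ymul_ymul: "ymul p i (ymul p j z) = ymul p j (ymul p i z)"
  using mulm_mulm[of "xm i" "xm j" z] mulm_mulm[of "xm p" "xm i" z] mulm_mulm[of "xm p" "xm j" z]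
  by (simp add: ymul_def cvp.linear_diff[OF clinear_mulm])

text \<open>The multiplications commute and the contractions anticommute, so the double sum is its
  own negative after exchanging the indices.\<close>

lemma kdiff_kdiff: "kdiff n p (kdiff n p z) = 0"
proof -
  let ?N = "{1..n} - {p}"
  let ?t = "\<lambda>i j. ymul p i (ymul p j (iota i (iota j z)))"
  have eq: "kdiff n p (kdiff n p z) = (\<Sum>i\<in>?N. \<Sum>j\<in>?N. ?t i j)"
    by (simp add: kdiff_def cvp.linear_sum[OF clinear_iota] cvp.linear_sum[OF clinear_ymul] iota_ymul)
  have anti: "?t i j = - ?t j i" for i j
    by (subst iota_iota) (simp add: ymul_ymul[of p i] cvp.linear_neg[OF clinear_ymul])
  have "(\<Sum>i\<in>?N. \<Sum>j\<in>?N. ?t i j) = (\<Sum>i\<in>?N. \<Sum>j\<in>?N. - ?t j i)"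
    by (intro sum.cong refl anti)
  also have "\<dots> = - (\<Sum>i\<in>?N. \<Sum>j\<in>?N. ?t j i)"
    by (simp only: sum_negf)
  also have "\<dots> = - (\<Sum>i\<in>?N. \<Sum>j\<in>?N. ?t i j)"
    by (subst sum.swap) simp
  finally show ?thesis unfolding eq[symmetric] by (rule eq_neg_self)
qed

section \<open>Graded pieces and relative homology of monomial ideals\<close>

definition graded :: "nat \<Rightarrow> nat \<Rightarrow> nat \<Rightarrow> nat \<Rightarrow> chain set" where
  "graded n p t s = supported_on {(u, F). u \<in> mons n s \<and> F \<subseteq> {1..n} - {p} \<and> card F = t}"

text \<open>The source of the incoming differential. It has to vanish in polynomial degree 0, where
  a truncated \<open>s - 1\<close> would give degree 0 again.\<close>

definition graded_pred :: "nat \<Rightarrow> nat \<Rightarrow> nat \<Rightarrow> nat \<Rightarrow> chain set" where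
  "graded_pred n p t s = (case s of 0 \<Rightarrow> {0} | Suc s' \<Rightarrow> graded n p t s')"

definition chains_in :: "(nat \<Rightarrow>\<^sub>0 nat) set \<Rightarrow> chain set" where
  "chains_in M = supported_on {(u, F). u \<in> M}"

definition upset :: "nat \<Rightarrow> (nat \<Rightarrow>\<^sub>0 nat) set \<Rightarrow> bool" where
  "upset n M \<longleftrightarrow> (\<forall>u\<in>M. \<forall>i\<in>{1..n}. u + xm i \<in> M)"

text \<open>Preimages of the cycles and boundaries of the Koszul complex of the module \<open>N/M\<close>, where \<open>M \<subseteq> N\<close>
  are monomial ideals.\<close>

definition rel_cycles :: "nat \<Rightarrow> nat \<Rightarrow> (nat \<Rightarrow>\<^sub>0 nat) set \<Rightarrow> (nat \<Rightarrow>\<^sub>0 nat) set \<Rightarrow> nat \<Rightarrow> nat \<Rightarrow> chain set" where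
  "rel_cycles n p N M t s = {z \<in> graded n p t s \<inter> chains_in N. kdiff n p z \<in> chains_in M}"

definition rel_bounds :: "nat \<Rightarrow> nat \<Rightarrow> (nat \<Rightarrow>\<^sub>0 nat) set \<Rightarrow> (nat \<Rightarrow>\<^sub>0 nat) set \<Rightarrow> nat \<Rightarrow> nat \<Rightarrow> chain set" where
  "rel_bounds n p N M t s = {w + kdiff n p z | w z. w \<in> graded n p t s \<inter> chains_in M \<and> z \<in> graded_pred n p (Suc t) s \<inter> chains_in N}"

lemma subspace_graded [simp]: "cvs.subspace (graded n p t s)" by (simp add: graded_def)
lemma subspace_chains_in [simp]: "cvs.subspace (chains_in M)" by (simp add: chains_in_def)
lemma subspace_graded_pred [simp]: "cvs.subspace (graded_pred n p t s)"
  by (cases s) (auto simp: graded_pred_def)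

lemma graded_pred_Suc [simp]: "graded_pred n p t (Suc s) = graded n p t s" by (simp add: graded_pred_def)

lemmas graded_add = cvs.subspace_add[OF subspace_graded]
lemmas graded_diff = cvs.subspace_diff[OF subspace_graded]
lemmas chains_in_add = cvs.subspace_add[OF subspace_chains_in]
lemmas chains_in_diff = cvs.subspace_diff[OF subspace_chains_in]
lemmas chains_in_0 [simp] = cvs.subspace_0[OF subspace_chains_in]
lemmas graded_0 [simp] = cvs.subspace_0[OF subspace_graded]
lemmas graded_pred_0 [simp] = cvs.subspace_0[OF subspace_graded_pred]

lemma chains_in_mono: "M \<subseteq> N \<Longrightarrow> chains_in M \<subseteq> chains_in N" by (auto simp: chains_in_def supported_on_def)
text \<open>With \<open>N = UNIV\<close> the module \<open>N/M\<close> is the quotient of the whole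
  polynomial ring by \<open>M\<close>, since \<open>graded\<close> already confines the monomials to
  the variables 1 to n.\<close>

lemma chains_in_UNIV [simp]: "chains_in UNIV = UNIV" by (auto simp: chains_in_def supported_on_def)

lemma subspace_rel_cycles: "cvs.subspace (rel_cycles n p N M t s)"
  by (rule cvs.subspaceI)
     (auto simp: rel_cycles_def kdiff_0 kdiff_add cvp.linear_scale[OF clinear_kdiff] graded_add chains_in_add
       intro: cvs.subspace_scale[OF subspace_graded] cvs.subspace_scale[OF subspace_chains_in])

lemma subspace_rel_bounds: "cvs.subspace (rel_bounds n p N M t s)"
proof (rule cvs.subspaceI)
  show "0 \<in> rel_bounds n p N M t s" unfolding rel_bounds_def by (rule CollectI, rule exI[of _ 0], rule exI[of _ 0]) (simp add: kdiff_0)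
  have s1: "cvs.subspace (graded n p t s \<inter> chains_in M)" and s2: "cvs.subspace (graded_pred n p (Suc t) s \<inter> chains_in N)"
    by (auto intro!: cvs.subspace_inter)
  fix x assume "x \<in> rel_bounds n p N M t s"
  then obtain w z where x: "x = w + kdiff n p z" "w \<in> graded n p t s \<inter> chains_in M" "z \<in> graded_pred n p (Suc t) s \<inter> chains_in N"
    unfolding rel_bounds_def by blast
  show "csc c x \<in> rel_bounds n p N M t s" for c
    unfolding rel_bounds_def mem_Collect_eq
    using x cvs.subspace_scale[OF s1] cvs.subspace_scale[OF s2]
    by (intro exI[of _ "csc c w"] exI[of _ "csc c z"])
       (auto simp only: cvp.linear_scale[OF clinear_kdiff] cvs.scale_right_distrib)
  fix y assume "y \<in> rel_bounds n p N M t s"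
  then obtain w' z' where y: "y = w' + kdiff n p z'" "w' \<in> graded n p t s \<inter> chains_in M" "z' \<in> graded_pred n p (Suc t) s \<inter> chains_in N"
    unfolding rel_bounds_def by blast
  show "x + y \<in> rel_bounds n p N M t s"
    unfolding rel_bounds_def mem_Collect_eq
    using x y cvs.subspace_add[OF s1] cvs.subspace_add[OF s2]
    by (intro exI[of _ "w + w'"] exI[of _ "z + z'"])
       (simp only: kdiff_add ac_simps conj_ac)
qed

lemma kdiff_sng:
  assumes "F \<subseteq> {1..n} - {p}"
  shows "kdiff n p (sng (u, F)) = (\<Sum>i\<in>F. csc (sg i F) (sng (u + xm i, F - {i}) - sng (u + xm p, F - {i})))"
proof -
  have "kdiff n p (sng (u, F)) = (\<Sum>i\<in>F. ymul p i (iota i (sng (u, F))))"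
    unfolding kdiff_def using assms
    by (intro sum.mono_neutral_right) (auto simp: iota_sng cvp.linear_0[OF clinear_ymul])
  also have "\<dots> = (\<Sum>i\<in>F. csc (sg i F) (sng (u + xm i, F - {i}) - sng (u + xm p, F - {i})))"
    by (intro sum.cong refl) (simp add: iota_sng cvp.linear_scale[OF clinear_ymul], simp add: ymul_def)
  finally show ?thesis .
qed

lemma kdiff_graded:
  assumes "p \<in> {1..n}" "z \<in> graded n p (Suc t) s"
  shows "kdiff n p z \<in> graded n p t (Suc s)"
proof (rule clinear_supported_on[OF clinear_kdiff assms(2)[unfolded graded_def]])
  fix k assume "k \<in> {(u, F). u \<in> mons n s \<and> F \<subseteq> {1..n} - {p} \<and> card F = Suc t}"
  then obtain u F where k: "k = (u, F)" "u \<in> mons n s" "F \<subseteq> {1..n} - {p}" "card F = Suc t" by auto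
  then have "finite F" by (metis card.infinite nat.distinct(1))
  with k assms(1) show "kdiff n p (sng k) \<in> graded n p t (Suc s)"
    unfolding k(1) kdiff_sng[OF k(3)] graded_def by (intro supported_on_sum supported_on_csc supported_on_diff) (auto intro!: mons_xm)
qed simp

lemma kdiff_graded_0:
  assumes "z \<in> graded n p 0 s"
  shows "kdiff n p z = 0"
proof -
  have "kdiff n p z \<in> {0}"
  proof (rule clinear_supported_on[OF clinear_kdiff assms(1)[unfolded graded_def]])
    fix k assume "k \<in> {(u, F). u \<in> mons n s \<and> F \<subseteq> {1..n} - {p} \<and> card F = 0}"
    then obtain u F where k: "k = (u, F)" "F \<subseteq> {1..n} - {p}" "card F = 0" by auto
    then have "F = {}" by (metis card_0_eq finite_Diff finite_atLeastAtMost finite_subset)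
    then show "kdiff n p (sng k) \<in> {0}" unfolding k(1) kdiff_sng[OF k(2)] by simp
  qed simp
  then show ?thesis by simp
qed

lemma ymul_chains_in: "p \<in> {1..n} \<Longrightarrow> i \<in> {1..n} \<Longrightarrow> upset n M \<Longrightarrow> z \<in> chains_in M \<Longrightarrow> ymul p i z \<in> chains_in M"
  unfolding chains_in_def
  by (erule clinear_supported_on[OF clinear_ymul]) (auto simp: ymul_def upset_def intro!: supported_on_diff)

lemma iota_chains_in: "z \<in> chains_in M \<Longrightarrow> iota i z \<in> chains_in M"
  unfolding chains_in_def by (erule clinear_supported_on[OF clinear_iota]) (auto simp: iota_sng intro!: supported_on_csc)

lemma eps_chains_in: "z \<in> chains_in M \<Longrightarrow> eps i z \<in> chains_in M"
  unfolding chains_in_def by (erule clinear_supported_on[OF clinear_eps]) (auto simp: eps_sng intro!: supported_on_csc)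

lemma kdiff_chains_in: "p \<in> {1..n} \<Longrightarrow> upset n M \<Longrightarrow> z \<in> chains_in M \<Longrightarrow> kdiff n p z \<in> chains_in M"
  unfolding kdiff_def by (intro cvs.subspace_sum subspace_chains_in ymul_chains_in iota_chains_in) auto

lemma rel_boundsI: "w \<in> graded n p t s \<Longrightarrow> w \<in> chains_in M \<Longrightarrow> z \<in> graded_pred n p (Suc t) s \<Longrightarrow> z \<in> chains_in N \<Longrightarrow> w + kdiff n p z \<in> rel_bounds n p N M t s"
  unfolding rel_bounds_def by blast

lemma rel_boundsE:
  assumes "x \<in> rel_bounds n p N M t s"
  obtains w z where "x = w + kdiff n p z" "w \<in> graded n p t s" "w \<in> chains_in M" "z \<in> graded_pred n p (Suc t) s" "z \<in> chains_in N"
  using assms unfolding rel_bounds_def by blast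

lemma kdiff_graded_pred: "p \<in> {1..n} \<Longrightarrow> z \<in> graded_pred n p (Suc t) s \<Longrightarrow> kdiff n p z \<in> graded n p t s"
  by (cases s) (auto simp: kdiff_0 graded_pred_def intro: kdiff_graded)

lemma rel_bounds_subset_rel_cycles:
  assumes "p \<in> {1..n}" "upset n M" "upset n N" "M \<subseteq> N"
  shows "rel_bounds n p N M t s \<subseteq> rel_cycles n p N M t s"
proof
  fix x assume "x \<in> rel_bounds n p N M t s"
  then obtain w z where x: "x = w + kdiff n p z" "w \<in> graded n p t s" "w \<in> chains_in M" "z \<in> graded_pred n p (Suc t) s" "z \<in> chains_in N"
    by (rule rel_boundsE)
  then show "x \<in> rel_cycles n p N M t s"
    using assms chains_in_mono[OF assms(4)] kdiff_graded_pred[OF assms(1) x(4)] kdiff_chains_in[OF assms(1,3) x(5)]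
    by (auto simp: rel_cycles_def kdiff_add kdiff_kdiff intro!: graded_add chains_in_add kdiff_chains_in)
qed

section \<open>Dimension formulas from short exact sequences\<close>

text \<open>Long exact sequence of \<open>0 \<rightarrow> M'/M \<rightarrow> S/M \<rightarrow> S/M' \<rightarrow> 0\<close>: the maps from the homology of \<open>M'/M\<close> to
  that of \<open>S/M\<close> are zero, since the former lives in degrees \<open>\<ge> r\<close> and the latter in degrees \<open>< r\<close>.\<close>

lemma step_extend:
  assumes p: "p \<in> {1..n}" and M: "upset n M" "upset n M'" "M \<subseteq> M'"
    and van: "\<And>t s. r \<le> s \<Longrightarrow> rel_cycles n p UNIV M t s \<subseteq> rel_bounds n p UNIV M t s"
    and deg: "\<And>u. u \<in> M' \<Longrightarrow> r \<le> monom_degree u"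
    and d1: "qdim (rel_cycles n p UNIV M t s) (rel_bounds n p UNIV M t s) d1"
    and d2: "case t of 0 \<Rightarrow> d2 = 0 | Suc t' \<Rightarrow> qdim (rel_cycles n p M' M t' (Suc s)) (rel_bounds n p M' M t' (Suc s)) d2"
  shows "qdim (rel_cycles n p UNIV M' t s) (rel_bounds n p UNIV M' t s) (d1 + d2)"
proof -
  have up: "upset n UNIV" by (simp add: upset_def)
  \<comment> \<open>\<open>M'\<close> has no monomials of degree below \<open>r\<close>.\<close>
  have small: "x = 0" if "x \<in> graded n p t s" "x \<in> chains_in M'" "s < r" for x t s
  proof -
    have "k \<notin> keys x" for k
    proof
      assume "k \<in> keys x"
      then have "fst k \<in> mons n s" "fst k \<in> M'" using that by (auto simp: graded_def chains_in_def supported_on_def)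
      then show False using deg[of "fst k"] that(3) by (auto simp: mons_def)
    qed
    then show ?thesis by (auto simp: poly_mapping_eq_iff fun_eq_iff in_keys_iff)
  qed
  have Z_sub: "rel_cycles n p UNIV M t s \<subseteq> rel_cycles n p UNIV M' t s" using chains_in_mono[OF M(3)] by (auto simp: rel_cycles_def)
  have B_sub: "rel_bounds n p UNIV M t s \<subseteq> rel_bounds n p UNIV M' t s"
    using chains_in_mono[OF M(3)] by (auto elim!: rel_boundsE intro!: rel_boundsI)
  have BZ: "rel_bounds n p UNIV M' t s \<subseteq> rel_cycles n p UNIV M' t s" by (rule rel_bounds_subset_rel_cycles) (use p M up in auto)
  \<comment> \<open>Injectivity of the map from the homology modulo \<open>M\<close> to that modulo
    \<open>M'\<close>: from degree \<open>r\<close> on its source is zero, and below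
    \<open>r\<close> the two ideals impose the same conditions.\<close>
  have inj: "a \<in> rel_bounds n p UNIV M t s" if a: "a \<in> rel_cycles n p UNIV M t s" "a \<in> rel_bounds n p UNIV M' t s" for a
  proof (cases "r \<le> s")
    case True
    then show ?thesis using van a by blast
  next
    case False
    from a(2) obtain w z where z: "a = w + kdiff n p z" "w \<in> graded n p t s" "w \<in> chains_in M'" "z \<in> graded_pred n p (Suc t) s"
      by (rule rel_boundsE)
    then have "w = 0" using small False by auto
    then show ?thesis using z rel_boundsI[of 0 n p t s M z UNIV] by simp
  qed
  have span: "cvs.span (rel_cycles n p UNIV M t s) = rel_cycles n p UNIV M t s"
    by (simp add: cvs.span_eq_iff subspace_rel_cycles)
  show ?thesis
  proof (cases t)
    case 0
    \<comment> \<open>In exterior degree 0 \<open>kdiff\<close> vanishes, so the third term of the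
      sequence is zero.\<close>
    have "qdim (rel_cycles n p UNIV M' t s) (rel_bounds n p UNIV M' t s) (d1 + 0)"
    proof (rule qdim_exact[where f = "kdiff n p" and ?W2.0 = "{0}" and ?U2.0 = "{0}", OF clinear_kdiff subspace_rel_cycles subspace_rel_bounds subspace_rel_bounds _ d1 _ BZ Z_sub B_sub])
      have kd0: "kdiff n p a = 0" if "a \<in> rel_cycles n p N L t s" for a N L
        using that 0 kdiff_graded_0 by (auto simp: rel_cycles_def)
      show "cvs.subspace {0::chain}" by simp
      show "qdim {0::chain} {0} 0" by (simp add: qdim_0_iff)
      show "kdiff n p a \<in> {0}" if "a \<in> rel_cycles n p UNIV M t s" for a using kd0[OF that] by simp
      show "kdiff n p a \<in> {0}" if "a \<in> rel_cycles n p UNIV M' t s" for a using kd0[OF that] by simp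
      show "kdiff n p a \<in> {0}" if "a \<in> rel_bounds n p UNIV M' t s" for a using kd0[of a UNIV M'] BZ that by blast
      show "a \<in> rel_bounds n p UNIV M t s" if "a \<in> cvs.span (rel_cycles n p UNIV M t s)" "a \<in> rel_bounds n p UNIV M' t s" for a
        using that inj unfolding span by blast
      show "\<exists>a\<in>rel_cycles n p UNIV M t s. u - a \<in> rel_bounds n p UNIV M' t s" if "u \<in> rel_cycles n p UNIV M' t s" for u
        using that 0 by (intro bexI[of _ u]) (auto simp: cvs.subspace_0 subspace_rel_bounds rel_cycles_def kdiff_graded_0)
      show "\<exists>u\<in>rel_cycles n p UNIV M' t s. v - kdiff n p u \<in> {0}" if "v \<in> {0}" for v
        using that by (intro bexI[of _ 0]) (auto simp: kdiff_0 cvs.subspace_0 subspace_rel_cycles)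
    qed
    then show ?thesis using d2 0 by simp
  next
    case (Suc t')
    then have d2': "qdim (rel_cycles n p M' M t' (Suc s)) (rel_bounds n p M' M t' (Suc s)) d2" using d2 by simp
    \<comment> \<open>\<open>kdiff\<close> itself induces the connecting map, as the boundary of a
      cycle modulo \<open>M'\<close> has coefficients in \<open>M'\<close>. It takes (t, s) to (t -
      1, s + 1).\<close>
    show ?thesis
    proof (rule qdim_exact[where f = "kdiff n p", OF clinear_kdiff subspace_rel_cycles subspace_rel_bounds subspace_rel_bounds subspace_rel_bounds d1 d2' BZ Z_sub B_sub])
      show "kdiff n p a \<in> rel_bounds n p M' M t' (Suc s)" if "a \<in> rel_cycles n p UNIV M t s" for a
        using that Suc rel_boundsI[of "kdiff n p a" n p t' "Suc s" M 0 M'] p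
        by (auto simp: rel_cycles_def kdiff_0 kdiff_graded)
      show "kdiff n p a \<in> rel_bounds n p M' M t' (Suc s)" if "a \<in> rel_bounds n p UNIV M' t s" for a
      proof -
        from that obtain w z where z: "a = w + kdiff n p z" "w \<in> graded n p t s" "w \<in> chains_in M'" by (rule rel_boundsE)
        then show ?thesis using Suc rel_boundsI[of 0 n p t' "Suc s" M w M'] by (simp add: kdiff_add kdiff_kdiff)
      qed
      show "a \<in> rel_bounds n p UNIV M t s" if "a \<in> cvs.span (rel_cycles n p UNIV M t s)" "a \<in> rel_bounds n p UNIV M' t s" for a
        using that inj unfolding span by blast
      show "kdiff n p u \<in> rel_cycles n p M' M t' (Suc s)" if "u \<in> rel_cycles n p UNIV M' t s" for u
        using that Suc p by (auto simp: rel_cycles_def kdiff_kdiff kdiff_graded)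
      show "\<exists>a\<in>rel_cycles n p UNIV M t s. u - a \<in> rel_bounds n p UNIV M' t s"
        if u: "u \<in> rel_cycles n p UNIV M' t s" "kdiff n p u \<in> rel_bounds n p M' M t' (Suc s)" for u
      proof -
        from u(2) obtain w z where z: "kdiff n p u = w + kdiff n p z" "w \<in> chains_in M" "z \<in> graded n p t s" "z \<in> chains_in M'"
          using Suc by (auto elim!: rel_boundsE)
        have "u - z \<in> rel_cycles n p UNIV M t s" using u z by (auto simp: rel_cycles_def kdiff_diff graded_diff)
        moreover have "u - (u - z) \<in> rel_bounds n p UNIV M' t s"
          using z rel_boundsI[of z n p t s M' 0 UNIV] by (simp add: kdiff_0)
        ultimately show ?thesis by blast
      qed
      \<comment> \<open>From degree \<open>r\<close> on, \<open>van\<close> makes \<open>v\<close> a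
        boundary modulo \<open>M\<close>, and a chain bounding it is the preimage; below degree
        \<open>r\<close> the only \<open>v\<close> is 0.\<close>
      show "\<exists>u\<in>rel_cycles n p UNIV M' t s. v - kdiff n p u \<in> rel_bounds n p M' M t' (Suc s)" if v: "v \<in> rel_cycles n p M' M t' (Suc s)" for v
      proof (cases "r \<le> Suc s")
        case True
        have "v \<in> rel_cycles n p UNIV M t' (Suc s)" using v by (auto simp: rel_cycles_def)
        then have "v \<in> rel_bounds n p UNIV M t' (Suc s)" using van True by blast
        then obtain w z where z: "v = w + kdiff n p z" "w \<in> graded n p t' (Suc s)" "w \<in> chains_in M" "z \<in> graded n p t s"
          using Suc by (auto elim!: rel_boundsE)
        have "kdiff n p z = v - w" using z by simp
        also have "\<dots> \<in> chains_in M'" by (rule chains_in_diff) (use v z chains_in_mono[OF M(3)] in \<open>auto simp: rel_cycles_def\<close>)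
        finally have "z \<in> rel_cycles n p UNIV M' t s" using z by (auto simp: rel_cycles_def)
        moreover have "v - kdiff n p z \<in> rel_bounds n p M' M t' (Suc s)"
          using z rel_boundsI[of w n p t' "Suc s" M 0 M'] by (simp add: kdiff_0)
        ultimately show ?thesis by blast
      next
        case False
        then have "v = 0" using small v by (auto simp: rel_cycles_def)
        then show ?thesis
          by (intro bexI[of _ 0]) (auto simp: kdiff_0 cvs.subspace_0 subspace_rel_cycles subspace_rel_bounds)
      qed
    qed
  qed
qed

text \<open>In the same sequence, now the connecting maps are zero.\<close>

lemma step_restrict:
  assumes p: "p \<in> {1..n}" and M: "upset n M" "upset n M'" "M \<subseteq> M'"
    and van: "\<And>t s. rel_cycles n p UNIV M' (Suc t) s \<subseteq> rel_bounds n p UNIV M' (Suc t) s"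
    and d1: "qdim (rel_cycles n p M' M t s) (rel_bounds n p M' M t s) d1"
    and d2: "qdim (rel_cycles n p UNIV M' t s) (rel_bounds n p UNIV M' t s) d2"
  shows "qdim (rel_cycles n p UNIV M t s) (rel_bounds n p UNIV M t s) (d1 + d2)"
proof (rule qdim_exact[where f = "\<lambda>z. z", OF clinear_id subspace_rel_cycles subspace_rel_bounds subspace_rel_bounds subspace_rel_bounds d1 d2])
  have up: "upset n UNIV" by (simp add: upset_def)
  show "rel_bounds n p UNIV M t s \<subseteq> rel_cycles n p UNIV M t s" by (rule rel_bounds_subset_rel_cycles) (use p M up in auto)
  show "rel_cycles n p M' M t s \<subseteq> rel_cycles n p UNIV M t s" by (auto simp: rel_cycles_def)
  show "rel_bounds n p M' M t s \<subseteq> rel_bounds n p UNIV M t s" by (auto elim!: rel_boundsE intro!: rel_boundsI)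
  show "a \<in> rel_bounds n p UNIV M' t s" if "a \<in> rel_cycles n p M' M t s" for a
    using that rel_boundsI[of a n p t s M' 0 UNIV] by (simp add: rel_cycles_def kdiff_0)
  show "a \<in> rel_bounds n p UNIV M' t s" if "a \<in> rel_bounds n p UNIV M t s" for a
    using that chains_in_mono[OF M(3)] by (auto elim!: rel_boundsE intro!: rel_boundsI)
  show "u \<in> rel_cycles n p UNIV M' t s" if "u \<in> rel_cycles n p UNIV M t s" for u
    using that chains_in_mono[OF M(3)] by (auto simp: rel_cycles_def)
  show "\<exists>a\<in>rel_cycles n p M' M t s. u - a \<in> rel_bounds n p UNIV M t s"
    if u: "u \<in> rel_cycles n p UNIV M t s" "u \<in> rel_bounds n p UNIV M' t s" for u
  proof -
    from u(2) obtain w z where z: "u = w + kdiff n p z" "w \<in> graded n p t s" "w \<in> chains_in M'" "z \<in> graded_pred n p (Suc t) s"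
      by (rule rel_boundsE)
    have "kdiff n p w = kdiff n p u" using z by (simp add: kdiff_add kdiff_kdiff)
    then have "w \<in> rel_cycles n p M' M t s" using u z by (auto simp: rel_cycles_def)
    moreover have "u - w \<in> rel_bounds n p UNIV M t s" using z rel_boundsI[of 0 n p t s M z UNIV] by simp
    ultimately show ?thesis by blast
  qed
  show "a \<in> rel_bounds n p M' M t s" if a: "a \<in> cvs.span (rel_cycles n p M' M t s)" "a \<in> rel_bounds n p UNIV M t s" for a
  proof -
    have "cvs.span (rel_cycles n p M' M t s) = rel_cycles n p M' M t s" by (simp add: cvs.span_eq_iff subspace_rel_cycles)
    with a have aZ: "a \<in> rel_cycles n p M' M t s" by simp
    from a(2) obtain w z where z: "a = w + kdiff n p z" "w \<in> graded n p t s" "w \<in> chains_in M" "z \<in> graded_pred n p (Suc t) s"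
      by (rule rel_boundsE)
    show ?thesis
    proof (cases s)
      case 0
      then have "z = 0" using z by (simp add: graded_pred_def)
      then show ?thesis using z rel_boundsI[of w n p t s M 0 M'] by simp
    next
      case (Suc s')
      \<comment> \<open>\<open>z\<close> is a cycle modulo \<open>M'\<close> of positive exterior
        degree; by \<open>van\<close> some \<open>w'\<close> with coefficients in \<open>M'\<close>
        has the same boundary and can replace it.\<close>
      have "kdiff n p z = a - w" using z by simp
      also have "\<dots> \<in> chains_in M'" by (rule chains_in_diff) (use aZ z chains_in_mono[OF M(3)] in \<open>auto simp: rel_cycles_def\<close>)
      finally have "z \<in> rel_cycles n p UNIV M' (Suc t) s'" using z Suc by (auto simp: rel_cycles_def)
      then have "z \<in> rel_bounds n p UNIV M' (Suc t) s'" using van by blast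
      then obtain w' z' where z': "z = w' + kdiff n p z'" "w' \<in> graded n p (Suc t) s'" "w' \<in> chains_in M'" by (rule rel_boundsE)
      then show ?thesis using z rel_boundsI[of w n p t s M w' M'] Suc by (simp add: kdiff_add kdiff_kdiff)
    qed
  qed
  \<comment> \<open>In exterior degree 0 every chain is a cycle; in positive degree the target is
    zero by \<open>van\<close>, so 0 is a preimage.\<close>
  show "\<exists>u\<in>rel_cycles n p UNIV M t s. v - u \<in> rel_bounds n p UNIV M' t s" if v: "v \<in> rel_cycles n p UNIV M' t s" for v
  proof (cases t)
    case 0
    then have "v \<in> rel_cycles n p UNIV M t s" using v by (auto simp: rel_cycles_def kdiff_graded_0)
    then show ?thesis by (intro bexI[of _ v]) (auto simp: cvs.subspace_0 subspace_rel_bounds)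
  next
    case (Suc t')
    then have "v \<in> rel_bounds n p UNIV M' t s" using van v by blast
    then show ?thesis by (intro bexI[of _ 0]) (auto simp: cvs.subspace_0 subspace_rel_cycles)
  qed
qed

section \<open>Homology of one step of the filtration\<close>

text \<open>\<open>R\<close> is the monomial basis of \<open>(M \<union> R)/M\<close>, which
  division by \<open>m\<close> identifies with the polynomial ring modulo the variables of
  \<open>Q\<close>. Choosing the root in \<open>Q\<close> lets \<open>x_p\<close> act as zero, so
  \<open>x_i - x_p\<close> acts as \<open>x_i\<close>.\<close>

locale relative_step =
  fixes n p r :: nat and Q :: "nat set" and m :: "nat \<Rightarrow>\<^sub>0 nat" and M R :: "(nat \<Rightarrow>\<^sub>0 nat) set"
  assumes pQ: "p \<in> Q" and Qn: "Q \<subseteq> {1..n}" and m: "m \<in> mons n r"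
    and R_def: "R = {m + u | u. keys u \<subseteq> {1..n} - Q}"
    and disj: "M \<inter> R = {}"
    and QM: "\<And>w j. w \<in> R \<Longrightarrow> j \<in> Q \<Longrightarrow> w + xm j \<in> M"
    and M: "upset n M"
begin

lemma p_ground: "p \<in> {1..n}" using pQ Qn by auto

text \<open>The contracting homotopy raises the exterior degree at the smallest index occurring in a
  basis element, indices in \<open>Q\<close> being ignored.\<close>

definition supp :: "(nat \<Rightarrow>\<^sub>0 nat) \<Rightarrow> nat set \<Rightarrow> nat set" where
  "supp w F = (keys (w - m) \<union> F) - Q"

definition contract_sng :: "(nat \<Rightarrow>\<^sub>0 nat) \<Rightarrow> nat set \<Rightarrow> chain" where
  "contract_sng w F = (if w \<in> R \<and> supp w F \<noteq> {} \<and> Min (supp w F) \<notin> F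
     then csc (sg (Min (supp w F)) F) (sng (w - xm (Min (supp w F)), insert (Min (supp w F)) F)) else 0)"

definition contract :: "chain \<Rightarrow> chain" where
  "contract = lin (\<lambda>(w, F). contract_sng w F)"

text \<open>Projection onto the basis elements over \<open>R\<close> with empty \<open>supp\<close>,
  where the homotopy finds no index to move. They represent the homology.\<close>

definition crit :: "chain \<Rightarrow> chain" where
  "crit = lin (\<lambda>(w, F). if w = m \<and> F \<subseteq> Q then sng (w, F) else 0)"

lemma clinear_contract: "clinear contract" unfolding contract_def by (rule clinear_lin)
lemma clinear_crit: "clinear crit" unfolding crit_def by (rule clinear_lin)

lemma contract_sng [simp]: "contract (sng (w, F)) = contract_sng w F" by (simp add: contract_def)
lemma crit_sng [simp]: "crit (sng (w, F)) = (if w = m \<and> F \<subseteq> Q then sng (w, F) else 0)"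
  by (simp add: crit_def)

lemma contract_chains_in: "z \<in> chains_in M \<Longrightarrow> contract z = 0"
proof -
  assume "z \<in> chains_in M"
  then have "contract z \<in> {0}" unfolding chains_in_def
    by (rule clinear_supported_on[OF clinear_contract]) (use disj in \<open>auto simp: contract_sng_def\<close>)
  then show ?thesis by simp
qed

lemma R_I: "keys u \<subseteq> {1..n} - Q \<Longrightarrow> m + u \<in> R" by (auto simp: R_def)

lemma m_R: "m \<in> R" using R_I[of 0] by simp

text \<open>The variables of \<open>Q\<close>, and \<open>x_p\<close> among them, carry
  \<open>R\<close> into \<open>M\<close>; only the terms with \<open>j\<close> outside
  \<open>Q\<close> survive.\<close>

lemma kdiff_R:
  assumes w: "w \<in> R" and F: "F \<subseteq> {1..n} - {p}"
  shows "kdiff n p (sng (w, F)) - (\<Sum>j\<in>F - Q. csc (sg j F) (sng (w + xm j, F - {j}))) \<in> chains_in M"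
proof -
  have fin: "finite F" using F finite_subset by blast
  have "kdiff n p (sng (w, F)) - (\<Sum>j\<in>F - Q. csc (sg j F) (sng (w + xm j, F - {j})))
     = (\<Sum>j\<in>F. csc (sg j F) (sng (w + xm j, F - {j}) - sng (w + xm p, F - {j})))
       - (\<Sum>j\<in>F. if j \<in> Q then 0 else csc (sg j F) (sng (w + xm j, F - {j})))"
    unfolding kdiff_sng[OF F] using fin by (simp add: sum.If_cases Diff_eq)
  also have "\<dots> = (\<Sum>j\<in>F. csc (sg j F) ((if j \<in> Q then sng (w + xm j, F - {j}) else 0) - sng (w + xm p, F - {j})))"
    unfolding sum_subtractf[symmetric] by (intro sum.cong refl) (simp add: cvs.scale_right_diff_distrib)
  also have "\<dots> \<in> chains_in M"
    unfolding chains_in_def using QM[OF w] pQ by (intro supported_on_sum supported_on_csc supported_on_diff) auto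
  finally show ?thesis .
qed

lemma contract_kdiff_R:
  assumes w: "w \<in> R" and F: "F \<subseteq> {1..n} - {p}"
  shows "contract (kdiff n p (sng (w, F))) = (\<Sum>j\<in>F - Q. csc (sg j F) (contract_sng (w + xm j) (F - {j})))"
proof -
  have "contract (kdiff n p (sng (w, F)) - (\<Sum>j\<in>F - Q. csc (sg j F) (sng (w + xm j, F - {j})))) = 0"
    by (rule contract_chains_in[OF kdiff_R[OF assms]])
  then show ?thesis
    by (simp add: cvp.linear_diff[OF clinear_contract] cvp.linear_sum[OF clinear_contract] cvp.linear_scale[OF clinear_contract])
qed

text \<open>The differential moves an index from the wedge part to the monomial, and the union of
  the two does not change. All surviving terms of a boundary thus share the index used by the
  homotopy.\<close>

lemma supp_step:
  assumes "w \<in> R" "j \<in> F" "j \<notin> Q"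
  shows "supp (w + xm j) (F - {j}) = supp w F"
proof -
  from assms(1) obtain u where "w = m + u" by (auto simp: R_def)
  then show ?thesis using assms by (auto simp: supp_def add.assoc)
qed

text \<open>Modulo \<open>M\<close>, \<open>contract\<close> is a homotopy between the identity and
  \<open>crit\<close>. By \<open>supp_step\<close> a single index \<open>i\<close> governs the cell
  and its boundary, and cells are paired by moving \<open>i\<close> between the monomial and the
  wedge part.\<close>

lemma homotopy:
  assumes w: "w \<in> R" and F: "F \<subseteq> {1..n} - {p}"
  shows "kdiff n p (contract_sng w F) + contract (kdiff n p (sng (w, F))) - sng (w, F) + crit (sng (w, F)) \<in> chains_in M"
proof -
  from w obtain u where u: "w = m + u" "keys u \<subseteq> {1..n} - Q" by (auto simp: R_def)
  have finF: "finite F" using F finite_subset by blast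
  have supp_eq: "supp w F = keys u \<union> (F - Q)" using u by (auto simp: supp_def)
  have up: "w + xm j \<in> R" if "j \<in> F - Q" for j
    using u R_I[of "u + xm j"] that F by (auto simp: add.assoc)
  show ?thesis
  proof (cases "supp w F = {}")
    case True
    then have "u = 0" "F \<subseteq> Q" unfolding supp_eq
      by (auto simp: poly_mapping_eq_iff fun_eq_iff in_keys_iff)
    then have "crit (sng (w, F)) = sng (w, F)" "F - Q = {}" using u by auto
    moreover have "contract_sng w F = 0" using True by (simp add: contract_sng_def)
    moreover have "contract (kdiff n p (sng (w, F))) = 0"
      unfolding contract_kdiff_R[OF w F] \<open>F - Q = {}\<close> by simp
    ultimately show ?thesis by (simp add: kdiff_0 del: crit_sng)
  next
    case False
    define i where "i = Min (supp w F)"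
    have "finite (supp w F)" using finF by (auto simp: supp_def)
    then have iS: "i \<in> supp w F" using False by (auto simp: i_def)
    then have i: "i \<notin> Q" "i \<in> {1..n}" "i \<noteq> p" unfolding supp_eq using u F pQ by auto
    have "crit (sng (w, F)) = 0" using False[unfolded supp_eq] u by auto
    have contract_sng_step: "contract_sng (w + xm j) (F - {j}) = (if i \<in> F - {j} then 0 else csc (sg i (F - {j})) (sng (w + xm j - xm i, insert i (F - {j}))))"
      if "j \<in> F - Q" for j
      using supp_step[OF w, of j F] that up[OF that] False by (auto simp: contract_sng_def i_def)
    have contract_sng_w: "contract_sng w F = (if i \<in> F then 0 else csc (sg i F) (sng (w - xm i, insert i F)))"
      using w False by (auto simp: contract_sng_def i_def)
    show ?thesis
    proof (cases "i \<in> F")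
      case True
      \<comment> \<open>With \<open>i\<close> in \<open>F\<close> the only boundary term that can be
        contracted is the one from which \<open>i\<close> was removed, and contracting it restores
        the cell.\<close>
      have "contract (kdiff n p (sng (w, F))) = (\<Sum>j\<in>F - Q. if j = i then sng (w, F) else 0)"
        unfolding contract_kdiff_R[OF w F]
      proof (intro sum.cong refl)
        fix j assume j: "j \<in> F - Q"
        have "w + xm j - xm j = w" by simp
        then show "csc (sg j F) (contract_sng (w + xm j) (F - {j})) = (if j = i then sng (w, F) else 0)"
          unfolding contract_sng_step[OF j] using True j by (auto simp: insert_absorb)
      qed
      also have "\<dots> = sng (w, F)" using finF True i by simp
      finally show ?thesis using contract_sng_w True \<open>crit (sng (w, F)) = 0\<close> by (simp add: kdiff_0)
    next
      case iF: False
      \<comment> \<open>Now \<open>i\<close> divides the monomial, so the cell is, up to sign, the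
        \<open>i\<close>-term of the boundary of \<open>(w', insert i F)\<close>.\<close>
      with iS have "i \<in> keys u" unfolding supp_eq by auto
      then obtain v where v: "u = v + xm i" by (rule monom_split_var)
      define w' where "w' = m + v"
      have w': "w = w' + xm i" "w' \<in> R" using u v R_I[of v] by (auto simp: w'_def add.assoc)
      have w'_j: "w + xm j - xm i = w' + xm j" for j
      proof -
        have "w + xm j = (w' + xm j) + xm i" by (simp add: w'(1) ac_simps)
        then show ?thesis by (simp only: add_diff_cancel_right')
      qed
      let ?F = "insert i F"
      have F': "?F \<subseteq> {1..n} - {p}" using F i by auto
      let ?S = "\<lambda>G. \<Sum>j\<in>G. csc (sg j ?F) (sng (w' + xm j, ?F - {j}))"
      have "kdiff n p (sng (w', ?F)) - ?S (?F - Q) \<in> chains_in M" by (rule kdiff_R[OF w'(2) F'])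
      moreover have "?F - Q = insert i (F - Q)" using i by auto
      then have "?S (?F - Q) = csc (sg i F) (sng (w, F)) + ?S (F - Q)"
        using iF finF w' by simp
      ultimately have "csc (sg i F) (kdiff n p (sng (w', ?F)) - (csc (sg i F) (sng (w, F)) + ?S (F - Q))) \<in> chains_in M"
        by (simp add: cvs.subspace_scale)
      \<comment> \<open>Inserting \<open>i\<close> before or after removing \<open>j\<close> differs
        by a sign, so the other boundary terms cancel.\<close>
      moreover have "contract (kdiff n p (sng (w, F))) = - csc (sg i F) (?S (F - Q))"
        unfolding contract_kdiff_R[OF w F] cvs.scale_sum_right sum_negf[symmetric]
      proof (intro sum.cong refl)
        fix j assume j: "j \<in> F - Q"
        then have "insert i (F - {j}) = insert i F - {j}" "i \<noteq> j" using iF by auto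
        then show "csc (sg j F) (contract_sng (w + xm j) (F - {j})) = - csc (sg i F) (csc (sg j ?F) (sng (w' + xm j, ?F - {j})))"
          unfolding contract_sng_step[OF j] using iF j
          by (cases i j rule: linorder_cases) (auto simp: w'_j sg_remove sg_insert mult.commute)
      qed
      moreover have "w - xm i = w'" using w' by simp
      then have "kdiff n p (contract_sng w F) = csc (sg i F) (kdiff n p (sng (w', ?F)))"
        using contract_sng_w iF by (simp add: cvp.linear_scale[OF clinear_kdiff])
      ultimately show ?thesis using \<open>crit (sng (w, F)) = 0\<close>
        by (simp add: cvs.scale_right_diff_distrib cvs.scale_right_distrib algebra_simps)
    qed
  qed
qed

text \<open>The homotopy divides the monomial by a variable, so it lowers the polynomial degree and
  gives 0 in degree 0.\<close>

lemma contract_graded: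
  assumes "z \<in> graded n p t s" "z \<in> chains_in (M \<union> R)"
  shows "contract z \<in> graded_pred n p (Suc t) s \<inter> chains_in (M \<union> R)"
proof (rule clinear_supported_on[OF clinear_contract])
  show "z \<in> supported_on {(u, F). u \<in> mons n s \<and> F \<subseteq> {1..n} - {p} \<and> card F = t}"
    using assms(1) by (simp add: graded_def)
  fix k assume "k \<in> {(u, F). u \<in> mons n s \<and> F \<subseteq> {1..n} - {p} \<and> card F = t}"
  then obtain w F where k: "k = (w, F)" "w \<in> mons n s" "F \<subseteq> {1..n} - {p}" "card F = t" by auto
  show "contract (sng k) \<in> graded_pred n p (Suc t) s \<inter> chains_in (M \<union> R)"
  proof (cases "w \<in> R \<and> supp w F \<noteq> {} \<and> Min (supp w F) \<notin> F")
    case False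
    then show ?thesis unfolding k(1) by (auto simp: contract_sng_def)
  next
    case True
    then obtain u where u: "w = m + u" "keys u \<subseteq> {1..n} - Q" by (auto simp: R_def)
    define i where "i = Min (supp w F)"
    have finF: "finite F" using k finite_subset by blast
    then have "i \<in> supp w F" using True unfolding i_def by (intro Min_in) (auto simp: supp_def)
    then have iu: "i \<in> keys u" "i \<notin> F" "i \<notin> Q" using True u by (auto simp: supp_def i_def)
    then obtain v where v: "u = v + xm i" by (metis monom_split_var)
    have w: "w = (m + v) + xm i" "m + v \<in> R" using u v R_I[of v] by (auto simp: add.assoc)
    then obtain s' where s: "s = Suc s'" "m + v \<in> mons n s'" using k by (auto simp: mons_def)
    have "w - xm i = m + v" using w by simp
    then have "contract (sng k) = csc (sg i F) (sng (m + v, insert i F))"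
      unfolding k(1) using True by (simp add: contract_sng_def i_def)
    moreover have "sng (m + v, insert i F) \<in> graded_pred n p (Suc t) s \<inter> chains_in (M \<union> R)"
      using s w iu k u finF pQ by (auto simp: graded_def chains_in_def)
    ultimately show ?thesis by (simp add: cvs.subspace_scale cvs.subspace_inter)
  qed
qed (auto intro!: cvs.subspace_inter)

text \<open>The homology has as basis the critical cells, \<open>m\<close> with a
  \<open>t\<close>-element subset of \<open>Q - {p}\<close>. They exist only in the degree
  \<open>r\<close> of \<open>m\<close>, are never hit by boundaries, and by \<open>homotopy\<close>
  every cycle is homologous to a combination of them.\<close>

lemma relative_homology:
  "qdim (rel_cycles n p (M \<union> R) M t s) (rel_bounds n p (M \<union> R) M t s) (if s = r then (card Q - 1) choose t else 0)"
proof -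
  \<comment> \<open>The condition \<open>s = r\<close> inside the set makes it empty in all other
    degrees and covers both cases at once.\<close>
  define I where "I = {F. F \<subseteq> Q - {p} \<and> card F = t \<and> s = r}"
  have finQ: "finite Q" using Qn finite_subset by blast
  have finI: "finite I" unfolding I_def by (rule finite_subset[of _ "Pow Q"]) (use finQ in auto)
  have cardI: "card I = (if s = r then (card Q - 1) choose t else 0)"
    using n_subsets[of "Q - {p}" t] finQ pQ by (simp add: I_def)
  have mM: "m \<notin> M" using m_R disj by auto
  have "qdim (rel_cycles n p (M \<union> R) M t s) (rel_bounds n p (M \<union> R) M t s) (card I)"
  proof (rule qdimI_family[OF subspace_rel_bounds finI, where e = "\<lambda>F. sng (m, F)"])
    show "(\<lambda>F. sng (m, F)) ` I \<subseteq> rel_cycles n p (M \<union> R) M t s"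
    proof (intro image_subsetI)
      fix F assume F: "F \<in> I"
      then have F': "F \<subseteq> {1..n} - {p}" "F - Q = {}" using Qn by (auto simp: I_def)
      have "kdiff n p (sng (m, F)) \<in> chains_in M" using kdiff_R[OF m_R F'(1)] F' by simp
      then show "sng (m, F) \<in> rel_cycles n p (M \<union> R) M t s"
        using F F' m m_R by (auto simp: rel_cycles_def graded_def chains_in_def I_def)
    qed
  next
    fix c assume "(\<Sum>F\<in>I. csc (c F) (sng (m, F))) \<in> rel_bounds n p (M \<union> R) M t s"
    then obtain w z where z: "(\<Sum>F\<in>I. csc (c F) (sng (m, F))) = w + kdiff n p z" "w \<in> chains_in M" "z \<in> chains_in (M \<union> R)" "z \<in> graded_pred n p (Suc t) s"
      by (rule rel_boundsE)
    \<comment> \<open>No boundary has a term at the monomial \<open>m\<close>: the differential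
      multiplies by a variable, products from \<open>M\<close> stay in \<open>M\<close>, and those
      from \<open>R\<close> are proper multiples of \<open>m\<close>.\<close>
    let ?P = "{(u, F). u \<noteq> m} :: ((nat \<Rightarrow>\<^sub>0 nat) \<times> nat set) set"
    have "z \<in> supported_on {(u, F). u \<in> M \<union> R \<and> F \<subseteq> {1..n} - {p}}"
      using z(3,4) by (cases s) (auto simp: chains_in_def graded_pred_def graded_def supported_on_def)
    then have "kdiff n p z \<in> supported_on ?P"
    proof (rule clinear_supported_on[OF clinear_kdiff])
      fix k assume "k \<in> {(u, F). u \<in> M \<union> R \<and> F \<subseteq> {1..n} - {p}}"
      then obtain u F where k: "k = (u, F)" "u \<in> M \<union> R" "F \<subseteq> {1..n} - {p}" by auto
      have ne: "u + xm i \<noteq> m" if i: "i \<in> {1..n}" for i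
      proof
        assume eq: "u + xm i = m"
        show False
        proof (cases "u \<in> M")
          case True
          then show False using M i eq mM by (auto simp: upset_def)
        next
          case False
          then obtain v where "u = m + v" using k by (auto simp: R_def)
          then have "m + (v + xm i) = m + 0" using eq by (simp add: add.assoc)
          then have "v + xm i = 0" by (simp only: add_left_cancel)
          then have "keys (v + xm i) = {}" by simp
          then show False by simp
        qed
      qed
      show "kdiff n p (sng k) \<in> supported_on ?P"
        unfolding k(1) kdiff_sng[OF k(3)] using ne k(3) p_ground
        by (intro supported_on_sum supported_on_csc supported_on_diff) (auto simp: subset_iff)
    qed simp
    moreover have "w \<in> supported_on ?P" using z(2) mM by (auto simp: chains_in_def supported_on_def)
    ultimately have P: "(\<Sum>F\<in>I. csc (c F) (sng (m, F))) \<in> supported_on ?P" unfolding z(1) by (intro supported_on_add)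
    show "\<forall>F\<in>I. c F = 0"
    proof
      fix F assume F: "F \<in> I"
      have "lookup (\<Sum>F\<in>I. csc (c F) (sng (m, F))) (m, F) = (\<Sum>G\<in>I. if G = F then c F else 0)"
        unfolding lookup_sum by (intro sum.cong) (auto simp: lookup_single when_def)
      also have "\<dots> = c F" using F finI by simp
      finally have "lookup (\<Sum>F\<in>I. csc (c F) (sng (m, F))) (m, F) = c F" .
      moreover have "(m, F) \<notin> keys (\<Sum>F\<in>I. csc (c F) (sng (m, F)))" using P by (auto simp: supported_on_def)
      ultimately show "c F = 0" by (simp add: in_keys_iff)
    qed
  next
    fix z assume z: "z \<in> rel_cycles n p (M \<union> R) M t s"
    then have zG: "z \<in> graded n p t s" "z \<in> chains_in (M \<union> R)" "kdiff n p z \<in> chains_in M" by (auto simp: rel_cycles_def)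
    let ?P = "\<lambda>z. kdiff n p (contract z) + contract (kdiff n p z) - z + crit z"
    have Plin: "clinear ?P"
      by (intro cvp.linear_compose_add cvp.linear_compose_sub clinear_comp[OF clinear_contract clinear_kdiff]
          clinear_comp[OF clinear_kdiff clinear_contract] clinear_id clinear_crit)
    have "?P z \<in> chains_in M"
    proof (rule clinear_supported_on[OF Plin])
      show "z \<in> supported_on {(u, F). u \<in> M \<union> R \<and> F \<subseteq> {1..n} - {p}}"
        using zG by (auto simp: chains_in_def graded_def supported_on_def)
      fix k assume "k \<in> {(u, F). u \<in> M \<union> R \<and> F \<subseteq> {1..n} - {p}}"
      then obtain u F where k: "k = (u, F)" "u \<in> M \<union> R" "F \<subseteq> {1..n} - {p}" by auto
      show "?P (sng k) \<in> chains_in M"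
      proof (cases "u \<in> R")
        case True
        show ?thesis unfolding k(1) contract_sng by (rule homotopy[OF True k(3)])
      next
        case False
        then have "sng k \<in> chains_in M" "u \<noteq> m" using k m_R by (auto simp: chains_in_def)
        moreover from this have "contract_sng u F = 0" using contract_chains_in[of "sng k"] by (simp add: k(1))
        ultimately show ?thesis using contract_chains_in kdiff_chains_in[OF p_ground M \<open>sng k \<in> chains_in M\<close>]
          by (simp add: k(1) kdiff_0 cvs.subspace_neg)
      qed
    qed simp
    then have PM: "kdiff n p (contract z) - z + crit z \<in> chains_in M" using contract_chains_in[OF zG(3)] by simp
    have hz: "contract z \<in> graded_pred n p (Suc t) s" "contract z \<in> chains_in (M \<union> R)" using contract_graded[OF zG(1,2)] by auto
    define c where "c F = lookup z (m, F)" for F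
    have crit: "crit z = (\<Sum>F\<in>I. csc (c F) (sng (m, F)))"
    proof -
      have "crit z = (\<Sum>k\<in>keys z. csc (lookup z k) (crit (sng k)))"
        by (subst poly_mapping_expand[of z]) (simp add: cvp.linear_sum[OF clinear_crit] cvp.linear_scale[OF clinear_crit])
      also have "\<dots> = (\<Sum>k\<in>keys z \<inter> Pair m ` I. csc (lookup z k) (crit (sng k)))"
      proof (intro sum.mono_neutral_right ballI)
        fix k assume k: "k \<in> keys z - keys z \<inter> Pair m ` I"
        then obtain u F where uF: "k = (u, F)" "u \<in> mons n s" "F \<subseteq> {1..n} - {p}" "card F = t"
          using zG(1) by (auto simp: graded_def supported_on_def)
        then have "u = m \<Longrightarrow> F \<subseteq> Q \<Longrightarrow> F \<in> I" using m by (auto simp: I_def mons_def)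
        then have "\<not> (u = m \<and> F \<subseteq> Q)" using k uF(1) by auto
        then show "csc (lookup z k) (crit (sng k)) = 0" unfolding uF(1) by auto
      qed auto
      also have "\<dots> = (\<Sum>k\<in>Pair m ` I. csc (lookup z k) (crit (sng k)))"
        using finI by (intro sum.mono_neutral_left) (auto simp: in_keys_iff)
      also have "\<dots> = (\<Sum>F\<in>I. csc (c F) (crit (sng (m, F))))"
        by (subst sum.reindex) (auto simp: inj_on_def c_def)
      also have "\<dots> = (\<Sum>F\<in>I. csc (c F) (sng (m, F)))"
        by (intro sum.cong refl) (auto simp: I_def)
      finally show ?thesis .
    qed
    \<comment> \<open>The homotopy identity for a cycle: \<open>z\<close> and \<open>crit z\<close>
      differ by the boundary of \<open>contract z\<close>, up to coefficients in
      \<open>M\<close>.\<close>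
    have "z - crit z = (- (kdiff n p (contract z) - z + crit z)) + kdiff n p (contract z)" by simp
    also have "\<dots> \<in> rel_bounds n p (M \<union> R) M t s"
    proof (rule rel_boundsI)
      show "- (kdiff n p (contract z) - z + crit z) \<in> chains_in M" using PM by (simp only: cvs.subspace_neg subspace_chains_in)
      have "crit z \<in> graded n p t s" unfolding crit using m Qn
        by (intro cvs.subspace_sum cvs.subspace_scale subspace_graded) (auto simp: graded_def I_def)
      then show "- (kdiff n p (contract z) - z + crit z) \<in> graded n p t s"
        using zG(1) kdiff_graded_pred[OF p_ground hz(1)]
        by (intro cvs.subspace_neg graded_add graded_diff subspace_graded)
    qed (use hz in auto)
    finally show "\<exists>c. z - (\<Sum>F\<in>I. csc (c F) (sng (m, F))) \<in> rel_bounds n p (M \<union> R) M t s"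
      unfolding crit by blast
  qed
  then show ?thesis by (simp only: cardI)
qed

end

section \<open>Exterior products of linear forms\<close>

lemma homogeneous_eq_supported_on: "homogeneous n s = supported_on (mons n s)"
  by (auto simp: homogeneous_def poly_ring_def supported_on_def mons_def)

lemma carrier_eq_supported_on: "carrier (poly_ring n) = supported_on {u. keys u \<subseteq> {1..n}}"
  by (auto simp: poly_ring_def supported_on_def)

lemma homogeneous_carrier: "f \<in> homogeneous n s \<Longrightarrow> f \<in> carrier (poly_ring n)"
  by (simp add: homogeneous_def)

lemma Const_mult: "Const c * (f :: mpoly) = csc c f"
proof -
  have single: "csc a (sng k) = Poly_Mapping.single k a" for a and k :: "nat \<Rightarrow>\<^sub>0 nat"
    by (rule poly_mapping_eqI) (simp add: lookup_single when_def)
  have f: "f = (\<Sum>k\<in>keys f. Poly_Mapping.single k (lookup f k))"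
    using poly_mapping_expand[of f] by (simp only: single)
  have "Const c * f = (\<Sum>k\<in>keys f. Poly_Mapping.single k (c * lookup f k))"
    by (subst f) (simp add: sum_distrib_left Const_def mult_single)
  also have "\<dots> = csc c (\<Sum>k\<in>keys f. Poly_Mapping.single k (lookup f k))"
    unfolding cvs.scale_sum_right
    by (intro sum.cong refl poly_mapping_eqI) (simp add: lookup_single when_def)
  also have "\<dots> = csc c f" by (simp only: f[symmetric])
  finally show ?thesis .
qed

lemma mult_csc_left: "csc c f * g = csc c (f * g :: mpoly)"
  by (simp add: Const_mult[symmetric] mult.assoc)

lemma mult_csc_right: "f * csc c g = csc c (f * g :: mpoly)"
  by (simp add: Const_mult[symmetric] ac_simps)

lemma Var_eq: "Var i = sng (xm i)" by (simp add: Var_def xm_def)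

lemma Var_mult_sng: "Var i * sng u = sng (u + xm i)"
  by (simp add: Var_eq mult_single add.commute)

definition coord :: "nat \<Rightarrow> mpoly \<Rightarrow> complex" where "coord i l = lookup l (xm i)"

lemma coord_add: "coord i (l + l') = coord i l + coord i l'" by (simp add: coord_def lookup_add)
lemma coord_scale: "coord i (Const c * l) = c * coord i l" by (simp add: coord_def Const_mult)
lemma xm_eq_iff [simp]: "xm i = xm j \<longleftrightarrow> i = j"
  by (metis keys_xm singleton_inject)
lemma coord_Var: "coord i (Var j) = (if i = j then 1 else 0)"
  by (auto simp: coord_def Var_eq lookup_single when_def)

text \<open>As the coefficients sum to zero, the one of \<open>x_p\<close> is determined by the
  others, so the coordinate at \<open>x_i - x_p\<close> is just the coefficient of
  \<open>x_i\<close>.\<close>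

lemma diff_forms_expand:
  assumes p: "p \<in> {1..n}" and l: "l \<in> diff_forms n"
  shows "l = (\<Sum>i\<in>{1..n} - {p}. csc (coord i l) (Var i - Var p))"
proof -
  from l obtain c where c: "l = (\<Sum>i=1..n. Const (c i) * Var i)" "(\<Sum>i=1..n. c i) = 0"
    by (auto simp: diff_forms_def)
  have coord: "coord j l = c j" if "j \<in> {1..n}" for j
  proof -
    have "coord j l = (\<Sum>i=1..n. if i = j then c i else 0)"
      unfolding c(1) coord_def lookup_sum
      by (intro sum.cong) (auto simp: Const_mult Var_eq lookup_single when_def)
    then show ?thesis using that by simp
  qed
  have p_coeff: "c p = - (\<Sum>i\<in>{1..n} - {p}. c i)"
    using c(2) p by (simp add: sum.remove[of _ p] eq_neg_iff_add_eq_0)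
  have "l = csc (c p) (Var p) + (\<Sum>i\<in>{1..n} - {p}. csc (c i) (Var i))"
    unfolding c(1) Const_mult using p by (subst sum.remove[of _ p]) auto
  also have "csc (c p) (Var p) = - (\<Sum>i\<in>{1..n} - {p}. csc (c i) (Var p))"
    unfolding p_coeff by (simp add: cvs.scale_sum_left cvs.scale_minus_left)
  also have "- (\<Sum>i\<in>{1..n} - {p}. csc (c i) (Var p)) + (\<Sum>i\<in>{1..n} - {p}. csc (c i) (Var i))
      = (\<Sum>i\<in>{1..n} - {p}. csc (c i) (Var i - Var p))"
    by (simp add: cvs.scale_right_diff_distrib sum_subtractf)
  also have "\<dots> = (\<Sum>i\<in>{1..n} - {p}. csc (coord i l) (Var i - Var p))"
    by (intro sum.cong) (auto simp: coord)
  finally show ?thesis .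
qed

lemma diff_forms_Var: 
  assumes "p \<in> {1..n}" "i \<in> {1..n}" shows "Var i - Var p \<in> diff_forms n"
proof -
  let ?c = "\<lambda>j. (if j = i then 1 else 0) - (if j = p then 1 else 0) :: complex"
  have "Const (?c j) * Var j = (if j = i then Var j else 0) - (if j = p then Var j else 0)" for j
    by (simp add: Const_mult cvs.scale_left_diff_distrib)
  then have "(\<Sum>j=1..n. Const (?c j) * Var j) = Var i - Var p"
    using assms by (simp only: sum_subtractf) simp
  moreover have "(\<Sum>j=1..n. ?c j) = 0" using assms by (simp only: sum_subtractf) simp
  ultimately show ?thesis unfolding diff_forms_def by (intro CollectI exI[of _ ?c]) simp
qed

lemma subspace_diff_forms: "cvs.subspace (diff_forms n)"
proof (rule cvs.subspaceI)
  show "0 \<in> diff_forms n"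
    unfolding diff_forms_def by (intro CollectI exI[of _ "\<lambda>_. 0"]) (simp add: Const_mult)
  fix x assume "x \<in> diff_forms n"
  then obtain c where c: "x = (\<Sum>i=1..n. Const (c i) * Var i)" "(\<Sum>i=1..n. c i) = 0"
    by (auto simp: diff_forms_def)
  show "csc a x \<in> diff_forms n" for a
    unfolding diff_forms_def using c
    by (intro CollectI exI[of _ "\<lambda>i. a * c i"]) (simp add: Const_mult cvs.scale_sum_right flip: sum_distrib_left)
  fix y assume "y \<in> diff_forms n"
  then obtain d where d: "y = (\<Sum>i=1..n. Const (d i) * Var i)" "(\<Sum>i=1..n. d i) = 0"
    by (auto simp: diff_forms_def)
  show "x + y \<in> diff_forms n"
    unfolding diff_forms_def using c d
    by (intro CollectI exI[of _ "\<lambda>i. c i + d i"]) (simp add: Const_mult cvs.scale_left_distrib sum.distrib)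
qed

lemma Var_mult_homogeneous: "i \<in> {1..n} \<Longrightarrow> f \<in> homogeneous n s \<Longrightarrow> Var i * f \<in> homogeneous n (Suc s)"
  unfolding homogeneous_eq_supported_on
  by (rule clinear_supported_on[of "\<lambda>f. Var i * f"])
     (auto simp: Var_mult_sng distrib_left mult_csc_right intro!: clinearI mons_xm)

lemma diff_forms_mult_homogeneous:
  assumes "l \<in> diff_forms n" "f \<in> homogeneous n s"
  shows "l * f \<in> homogeneous n (Suc s)"
proof -
  from assms(1) obtain c where c: "l = (\<Sum>i=1..n. Const (c i) * Var i)" by (auto simp: diff_forms_def)
  have "l * f = (\<Sum>i=1..n. csc (c i) (Var i * f))"
    unfolding c by (simp add: sum_distrib_right Const_mult mult_csc_left)
  also have "\<dots> \<in> homogeneous n (Suc s)"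
    using Var_mult_homogeneous[OF _ assms(2)] unfolding homogeneous_eq_supported_on by (intro supported_on_sum supported_on_csc) auto
  finally show ?thesis .
qed

lemma diff_forms_carrier: "l \<in> diff_forms n \<Longrightarrow> l \<in> carrier (poly_ring n)"
proof -
  assume "l \<in> diff_forms n"
  then obtain c where c: "l = (\<Sum>i=1..n. Const (c i) * Var i)" by (auto simp: diff_forms_def)
  show ?thesis unfolding carrier_eq_supported_on c Const_mult by (intro supported_on_sum supported_on_csc) (auto simp: Var_eq)
qed

lemma Const_carrier: "Const c \<in> carrier (poly_ring n)"
  unfolding carrier_eq_supported_on by (auto simp: supported_on_def Const_def)

section \<open>Wedge products of arbitrary forms, expanded in the basis of a root\<close>

definition embed :: "mpoly \<Rightarrow> chain" where "embed = lin (\<lambda>u. sng (u, {}))"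

definition form_wedge :: "nat \<Rightarrow> nat \<Rightarrow> mpoly \<Rightarrow> chain \<Rightarrow> chain" where
  "form_wedge n p l z = (\<Sum>i\<in>{1..n} - {p}. csc (coord i l) (eps i z))"

definition form_mul :: "nat \<Rightarrow> nat \<Rightarrow> mpoly \<Rightarrow> chain \<Rightarrow> chain" where
  "form_mul n p l z = (\<Sum>i\<in>{1..n} - {p}. csc (coord i l) (ymul p i z))"

fun wedge_chain :: "nat \<Rightarrow> nat \<Rightarrow> mpoly \<Rightarrow> mpoly list \<Rightarrow> chain" where
  "wedge_chain n p f [] = embed f"
| "wedge_chain n p f (l # ls) = form_wedge n p l (wedge_chain n p f ls)"

lemma clinear_embed: "clinear embed" unfolding embed_def by (rule clinear_lin)
lemma embed_sng [simp]: "embed (sng u) = sng (u, {})" by (simp add: embed_def)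

lemma clinear_form_wedge: "clinear (form_wedge n p l)"
  unfolding form_wedge_def by (intro cvp.linear_compose_sum ballI cvp.linear_compose_scale_right clinear_eps)

lemma form_wedge_add: "form_wedge n p (l + l') z = form_wedge n p l z + form_wedge n p l' z"
  by (simp add: form_wedge_def coord_add cvs.scale_left_distrib sum.distrib)

lemma form_wedge_scale: "form_wedge n p (Const c * l) z = csc c (form_wedge n p l z)"
  by (simp add: form_wedge_def coord_scale cvs.scale_sum_right)

lemma form_wedge_form_wedge: "form_wedge n p l (form_wedge n p l' z) = - form_wedge n p l' (form_wedge n p l z)"
proof -
  let ?N = "{1..n} - {p}"
  have expand: "form_wedge n p l (form_wedge n p l' z) = (\<Sum>i\<in>?N. \<Sum>j\<in>?N. csc (coord i l * coord j l') (eps i (eps j z)))" for l l'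
    by (simp add: form_wedge_def cvp.linear_sum[OF clinear_eps] cvp.linear_scale[OF clinear_eps] cvs.scale_sum_right)
  have "(\<Sum>i\<in>?N. \<Sum>j\<in>?N. csc (coord i l * coord j l') (eps i (eps j z)))
      = (\<Sum>i\<in>?N. \<Sum>j\<in>?N. - csc (coord j l' * coord i l) (eps j (eps i z)))"
    by (intro sum.cong refl) (subst eps_eps, simp add: mult.commute)
  also have "\<dots> = - (\<Sum>i\<in>?N. \<Sum>j\<in>?N. csc (coord j l' * coord i l) (eps j (eps i z)))"
    by (simp only: sum_negf)
  also have "(\<Sum>i\<in>?N. \<Sum>j\<in>?N. csc (coord j l' * coord i l) (eps j (eps i z)))
     = (\<Sum>j\<in>?N. \<Sum>i\<in>?N. csc (coord j l' * coord i l) (eps j (eps i z)))"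
    by (rule sum.swap)
  finally show ?thesis unfolding expand .
qed

lemma form_wedge_self: "form_wedge n p l (form_wedge n p l z) = 0"
  by (rule eq_neg_self) (rule form_wedge_form_wedge)

text \<open>Moving \<open>l\<close> past the other factors only changes signs until it meets its own
  copy.\<close>

lemma form_wedge_wedge_chain_mem: "l \<in> set ls \<Longrightarrow> form_wedge n p l (wedge_chain n p f ls) = 0"
proof (induction ls)
  case (Cons l' ls)
  then show ?case
    using form_wedge_form_wedge[of n p l l' "wedge_chain n p f ls"]
    by (cases "l = l'") (auto simp: form_wedge_self cvp.linear_0[OF clinear_form_wedge])
qed simp

lemma wedge_chain_alternating: "i < j \<Longrightarrow> j < length ls \<Longrightarrow> ls ! i = ls ! j \<Longrightarrow> wedge_chain n p f ls = 0"
proof (induction ls arbitrary: i j)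
  case (Cons l ls)
  then obtain j' where j: "j = Suc j'" by (cases j) auto
  show ?case
  proof (cases i)
    case 0
    then have "l \<in> set ls" using Cons.prems j by auto
    then show ?thesis by (simp add: form_wedge_wedge_chain_mem)
  next
    case (Suc i')
    then show ?thesis using Cons.IH[of i' j'] Cons.prems j by (simp add: cvp.linear_0[OF clinear_form_wedge])
  qed
qed simp

lemma wedge_chain_form_add: "i < length ls \<Longrightarrow> wedge_chain n p f (ls[i := l + l']) = wedge_chain n p f (ls[i := l]) + wedge_chain n p f (ls[i := l'])"
  by (induction ls arbitrary: i)
     (auto simp: form_wedge_add cvp.linear_add[OF clinear_form_wedge] split: nat.split)

lemma wedge_chain_form_scale: "i < length ls \<Longrightarrow> wedge_chain n p f (ls[i := Const c * l]) = csc c (wedge_chain n p f (ls[i := l]))"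
  by (induction ls arbitrary: i)
     (auto simp: form_wedge_scale cvp.linear_scale[OF clinear_form_wedge] split: nat.split)

lemma clinear_wedge_chain: "clinear (\<lambda>f. wedge_chain n p f ls)"
  by (induction ls) (auto intro: clinear_embed clinear_comp[OF _ clinear_form_wedge])

lemma embed_chains_in: "keys f \<subseteq> M \<Longrightarrow> embed f \<in> chains_in M"
  by (rule clinear_in_subspace[OF clinear_embed]) (auto simp: chains_in_def)

lemma form_wedge_chains_in: "z \<in> chains_in M \<Longrightarrow> form_wedge n p l z \<in> chains_in M"
  unfolding form_wedge_def by (intro cvs.subspace_sum cvs.subspace_scale subspace_chains_in eps_chains_in)

lemma wedge_chain_chains_in: "keys f \<subseteq> M \<Longrightarrow> wedge_chain n p f ls \<in> chains_in M"
  by (induction ls) (auto intro: embed_chains_in form_wedge_chains_in)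

lemma eps_graded: "i \<in> {1..n} - {p} \<Longrightarrow> z \<in> graded n p t s \<Longrightarrow> eps i z \<in> graded n p (Suc t) s"
proof -
  assume i: "i \<in> {1..n} - {p}" and z: "z \<in> graded n p t s"
  show ?thesis
  proof (rule clinear_supported_on[OF clinear_eps z[unfolded graded_def]])
    fix k assume "k \<in> {(u, F). u \<in> mons n s \<and> F \<subseteq> {1..n} - {p} \<and> card F = t}"
    then obtain u F where k: "k = (u, F)" "u \<in> mons n s" "F \<subseteq> {1..n} - {p}" "card F = t" by auto
    then have "finite F" using finite_subset by blast
    then show "eps i (sng k) \<in> graded n p (Suc t) s"
      using k i unfolding k(1) by (auto simp: eps_sng graded_def intro!: supported_on_csc)
  qed simp
qed

lemma form_wedge_graded: "z \<in> graded n p t s \<Longrightarrow> form_wedge n p l z \<in> graded n p (Suc t) s"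
  unfolding form_wedge_def by (intro cvs.subspace_sum cvs.subspace_scale subspace_graded eps_graded)

lemma wedge_chain_graded: "f \<in> homogeneous n s \<Longrightarrow> wedge_chain n p f ls \<in> graded n p (length ls) s"
proof (induction ls)
  case Nil
  have "embed f \<in> graded n p 0 s"
    by (rule clinear_supported_on[OF clinear_embed Nil[unfolded homogeneous_eq_supported_on]]) (auto simp: graded_def)
  then show ?case by simp
qed (auto intro: form_wedge_graded)

lemma embed_mult:
  assumes "p \<in> {1..n}" "l \<in> diff_forms n"
  shows "embed (l * f) = form_mul n p l (embed f)"
proof -
  have Var: "embed (Var i * f) = mulm (xm i) (embed f)" for i
  proof -
    have "(\<lambda>f. embed (Var i * f)) = (\<lambda>f. mulm (xm i) (embed f))"
    proof (rule clinear_ext[OF clinear_comp[OF _ clinear_embed] clinear_comp[OF clinear_embed clinear_mulm]])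
      show "clinear (\<lambda>f. Var i * f)" by (auto intro!: clinearI simp: distrib_left mult_csc_right)
    qed (simp add: Var_mult_sng)
    then show ?thesis by (rule fun_cong)
  qed
  have "l * f = (\<Sum>i\<in>{1..n} - {p}. csc (coord i l) (Var i * f - Var p * f))"
    by (subst diff_forms_expand[OF assms]) (simp add: sum_distrib_right mult_csc_left left_diff_distrib)
  then show ?thesis
    by (simp add: form_mul_def cvp.linear_sum[OF clinear_embed] cvp.linear_scale[OF clinear_embed]
        cvp.linear_diff[OF clinear_embed] Var ymul_def)
qed

lemma eps_ymul: "eps i (ymul p j z) = ymul p j (eps i z)"
  by (simp add: ymul_def eps_mulm cvp.linear_diff[OF clinear_eps])

lemma form_wedge_form_mul: "form_wedge n p l (form_mul n p l' z) = form_mul n p l' (form_wedge n p l z)"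
  unfolding form_wedge_def form_mul_def
  by (simp add: cvp.linear_sum[OF clinear_eps] cvp.linear_scale[OF clinear_eps] cvp.linear_sum[OF clinear_ymul]
      cvp.linear_scale[OF clinear_ymul] cvs.scale_sum_right eps_ymul) (subst sum.swap, simp add: mult.commute)

lemma wedge_chain_mult:
  assumes "p \<in> {1..n}" "l \<in> diff_forms n"
  shows "wedge_chain n p (l * f) ls = form_mul n p l (wedge_chain n p f ls)"
  by (induction ls) (simp_all add: embed_mult[OF assms] form_wedge_form_mul)

text \<open>The antiderivation rule, from the Clifford relation \<open>iota_eps\<close> summed over
  all indices.\<close>

lemma kdiff_form_wedge: "kdiff n p (form_wedge n p l z) = form_mul n p l z - form_wedge n p l (kdiff n p z)"
proof -
  let ?N = "{1..n} - {p}"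
  have "kdiff n p (eps i z) = ymul p i z - eps i (kdiff n p z)" if "i \<in> ?N" for i
  proof -
    have "kdiff n p (eps i z) = (\<Sum>j\<in>?N. ymul p j (if i = j then z else 0) - ymul p j (eps i (iota j z)))"
      by (simp add: kdiff_def iota_eps cvp.linear_diff[OF clinear_ymul])
    also have "\<dots> = (\<Sum>j\<in>?N. if j = i then ymul p i z else 0) - (\<Sum>j\<in>?N. ymul p j (eps i (iota j z)))"
      unfolding sum_subtractf by (intro arg_cong2[where f = minus] sum.cong refl) (auto simp: cvp.linear_0[OF clinear_ymul])
    also have "\<dots> = ymul p i z - eps i (kdiff n p z)"
      using that by (simp add: kdiff_def cvp.linear_sum[OF clinear_eps] eps_ymul)
    finally show ?thesis .
  qed
  then have "kdiff n p (form_wedge n p l z) = (\<Sum>i\<in>?N. csc (coord i l) (ymul p i z - eps i (kdiff n p z)))"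
    by (simp add: form_wedge_def cvp.linear_sum[OF clinear_kdiff] cvp.linear_scale[OF clinear_kdiff])
  then show ?thesis by (simp add: form_wedge_def form_mul_def cvs.scale_right_diff_distrib sum_subtractf)
qed

lemma kdiff_embed: "kdiff n p (embed f) = 0"
proof -
  have "(\<lambda>f. kdiff n p (embed f)) = (\<lambda>_. 0)"
  proof (rule clinear_ext[OF clinear_comp[OF clinear_embed clinear_kdiff]])
    show "clinear (\<lambda>_. 0 :: chain)" by (rule clinearI) auto
    show "kdiff n p (embed (sng k)) = 0" for k using kdiff_sng[of "{}" n p k] by simp
  qed
  then show ?thesis by (rule fun_cong)
qed

text \<open>Iterating the antiderivation rule gives alternating signs that start with plus; the
  outer minus matches them to the exponent \<open>Suc j\<close> of the presented
  differential.\<close>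

lemma kdiff_wedge_chain:
  assumes "p \<in> {1..n}" "set ls \<subseteq> diff_forms n"
  shows "kdiff n p (wedge_chain n p f ls)
    = - (\<Sum>j<length ls. csc ((- 1) ^ Suc j) (wedge_chain n p (ls ! j * f) (take j ls @ drop (Suc j) ls)))"
  using assms(2)
proof (induction ls)
  case Nil
  then show ?case by (simp add: kdiff_embed)
next
  case (Cons l ls)
  have "kdiff n p (wedge_chain n p f (l # ls)) = wedge_chain n p (l * f) ls
      + (\<Sum>j<length ls. csc ((- 1) ^ Suc j) (form_wedge n p l (wedge_chain n p (ls ! j * f) (take j ls @ drop (Suc j) ls))))"
    using Cons wedge_chain_mult[OF assms(1), of l f ls]
    by (simp add: kdiff_form_wedge cvp.linear_neg[OF clinear_form_wedge] cvp.linear_sum[OF clinear_form_wedge] cvp.linear_scale[OF clinear_form_wedge])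
  then show ?case unfolding length_Cons sum.lessThan_Suc_shift
    by (simp add: sum_negf del: sum.lessThan_Suc)
qed

section \<open>Comparison of the presented and the concrete complex\<close>

definition cong_mod :: "('a \<Rightarrow>\<^sub>0 complex) set \<Rightarrow> ('a \<Rightarrow>\<^sub>0 complex) \<Rightarrow> ('a \<Rightarrow>\<^sub>0 complex) \<Rightarrow> bool" where
  "cong_mod W x y \<longleftrightarrow> x - y \<in> W"

lemma cong_mod_refl: "cvs.subspace W \<Longrightarrow> cong_mod W x x"
  by (simp add: cong_mod_def cvs.subspace_0)

lemma cong_mod_sym: "cvs.subspace W \<Longrightarrow> cong_mod W x y \<Longrightarrow> cong_mod W y x"
  using cvs.subspace_neg[of W "x - y"] by (simp add: cong_mod_def)

lemma cong_mod_trans: "cvs.subspace W \<Longrightarrow> cong_mod W x y \<Longrightarrow> cong_mod W y z \<Longrightarrow> cong_mod W x z"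
  using cvs.subspace_add[of W "x - y" "y - z"] by (simp add: cong_mod_def)

lemma cong_mod_add: "cvs.subspace W \<Longrightarrow> cong_mod W x y \<Longrightarrow> cong_mod W x' y' \<Longrightarrow> cong_mod W (x + x') (y + y')"
  using cvs.subspace_add[of W "x - y" "x' - y'"] by (simp add: cong_mod_def algebra_simps)

lemma cong_mod_csc: "cvs.subspace W \<Longrightarrow> cong_mod W x y \<Longrightarrow> cong_mod W (csc c x) (csc c y)"
  using cvs.subspace_scale[of W "x - y" c] by (simp add: cong_mod_def cvs.scale_right_diff_distrib)

lemma cong_mod_neg: "cvs.subspace W \<Longrightarrow> cong_mod W x y \<Longrightarrow> cong_mod W (- x) (- y)"
  using cvs.subspace_neg[of W "x - y"] by (simp add: cong_mod_def)

lemma cong_mod_sum: "cvs.subspace W \<Longrightarrow> (\<And>i. i \<in> I \<Longrightarrow> cong_mod W (f i) (g i)) \<Longrightarrow> cong_mod W (sum f I) (sum g I)"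
  using cvs.subspace_sum[of W I "\<lambda>i. f i - g i"] by (simp add: cong_mod_def sum_subtractf)

lemma cong_mod_linear:
  assumes "clinear f" "clinear g" "cvs.subspace W" "\<And>k. k \<in> keys z \<Longrightarrow> cong_mod W (f (sng k)) (g (sng k))"
  shows "cong_mod W (f z) (g z)"
  unfolding cong_mod_def
  by (rule clinear_in_subspace[of "\<lambda>z. f z - g z"])
     (use assms in \<open>auto simp: cong_mod_def intro: cvp.linear_compose_sub\<close>)

lemma cong_mod_mem: "cvs.subspace W \<Longrightarrow> cong_mod W x y \<Longrightarrow> x \<in> W \<longleftrightarrow> y \<in> W"
  using cvs.subspace_diff[of W x "x - y"] cvs.subspace_add[of W "x - y" y] by (auto simp: cong_mod_def)

text \<open>The counterpart of \<open>qdim_transfer\<close> in the direction of \<open>f\<close>: a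
  basis of the source is mapped to one of the target. Together they let a dimension travel from one
  root to the presentation and on to another root.\<close>

lemma qdim_image:
  assumes f: "clinear f" and W': "cvs.subspace W'"
    and q: "qdim U W d"
    and "\<And>a. a \<in> W \<Longrightarrow> f a \<in> W'" "\<And>u. u \<in> cvs.span U \<Longrightarrow> f u \<in> W' \<Longrightarrow> u \<in> W"
    and "\<And>u. u \<in> U \<Longrightarrow> f u \<in> U'" "\<And>v. v \<in> U' \<Longrightarrow> \<exists>u\<in>U. v - f u \<in> W'"
  shows "qdim U' W' d"
proof -
  from q obtain T where T: "quotient_basis U W T" "card T = d" by (auto simp: qdim_def)
  then have fin: "finite T" "T \<subseteq> U" by (auto simp: quotient_basis_def)
  have fsum: "f (\<Sum>b\<in>T. csc (c b) b) = (\<Sum>b\<in>T. csc (c b) (f b))" for c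
    by (simp add: cvp.linear_sum[OF f] cvp.linear_scale[OF f])
  have "qdim U' W' (card T)"
  proof (rule qdimI_family[OF W' fin(1), of f])
    show "f ` T \<subseteq> U'" using fin assms by auto
    show "\<forall>b\<in>T. c b = 0" if "(\<Sum>b\<in>T. csc (c b) (f b)) \<in> W'" for c
    proof -
      have "(\<Sum>b\<in>T. csc (c b) b) \<in> cvs.span U"
        using fin by (intro cvs.span_sum cvs.span_scale cvs.span_base) auto
      then have "(\<Sum>b\<in>T. csc (c b) b) \<in> W" using that assms(5) unfolding fsum[symmetric] by blast
      then show ?thesis using T by (auto simp: quotient_basis_def)
    qed
    show "\<exists>c. v - (\<Sum>b\<in>T. csc (c b) (f b)) \<in> W'" if v: "v \<in> U'" for v
    proof -
      from assms(7)[OF v] obtain u where u: "u \<in> U" "v - f u \<in> W'" by blast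
      then obtain c where c: "u - (\<Sum>b\<in>T. csc (c b) b) \<in> W" using T by (auto simp: quotient_basis_def)
      have "(v - f u) + f (u - (\<Sum>b\<in>T. csc (c b) b)) \<in> W'"
        using u assms(4)[OF c] cvs.subspace_add[OF W'] by blast
      then show ?thesis by (intro exI[of _ c]) (simp add: cvp.linear_diff[OF f] fsum)
    qed
  qed
  then show ?thesis by (simp add: T)
qed

section \<open>Maps between the presented and the concrete complex\<close>

lemma symb_eq: "symb a ls = sng (a, ls)" by (simp add: symb_def)

lemma koszul_diff_eq_lin: "koszul_diff A = lin (\<lambda>(a, ls). koszul_diff_symb A a ls)"
  by (rule ext) (simp add: koszul_diff_def lin_def case_prod_unfold)

lemma clinear_koszul_diff: "clinear (koszul_diff A)"
  unfolding koszul_diff_eq_lin by (rule clinear_lin)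

lemma koszul_diff_symb [simp]: "koszul_diff A (symb a ls) = koszul_diff_symb A a ls"
  by (simp add: koszul_diff_eq_lin symb_eq)

text \<open>The comparison uses cosets only through these laws of the quotient map \<open>q\<close>.
  The root \<open>p\<close> enters the concrete complex alone, never the presented one.\<close>

locale koszul_quotient =
  fixes n p :: nat and A :: "(mpoly, 'b) module" and q :: "mpoly \<Rightarrow> 'b" and M :: "(nat \<Rightarrow>\<^sub>0 nat) set"
  assumes p: "p \<in> {1..n}" and M: "upset n M"
    and q_add: "\<And>f g. f \<in> carrier (poly_ring n) \<Longrightarrow> g \<in> carrier (poly_ring n) \<Longrightarrow> q f \<oplus>\<^bsub>A\<^esub> q g = q (f + g)"
    and q_smult: "\<And>l f. l \<in> carrier (poly_ring n) \<Longrightarrow> f \<in> carrier (poly_ring n) \<Longrightarrow> l \<odot>\<^bsub>A\<^esub> q f = q (l * f)"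
    and q_eq: "\<And>f g. f \<in> carrier (poly_ring n) \<Longrightarrow> g \<in> carrier (poly_ring n) \<Longrightarrow> q f = q g \<longleftrightarrow> keys (f - g) \<subseteq> M"
begin

abbreviation gr :: "nat \<Rightarrow> 'b set" where "gr s \<equiv> q ` homogeneous n s"
abbreviation V :: "mpoly set" where "V \<equiv> diff_forms n"
abbreviation free where "free t s \<equiv> koszul_free gr V t s"
abbreviation null where "null t s \<equiv> koszul_null A gr V t s"
abbreviation rels where "rels t s \<equiv> koszul_rels A gr V t s"
abbreviation N :: "nat set" where "N \<equiv> {1..n} - {p}"
abbreviation diff_var :: "nat \<Rightarrow> mpoly" where "diff_var i \<equiv> Var i - Var p"

text \<open>The degree is an argument because the zero class has representatives in every degree. By
  \<open>rep_cong\<close> the choice does not matter modulo \<open>M\<close>.\<close>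

definition rep :: "nat \<Rightarrow> 'b \<Rightarrow> mpoly" where
  "rep s a = (SOME f. f \<in> homogeneous n s \<and> q f = a)"

definition to_chain :: "nat \<Rightarrow> (('b \<times> mpoly list) \<Rightarrow>\<^sub>0 complex) \<Rightarrow> chain" where
  "to_chain s = lin (\<lambda>(a, ls). wedge_chain n p (rep s a) ls)"

text \<open>The increasing order of the factors is the convention behind the signs
  \<open>sg\<close>. Up to the relations on one side and \<open>M\<close> on the other, this is
  inverse to \<open>to_chain\<close>.\<close>

definition from_chain :: "chain \<Rightarrow> (('b \<times> mpoly list) \<Rightarrow>\<^sub>0 complex)" where
  "from_chain = lin (\<lambda>(u, F). symb (q (sng u)) (map diff_var (sorted_list_of_set F)))"

definition wedge :: "mpoly \<Rightarrow> (('b \<times> mpoly list) \<Rightarrow>\<^sub>0 complex) \<Rightarrow> (('b \<times> mpoly list) \<Rightarrow>\<^sub>0 complex)" where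
  "wedge l = lin (\<lambda>(a, ls). symb a (l # ls))"

lemma clinear_to_chain: "clinear (to_chain s)" unfolding to_chain_def by (rule clinear_lin)
lemma clinear_from_chain: "clinear from_chain" unfolding from_chain_def by (rule clinear_lin)
lemma clinear_wedge: "clinear (wedge l)" unfolding wedge_def by (rule clinear_lin)

lemma to_chain_symb: "to_chain s (symb a ls) = wedge_chain n p (rep s a) ls" by (simp add: to_chain_def symb_eq)
lemma from_chain_sng: "from_chain (sng (u, F)) = symb (q (sng u)) (map diff_var (sorted_list_of_set F))" by (simp add: from_chain_def)
lemma wedge_symb: "wedge l (symb a ls) = symb a (l # ls)" by (simp add: wedge_def symb_eq)

lemma diff_var_V: "i \<in> N \<Longrightarrow> diff_var i \<in> V" using diff_forms_Var[OF p] by auto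

lemma V_add: "l \<in> V \<Longrightarrow> l' \<in> V \<Longrightarrow> l + l' \<in> V" by (rule cvs.subspace_add[OF subspace_diff_forms])
lemma V_scale: "l \<in> V \<Longrightarrow> Const c * l \<in> V" unfolding Const_mult by (rule cvs.subspace_scale[OF subspace_diff_forms])

lemma rep: "a \<in> gr s \<Longrightarrow> rep s a \<in> homogeneous n s \<and> q (rep s a) = a"
  unfolding rep_def by (rule someI_ex) auto

lemma homogeneous_add: "f \<in> homogeneous n s \<Longrightarrow> g \<in> homogeneous n s \<Longrightarrow> f + g \<in> homogeneous n s"
  unfolding homogeneous_eq_supported_on by (rule supported_on_add)

lemma homogeneous_csc: "f \<in> homogeneous n s \<Longrightarrow> csc c f \<in> homogeneous n s"
  unfolding homogeneous_eq_supported_on by (rule supported_on_csc)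

lemma q_add_homogeneous: "f \<in> homogeneous n s \<Longrightarrow> g \<in> homogeneous n s \<Longrightarrow> q f \<oplus>\<^bsub>A\<^esub> q g = q (f + g)"
  by (intro q_add homogeneous_carrier)

lemma q_scale_homogeneous: "f \<in> homogeneous n s \<Longrightarrow> Const c \<odot>\<^bsub>A\<^esub> q f = q (csc c f)"
  using q_smult[OF Const_carrier homogeneous_carrier] by (simp add: Const_mult)

lemma q_mult_homogeneous: "l \<in> V \<Longrightarrow> f \<in> homogeneous n s \<Longrightarrow> l \<odot>\<^bsub>A\<^esub> q f = q (l * f)"
  by (intro q_smult diff_forms_carrier homogeneous_carrier)

lemma gr_add: "a \<in> gr s \<Longrightarrow> b \<in> gr s \<Longrightarrow> a \<oplus>\<^bsub>A\<^esub> b \<in> gr s"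
  by (elim imageE) (simp add: q_add_homogeneous homogeneous_add)

lemma gr_scale: "a \<in> gr s \<Longrightarrow> Const c \<odot>\<^bsub>A\<^esub> a \<in> gr s"
  by (elim imageE) (simp add: q_scale_homogeneous homogeneous_csc)

lemma gr_mult: "a \<in> gr s \<Longrightarrow> l \<in> V \<Longrightarrow> l \<odot>\<^bsub>A\<^esub> a \<in> gr (Suc s)"
  by (elim imageE) (simp add: q_mult_homogeneous diff_forms_mult_homogeneous)

lemma free_eq_supported_on: "free t s = supported_on (gr s \<times> {ls. length ls = t \<and> set ls \<subseteq> V})"
  by (auto simp: koszul_free_def supported_on_def)

lemma symb_free [simp]: "symb a ls \<in> free t s \<longleftrightarrow> a \<in> gr s \<and> length ls = t \<and> set ls \<subseteq> V"
  by (auto simp: free_eq_supported_on symb_eq)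

lemma subspace_free [simp]: "cvs.subspace (free t s)" by (simp add: free_eq_supported_on)
lemma subspace_null [simp]: "cvs.subspace (null t s)" by (simp add: koszul_null_def)

lemma clinear_free:
  assumes "clinear f" "z \<in> free t s" "cvs.subspace W"
    and "\<And>a ls. a \<in> gr s \<Longrightarrow> length ls = t \<Longrightarrow> set ls \<subseteq> V \<Longrightarrow> f (symb a ls) \<in> W"
  shows "f z \<in> W"
  using clinear_supported_on[OF assms(1) assms(2)[unfolded free_eq_supported_on] _ assms(3)] assms(4) by (auto simp: symb_eq)

lemma cong_free:
  assumes "clinear f" "clinear g" "z \<in> free t s" "cvs.subspace W"
    and "\<And>a ls. a \<in> gr s \<Longrightarrow> length ls = t \<Longrightarrow> set ls \<subseteq> V \<Longrightarrow> cong_mod W (f (symb a ls)) (g (symb a ls))"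
  shows "cong_mod W (f z) (g z)"
  by (rule cong_mod_linear[OF assms(1,2,4)])
     (use assms(3,5) in \<open>auto simp: free_eq_supported_on supported_on_def symb_eq[symmetric]\<close>)

lemma rels_null: "x \<in> rels t s \<Longrightarrow> x \<in> null t s"
  unfolding koszul_null_def by (rule cvs.span_base)

lemma set_update_V: "set ls \<subseteq> V \<Longrightarrow> l \<in> V \<Longrightarrow> set (ls[i := l]) \<subseteq> V"
  using set_update_subset_insert[of ls i l] by auto

lemma null_free: "null t s \<subseteq> free t s"
  unfolding koszul_null_def
proof (rule cvs.span_minimal[OF _ subspace_free], rule subsetI)
  fix x assume "x \<in> rels t s"
  then show "x \<in> free t s"
    by cases (auto simp: gr_add gr_scale V_add V_scale set_update_V
      intro!: cvs.subspace_diff[OF subspace_free] cvs.subspace_scale[OF subspace_free] del: subsetI)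
qed

lemma rep_cong:
  assumes "f \<in> homogeneous n s"
  shows "cong_mod (chains_in M) (wedge_chain n p (rep s (q f)) ls) (wedge_chain n p f ls)"
proof -
  have r: "rep s (q f) \<in> homogeneous n s" "q (rep s (q f)) = q f" using rep[of "q f" s] assms by auto
  then have "keys (rep s (q f) - f) \<subseteq> M" using q_eq homogeneous_carrier assms by blast
  then have "wedge_chain n p (rep s (q f) - f) ls \<in> chains_in M" by (rule wedge_chain_chains_in)
  then show ?thesis by (simp add: cong_mod_def cvp.linear_diff[OF clinear_wedge_chain])
qed

lemma to_chain_graded: "z \<in> free t s \<Longrightarrow> to_chain s z \<in> graded n p t s"
  by (erule clinear_free[OF clinear_to_chain]) (use rep wedge_chain_graded in \<open>auto simp: to_chain_symb\<close>)

text \<open>The relations for the forms hold exactly after expansion; those for the coefficient hold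
  only modulo \<open>M\<close>, since representatives were chosen.\<close>

lemma to_chain_null: "z \<in> null t s \<Longrightarrow> to_chain s z \<in> chains_in M"
proof -
  assume z: "z \<in> null t s"
  have sub: "cvs.subspace {z. to_chain s z \<in> chains_in M}"
    by (rule cvs.subspaceI)
       (auto simp: cvp.linear_0[OF clinear_to_chain] cvp.linear_add[OF clinear_to_chain] cvp.linear_scale[OF clinear_to_chain]
         intro: cvs.subspace_add cvs.subspace_scale)
  have "null t s \<subseteq> {z. to_chain s z \<in> chains_in M}"
    unfolding koszul_null_def
  proof (rule cvs.span_minimal[OF _ sub], rule subsetI, rule CollectI)
    fix x assume "x \<in> rels t s"
    then show "to_chain s x \<in> chains_in M"
    proof cases
      case (coeff_add a b ls)
      then obtain f g where fg: "a = q f" "b = q g" "f \<in> homogeneous n s" "g \<in> homogeneous n s" by auto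
      then have h: "f + g \<in> homogeneous n s" "a \<oplus>\<^bsub>A\<^esub> b = q (f + g)"
        by (simp_all add: homogeneous_add q_add_homogeneous)
      have "cong_mod (chains_in M) (wedge_chain n p (rep s a) ls + wedge_chain n p (rep s b) ls) (wedge_chain n p f ls + wedge_chain n p g ls)"
        unfolding fg by (intro cong_mod_add subspace_chains_in rep_cong fg)
      moreover have "cong_mod (chains_in M) (wedge_chain n p (rep s (a \<oplus>\<^bsub>A\<^esub> b)) ls) (wedge_chain n p f ls + wedge_chain n p g ls)"
        unfolding h(2) cvp.linear_add[OF clinear_wedge_chain, symmetric] by (rule rep_cong[OF h(1)])
      ultimately have "cong_mod (chains_in M) (wedge_chain n p (rep s (a \<oplus>\<^bsub>A\<^esub> b)) ls) (wedge_chain n p (rep s a) ls + wedge_chain n p (rep s b) ls)"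
        using cong_mod_trans cong_mod_sym subspace_chains_in by blast
      then show ?thesis unfolding coeff_add
        by (simp add: cvp.linear_diff[OF clinear_to_chain] cvp.linear_add[OF clinear_to_chain] to_chain_symb cong_mod_def diff_diff_eq)
    next
      case (coeff_scale a ls c)
      then obtain f where f: "a = q f" "f \<in> homogeneous n s" by auto
      then have h: "csc c f \<in> homogeneous n s" "Const c \<odot>\<^bsub>A\<^esub> a = q (csc c f)"
        by (simp_all add: homogeneous_csc q_scale_homogeneous)
      have "cong_mod (chains_in M) (csc c (wedge_chain n p (rep s a) ls)) (csc c (wedge_chain n p f ls))"
        unfolding f by (intro cong_mod_csc subspace_chains_in rep_cong f)
      moreover have "cong_mod (chains_in M) (wedge_chain n p (rep s (Const c \<odot>\<^bsub>A\<^esub> a)) ls) (csc c (wedge_chain n p f ls))"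
        unfolding h(2) cvp.linear_scale[OF clinear_wedge_chain, symmetric] by (rule rep_cong[OF h(1)])
      ultimately have "cong_mod (chains_in M) (wedge_chain n p (rep s (Const c \<odot>\<^bsub>A\<^esub> a)) ls) (csc c (wedge_chain n p (rep s a) ls))"
        using cong_mod_trans cong_mod_sym subspace_chains_in by blast
      then show ?thesis unfolding coeff_scale
        by (simp add: cvp.linear_diff[OF clinear_to_chain] cvp.linear_scale[OF clinear_to_chain] to_chain_symb cong_mod_def)
    next
      case (form_add a ls i l l')
      then show ?thesis
        by (simp add: cvp.linear_diff[OF clinear_to_chain] to_chain_symb wedge_chain_form_add)
    next
      case (form_scale a ls i l c)
      then show ?thesis
        by (simp add: cvp.linear_diff[OF clinear_to_chain] cvp.linear_scale[OF clinear_to_chain] to_chain_symb wedge_chain_form_scale)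
    next
      case (alternating a ls i j)
      then show ?thesis by (simp add: to_chain_symb wedge_chain_alternating)
    qed
  qed
  with z show ?thesis by blast
qed

lemma koszul_diff_free:
  assumes "z \<in> free (Suc t) s"
  shows "koszul_diff A z \<in> free t (Suc s)"
proof (rule clinear_free[OF clinear_koszul_diff assms subspace_free])
  fix a ls assume *: "a \<in> gr s" "length ls = Suc t" "set ls \<subseteq> V"
  have "set (take j ls @ drop (Suc j) ls) \<subseteq> V" for j
    using * set_take_subset[of j ls] set_drop_subset[of "Suc j" ls] by auto
  then show "koszul_diff A (symb a ls) \<in> free t (Suc s)"
    using * gr_mult[OF *(1)] nth_mem[of _ ls] unfolding koszul_diff_symb koszul_diff_symb_def
    by (intro cvs.subspace_sum[OF subspace_free] cvs.subspace_scale[OF subspace_free]) (auto simp: subset_iff)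
qed

text \<open>A chain map up to sign. The sign is harmless, because cycles and boundaries form
  subspaces.\<close>

lemma to_chain_koszul_diff:
  assumes "z \<in> free t s"
  shows "cong_mod (chains_in M) (to_chain (Suc s) (koszul_diff A z)) (- kdiff n p (to_chain s z))"
proof (rule cong_free[OF clinear_comp[OF clinear_koszul_diff clinear_to_chain]
      cvp.linear_compose_neg[OF clinear_comp[OF clinear_to_chain clinear_kdiff]] assms subspace_chains_in])
  fix a ls assume *: "a \<in> gr s" "length ls = t" "set ls \<subseteq> V"
  define f where "f = rep s a"
  have f: "f \<in> homogeneous n s" "a = q f" using rep[OF *(1)] by (auto simp: f_def)
  have "cong_mod (chains_in M)
     (\<Sum>j<length ls. csc ((- 1) ^ Suc j) (wedge_chain n p (rep (Suc s) ((ls ! j) \<odot>\<^bsub>A\<^esub> a)) (take j ls @ drop (Suc j) ls)))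
     (\<Sum>j<length ls. csc ((- 1) ^ Suc j) (wedge_chain n p (ls ! j * f) (take j ls @ drop (Suc j) ls)))"
  proof (intro cong_mod_sum cong_mod_csc subspace_chains_in)
    fix j assume "j \<in> {..<length ls}"
    then have l: "ls ! j \<in> V" using * by (auto simp: subset_iff)
    have "(ls ! j) \<odot>\<^bsub>A\<^esub> a = q (ls ! j * f)"
      unfolding f(2) by (rule q_mult_homogeneous[OF l f(1)])
    then show "cong_mod (chains_in M) (wedge_chain n p (rep (Suc s) ((ls ! j) \<odot>\<^bsub>A\<^esub> a)) (take j ls @ drop (Suc j) ls))
        (wedge_chain n p (ls ! j * f) (take j ls @ drop (Suc j) ls))"
      using rep_cong[OF diff_forms_mult_homogeneous[OF l f(1)]] by simp
  qed
  then show "cong_mod (chains_in M) (to_chain (Suc s) (koszul_diff A (symb a ls))) (- kdiff n p (to_chain s (symb a ls)))"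
    unfolding koszul_diff_symb koszul_diff_symb_def to_chain_symb kdiff_wedge_chain[OF p *(3)] f_def[symmetric]
    by (simp add: cvp.linear_sum[OF clinear_to_chain] cvp.linear_scale[OF clinear_to_chain] to_chain_symb del: power_Suc)
qed

text \<open>Prefixing a form turns each relation into one of the same kind with positions shifted by
  one, so \<open>wedge\<close> descends to the quotient.\<close>

lemma wedge_null:
  assumes l: "l \<in> V" and x: "x \<in> null t s"
  shows "wedge l x \<in> null (Suc t) s"
proof -
  have sub: "cvs.subspace {z. wedge l z \<in> null (Suc t) s}"
    by (rule cvs.subspaceI)
       (auto simp: cvp.linear_0[OF clinear_wedge] cvp.linear_add[OF clinear_wedge] cvp.linear_scale[OF clinear_wedge]
         intro: cvs.subspace_add cvs.subspace_scale cvs.subspace_0)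
  have "null t s \<subseteq> {z. wedge l z \<in> null (Suc t) s}"
    unfolding koszul_null_def[of _ _ _ t]
  proof (rule cvs.span_minimal[OF _ sub], rule subsetI, rule CollectI, rule rels_null)
    fix x assume "x \<in> rels t s"
    then show "wedge l x \<in> rels (Suc t) s"
    proof cases
      case (coeff_add a b ls)
      then show ?thesis using l koszul_rels.coeff_add[of a gr s b "l # ls" "Suc t" V A]
        by (simp add: cvp.linear_diff[OF clinear_wedge] wedge_symb)
    next
      case (coeff_scale a ls c)
      then show ?thesis using l koszul_rels.coeff_scale[of a gr s "l # ls" "Suc t" V A c]
        by (simp add: cvp.linear_diff[OF clinear_wedge] cvp.linear_scale[OF clinear_wedge] wedge_symb)
    next
      case (form_add a ls i l1 l2)
      then show ?thesis using l koszul_rels.form_add[of a gr s "l # ls" "Suc t" V "Suc i" l1 l2 A]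
        by (simp add: cvp.linear_diff[OF clinear_wedge] wedge_symb)
    next
      case (form_scale a ls i l1 c)
      then show ?thesis using l koszul_rels.form_scale[of a gr s "l # ls" "Suc t" V "Suc i" l1 c A]
        by (simp add: cvp.linear_diff[OF clinear_wedge] cvp.linear_scale[OF clinear_wedge] wedge_symb)
    next
      case (alternating a ls i j)
      then show ?thesis using l koszul_rels.alternating[of a gr s "l # ls" "Suc t" V "Suc i" "Suc j" A]
        by (simp add: wedge_symb)
    qed
  qed
  with x show ?thesis by blast
qed

section \<open>Reordering and expanding symbols modulo the relations\<close>

abbreviation eqv where "eqv t s \<equiv> cong_mod (null t s)"

lemma eqv_trans: "eqv t s x y \<Longrightarrow> eqv t s y z \<Longrightarrow> eqv t s x z"
  by (rule cong_mod_trans[OF subspace_null])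
lemma eqv_refl: "eqv t s x x" by (rule cong_mod_refl[OF subspace_null])

lemma wedge_eqv: "l \<in> V \<Longrightarrow> eqv t s x y \<Longrightarrow> eqv (Suc t) s (wedge l x) (wedge l y)"
  using wedge_null[of l "x - y"] by (simp add: cong_mod_def cvp.linear_diff[OF clinear_wedge])

lemma wedge_form_add:
  assumes "l \<in> V" "l' \<in> V" "z \<in> free t s"
  shows "eqv (Suc t) s (wedge (l + l') z) (wedge l z + wedge l' z)"
proof (rule cong_free[OF clinear_wedge cvp.linear_compose_add[OF clinear_wedge clinear_wedge] assms(3) subspace_null])
  fix a ls assume "a \<in> gr s" "length ls = t" "set ls \<subseteq> V"
  then have "symb a ((l # ls)[0 := l + l']) - symb a ((l # ls)[0 := l]) - symb a ((l # ls)[0 := l']) \<in> null (Suc t) s"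
    using assms by (intro rels_null koszul_rels.form_add) auto
  then show "eqv (Suc t) s (wedge (l + l') (symb a ls)) (wedge l (symb a ls) + wedge l' (symb a ls))"
    by (simp add: wedge_symb cong_mod_def algebra_simps)
qed

lemma wedge_form_scale:
  assumes "l \<in> V" "z \<in> free t s"
  shows "eqv (Suc t) s (wedge (csc c l) z) (csc c (wedge l z))"
proof (rule cong_free[OF clinear_wedge cvp.linear_compose_scale_right[OF clinear_wedge] assms(2) subspace_null])
  fix a ls assume "a \<in> gr s" "length ls = t" "set ls \<subseteq> V"
  then have "symb a ((l # ls)[0 := Const c * l]) - csc c (symb a ((l # ls)[0 := l])) \<in> null (Suc t) s"
    using assms by (intro rels_null koszul_rels.form_scale) auto
  then show "eqv (Suc t) s (wedge (csc c l) (symb a ls)) (csc c (wedge l (symb a ls)))"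
    by (simp add: wedge_symb cong_mod_def Const_mult)
qed

lemma wedge_form_sum:
  assumes "finite I" "\<And>i. i \<in> I \<Longrightarrow> v i \<in> V" "z \<in> free t s"
  shows "eqv (Suc t) s (wedge (\<Sum>i\<in>I. csc (c i) (v i)) z) (\<Sum>i\<in>I. csc (c i) (wedge (v i) z))"
  using assms(1,2)
proof (induction I)
  case empty
  have "0 \<in> V" by (rule cvs.subspace_0[OF subspace_diff_forms])
  from wedge_form_scale[OF this assms(3), of 0] show ?case by simp
next
  case (insert j I)
  have sumV: "(\<Sum>i\<in>I. csc (c i) (v i)) \<in> V" "csc (c j) (v j) \<in> V"
    using insert subspace_diff_forms by (auto intro!: cvs.subspace_sum cvs.subspace_scale)
  have "eqv (Suc t) s (wedge (csc (c j) (v j)) z + wedge (\<Sum>i\<in>I. csc (c i) (v i)) z)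
     (csc (c j) (wedge (v j) z) + (\<Sum>i\<in>I. csc (c i) (wedge (v i) z)))"
    using insert assms(3) by (intro cong_mod_add subspace_null wedge_form_scale insert.IH) auto
  then show ?case
    using eqv_trans[OF wedge_form_add[OF sumV(2,1) assms(3)]] insert(1,2) by simp
qed

text \<open>Polarization: expand the vanishing symbol whose two leading entries are both
  \<open>l + l'\<close>.\<close>

lemma symb_swap:
  assumes "a \<in> gr s" "length ls = t" "set ls \<subseteq> V" "l \<in> V" "l' \<in> V"
  shows "eqv (Suc (Suc t)) s (symb a (l # l' # ls)) (- symb a (l' # l # ls))"
proof -
  let ?W = "null (Suc (Suc t)) s"
  let ?s = "\<lambda>x y. symb a (x # y # ls)"
  have alt: "?s x x \<in> ?W" if "x \<in> V" for x
    using that assms by (intro rels_null koszul_rels.alternating[where i = 0 and j = 1]) auto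
  have a1: "?s (l + l') y - ?s l y - ?s l' y \<in> ?W" if "y \<in> V" for y
    using that assms koszul_rels.form_add[of a gr s "l # y # ls" "Suc (Suc t)" V 0 l l' A] by (auto intro: rels_null)
  have a2: "?s x (l + l') - ?s x l - ?s x l' \<in> ?W" if "x \<in> V" for x
    using that assms koszul_rels.form_add[of a gr s "x # l # ls" "Suc (Suc t)" V 1 l l' A] by (auto intro: rels_null)
  note d = cvs.subspace_diff[OF subspace_null] and ll = V_add[OF assms(4,5)]
  have "?s l l' + ?s l' l = ?s (l + l') (l + l') - (?s (l + l') (l + l') - ?s l (l + l') - ?s l' (l + l'))
      - (?s l (l + l') - ?s l l - ?s l l') - (?s l' (l + l') - ?s l' l - ?s l' l') - ?s l l - ?s l' l'"
    by (simp add: algebra_simps)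
  also have "\<dots> \<in> ?W"
    by (rule d[OF d[OF d[OF d[OF d[OF alt[OF ll] a1[OF ll]] a2[OF assms(4)]] a2[OF assms(5)]] alt[OF assms(4)]] alt[OF assms(5)]])
  finally show ?thesis by (simp add: cong_mod_def)
qed

text \<open>Insertion sort with one sign change per transposition; a repeated index is killed by the
  alternating relation.\<close>

lemma symb_insort:
  assumes "a \<in> gr s" "sorted_wrt (<) xs" "set xs \<subseteq> N" "i \<in> N"
  shows "eqv (Suc (length xs)) s (symb a (map diff_var (i # xs)))
    (if i \<in> set xs then 0 else csc (sg i (set xs)) (symb a (map diff_var (insort i xs))))"
  using assms(2,3)
proof (induction xs)
  case Nil
  then show ?case by (simp add: sg_def eqv_refl)
next
  case (Cons x ys)
  have ysV: "set (map diff_var ys) \<subseteq> V" "diff_var x \<in> V" "diff_var i \<in> V"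
    using Cons.prems assms(4) by (auto simp del: atLeastAtMost_iff intro!: diff_var_V)
  consider "i < x" | "i = x" | "x < i" by linarith
  then show ?case
  proof cases
    case 1
    then have "{j \<in> set (x # ys). j < i} = {}" using Cons.prems by force
    then have "sg i (set (x # ys)) = 1" unfolding sg_def by (metis card.empty power_0)
    moreover have "i \<notin> set (x # ys)" using 1 Cons.prems by force
    ultimately show ?thesis using 1 by (simp add: eqv_refl)
  next
    case 2
    then have "symb a (map diff_var (i # x # ys)) \<in> null (Suc (length (x # ys))) s"
      using ysV assms(1) by (intro rels_null koszul_rels.alternating[where i = 0 and j = 1]) auto
    then show ?thesis using 2 by (simp add: cong_mod_def)
  next
    case 3
    \<comment> \<open>The form of \<open>i\<close> is swapped past that of \<open>x\<close>, and the
      induction hypothesis is applied behind the latter.\<close>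
    have x: "x \<notin> set ys" using Cons.prems by auto
    have "eqv (Suc (Suc (length ys))) s (wedge (diff_var x) (symb a (map diff_var (i # ys))))
       (wedge (diff_var x) (if i \<in> set ys then 0 else csc (sg i (set ys)) (symb a (map diff_var (insort i ys)))))"
      using Cons by (intro wedge_eqv ysV(2) Cons.IH) auto
    then have "eqv (Suc (Suc (length ys))) s (- wedge (diff_var x) (symb a (map diff_var (i # ys))))
       (- wedge (diff_var x) (if i \<in> set ys then 0 else csc (sg i (set ys)) (symb a (map diff_var (insort i ys)))))"
      by (rule cong_mod_neg[OF subspace_null])
    moreover have "eqv (Suc (Suc (length ys))) s (symb a (map diff_var (i # x # ys))) (- wedge (diff_var x) (symb a (map diff_var (i # ys))))"
      using symb_swap[OF assms(1) _ ysV(1) ysV(3) ysV(2)] by (simp add: wedge_symb)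
    ultimately have "eqv (Suc (Suc (length ys))) s (symb a (map diff_var (i # x # ys)))
       (- wedge (diff_var x) (if i \<in> set ys then 0 else csc (sg i (set ys)) (symb a (map diff_var (insort i ys)))))"
      using eqv_trans by blast
    also have "- wedge (diff_var x) (if i \<in> set ys then 0 else csc (sg i (set ys)) (symb a (map diff_var (insort i ys))))
      = (if i \<in> set (x # ys) then 0 else csc (sg i (set (x # ys))) (symb a (map diff_var (insort i (x # ys)))))"
      using 3 x by (simp add: wedge_symb sg_insert cvp.linear_0[OF clinear_wedge] cvp.linear_scale[OF clinear_wedge])
    finally show ?thesis by simp
  qed
qed

lemma sng_homogeneous: "u \<in> mons n s \<Longrightarrow> sng u \<in> homogeneous n s" by (simp add: homogeneous_eq_supported_on)

lemma finite_sub_N: "F \<subseteq> N \<Longrightarrow> finite F" using finite_subset by blast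

lemma from_chain_free:
  assumes "z \<in> graded n p t s"
  shows "from_chain z \<in> free t s"
proof (rule clinear_supported_on[OF clinear_from_chain assms[unfolded graded_def] _ subspace_free])
  fix k assume "k \<in> {(u, F). u \<in> mons n s \<and> F \<subseteq> N \<and> card F = t}"
  then obtain u F where k: "k = (u, F)" "u \<in> mons n s" "F \<subseteq> N" "card F = t" by auto
  have "diff_var ` F \<subseteq> V" using k(3) by (intro image_subsetI diff_var_V) auto
  then show "from_chain (sng k) \<in> free t s"
    unfolding k(1) from_chain_sng using k finite_sub_N[OF k(3)] sng_homogeneous by simp
qed

lemma from_chain_eps:
  assumes i: "i \<in> N" and z: "z \<in> graded n p t s"
  shows "eqv (Suc t) s (wedge (diff_var i) (from_chain z)) (from_chain (eps i z))"
proof (rule cong_mod_linear[OF clinear_comp[OF clinear_from_chain clinear_wedge] clinear_comp[OF clinear_eps clinear_from_chain] subspace_null])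
  fix k assume "k \<in> keys z"
  then obtain u F where k: "k = (u, F)" "u \<in> mons n s" "F \<subseteq> N" "card F = t"
    using z by (auto simp: graded_def supported_on_def)
  have finF: "finite F" by (rule finite_sub_N[OF k(3)])
  let ?xs = "sorted_list_of_set F"
  have "eqv (Suc (length ?xs)) s (symb (q (sng u)) (map diff_var (i # ?xs)))
    (if i \<in> set ?xs then 0 else csc (sg i (set ?xs)) (symb (q (sng u)) (map diff_var (insort i ?xs))))"
    using k sng_homogeneous finF i by (intro symb_insort) auto
  then show "eqv (Suc t) s (wedge (diff_var i) (from_chain (sng k))) (from_chain (eps i (sng k)))"
    using finF k by (cases "i \<in> F")
      (simp_all add: from_chain_sng wedge_symb eps_sng cvp.linear_0[OF clinear_from_chain] cvp.linear_scale[OF clinear_from_chain])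
qed

lemma from_chain_form_wedge:
  assumes l: "l \<in> V" and z: "z \<in> graded n p t s"
  shows "eqv (Suc t) s (wedge l (from_chain z)) (from_chain (form_wedge n p l z))"
proof -
  have "eqv (Suc t) s (wedge (\<Sum>i\<in>N. csc (coord i l) (diff_var i)) (from_chain z)) (\<Sum>i\<in>N. csc (coord i l) (wedge (diff_var i) (from_chain z)))"
    by (intro wedge_form_sum from_chain_free[OF z] diff_var_V) auto
  then have 1: "eqv (Suc t) s (wedge l (from_chain z)) (\<Sum>i\<in>N. csc (coord i l) (wedge (diff_var i) (from_chain z)))"
    by (simp only: diff_forms_expand[OF p l, symmetric])
  have 2: "eqv (Suc t) s (\<Sum>i\<in>N. csc (coord i l) (wedge (diff_var i) (from_chain z))) (\<Sum>i\<in>N. csc (coord i l) (from_chain (eps i z)))"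
    by (intro cong_mod_sum cong_mod_csc subspace_null from_chain_eps z)
  have "from_chain (form_wedge n p l z) = (\<Sum>i\<in>N. csc (coord i l) (from_chain (eps i z)))"
    by (simp add: form_wedge_def cvp.linear_sum[OF clinear_from_chain] cvp.linear_scale[OF clinear_from_chain])
  then show ?thesis using eqv_trans[OF 1 2] by simp
qed

text \<open>The scaling relation with factor 0.\<close>

lemma symb_zero_null:
  assumes "length ls = t" "set ls \<subseteq> V"
  shows "symb (q 0) ls \<in> null t s"
proof -
  have "0 \<in> homogeneous n s" by (simp add: homogeneous_eq_supported_on)
  then have "symb (Const 0 \<odot>\<^bsub>A\<^esub> q 0) ls - csc 0 (symb (q 0) ls) \<in> null t s"
    using assms by (intro rels_null koszul_rels.coeff_scale) auto
  moreover have "Const 0 \<odot>\<^bsub>A\<^esub> q 0 = q 0"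
    using q_scale_homogeneous[OF \<open>0 \<in> homogeneous n s\<close>] by simp
  ultimately show ?thesis by simp
qed

lemma symb_coeff_sum:
  assumes "finite I" "\<And>i. i \<in> I \<Longrightarrow> g i \<in> homogeneous n s" "length ls = t" "set ls \<subseteq> V"
  shows "eqv t s (symb (q (\<Sum>i\<in>I. csc (c i) (g i))) ls) (\<Sum>i\<in>I. csc (c i) (symb (q (g i)) ls))"
  using assms(1,2)
proof (induction I)
  case empty
  show ?case using symb_zero_null[OF assms(3,4)] by (simp add: cong_mod_def)
next
  case (insert j I)
  let ?S = "\<Sum>i\<in>I. csc (c i) (g i)"
  have h: "?S \<in> homogeneous n s" "csc (c j) (g j) \<in> homogeneous n s" "g j \<in> homogeneous n s"
    using insert unfolding homogeneous_eq_supported_on by (auto intro!: supported_on_sum supported_on_csc)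
  have "symb (q (csc (c j) (g j)) \<oplus>\<^bsub>A\<^esub> q ?S) ls - symb (q (csc (c j) (g j))) ls - symb (q ?S) ls \<in> null t s"
    using h assms by (intro rels_null koszul_rels.coeff_add) auto
  then have 1: "eqv t s (symb (q (csc (c j) (g j) + ?S)) ls) (symb (q (csc (c j) (g j))) ls + symb (q ?S) ls)"
    using q_add_homogeneous[OF h(2,1)] by (simp add: cong_mod_def algebra_simps)
  have "symb (Const (c j) \<odot>\<^bsub>A\<^esub> q (g j)) ls - csc (c j) (symb (q (g j)) ls) \<in> null t s"
    using h assms by (intro rels_null koszul_rels.coeff_scale) auto
  then have 2: "eqv t s (symb (q (csc (c j) (g j))) ls) (csc (c j) (symb (q (g j)) ls))"
    using q_scale_homogeneous[OF h(3)] by (simp add: cong_mod_def)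
  have "eqv t s (symb (q (csc (c j) (g j))) ls + symb (q ?S) ls)
    (csc (c j) (symb (q (g j)) ls) + (\<Sum>i\<in>I. csc (c i) (symb (q (g i)) ls)))"
    using insert by (intro cong_mod_add subspace_null 2 insert.IH) auto
  with 1 show ?case using insert(1,2) eqv_trans by simp
qed

text \<open>By induction on the list: a new form acts by \<open>wedge\<close> on symbols and by
  \<open>form_wedge\<close> on chains, and \<open>from_chain\<close> intertwines the two.\<close>

lemma from_chain_wedge_chain:
  assumes f: "f \<in> homogeneous n s" and ls: "set ls \<subseteq> V"
  shows "eqv (length ls) s (symb (q f) ls) (from_chain (wedge_chain n p f ls))"
  using ls
proof (induction ls)
  case Nil
  have "eqv 0 s (symb (q (\<Sum>u\<in>keys f. csc (lookup f u) (sng u))) []) (\<Sum>u\<in>keys f. csc (lookup f u) (symb (q (sng u)) []))"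
    using f by (intro symb_coeff_sum) (auto simp: homogeneous_eq_supported_on supported_on_def)
  also have "(\<Sum>u\<in>keys f. csc (lookup f u) (sng u)) = f" by (rule poly_mapping_expand[symmetric])
  also have "(\<Sum>u\<in>keys f. csc (lookup f u) (symb (q (sng u)) [])) = from_chain (embed f)"
    by (subst (3) poly_mapping_expand[of f])
       (simp add: cvp.linear_sum[OF clinear_embed] cvp.linear_scale[OF clinear_embed]
        cvp.linear_sum[OF clinear_from_chain] cvp.linear_scale[OF clinear_from_chain] from_chain_sng)
  finally show ?case by simp
next
  case (Cons l ls)
  have 1: "eqv (Suc (length ls)) s (wedge l (symb (q f) ls)) (wedge l (from_chain (wedge_chain n p f ls)))"
    using Cons by (intro wedge_eqv Cons.IH) auto
  have 2: "eqv (Suc (length ls)) s (wedge l (from_chain (wedge_chain n p f ls))) (from_chain (form_wedge n p l (wedge_chain n p f ls)))"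
    using Cons.prems by (intro from_chain_form_wedge wedge_chain_graded f) auto
  show ?case using eqv_trans[OF 1 2] by (simp add: wedge_symb)
qed

lemma from_chain_to_chain:
  assumes "z \<in> free t s"
  shows "eqv t s z (from_chain (to_chain s z))"
proof (rule cong_free[OF clinear_id clinear_comp[OF clinear_to_chain clinear_from_chain] assms subspace_null])
  fix a ls assume *: "a \<in> gr s" "length ls = t" "set ls \<subseteq> V"
  show "eqv t s (symb a ls) (from_chain (to_chain s (symb a ls)))"
    using from_chain_wedge_chain[of "rep s a" s ls] rep[OF *(1)] * by (simp add: to_chain_symb)
qed

lemma wedge_chain_sng:
  "sorted_wrt (<) xs \<Longrightarrow> set xs \<subseteq> N \<Longrightarrow> wedge_chain n p (sng u) (map diff_var xs) = sng (u, set xs)"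
proof (induction xs)
  case (Cons x xs)
  have coord: "coord i (diff_var x) = (if i = x then 1 else 0)" if "i \<in> N" for i
    using that coord_Var[of i x] coord_Var[of i p] by (simp add: coord_def lookup_minus)
  have "form_wedge n p (diff_var x) (sng (u, set xs)) = (\<Sum>i\<in>N. if i = x then eps i (sng (u, set xs)) else 0)"
    unfolding form_wedge_def by (intro sum.cong refl) (simp add: coord)
  also have "\<dots> = eps x (sng (u, set xs))" using Cons.prems by simp
  also have "\<dots> = sng (u, set (x # xs))"
  proof -
    have "{j \<in> set xs. j < x} = {}" "x \<notin> set xs" using Cons.prems by force+
    then show ?thesis by (simp add: eps_sng sg_def del: Collect_empty_eq)
  qed
  finally show ?case using Cons by simp
qed simp

lemma to_chain_from_chain:
  assumes "z \<in> graded n p t s"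
  shows "cong_mod (chains_in M) (to_chain s (from_chain z)) z"
proof (rule cong_mod_linear[OF clinear_comp[OF clinear_from_chain clinear_to_chain] clinear_id subspace_chains_in])
  fix k assume "k \<in> keys z"
  then obtain u F where k: "k = (u, F)" "u \<in> mons n s" "F \<subseteq> N" using assms by (auto simp: graded_def supported_on_def)
  let ?xs = "sorted_list_of_set F"
  have "cong_mod (chains_in M) (wedge_chain n p (rep s (q (sng u))) (map diff_var ?xs)) (wedge_chain n p (sng u) (map diff_var ?xs))"
    by (rule rep_cong[OF sng_homogeneous[OF k(2)]])
  also have "wedge_chain n p (sng u) (map diff_var ?xs) = sng (u, F)"
    using wedge_chain_sng[of ?xs u] k(3) finite_sub_N[OF k(3)] by simp
  finally show "cong_mod (chains_in M) (to_chain s (from_chain (sng k))) (sng k)"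
    by (simp add: k(1) from_chain_sng to_chain_symb)
qed

text \<open>The relations are exactly the kernel of \<open>to_chain\<close> modulo \<open>M\<close>:
  a monomial in \<open>M\<close> has class \<open>q 0\<close>, so \<open>from_chain\<close> sends
  chains over \<open>M\<close> to relations, and going to chains and back returns \<open>z\<close>
  modulo relations.\<close>

lemma null_iff:
  assumes "z \<in> free t s"
  shows "z \<in> null t s \<longleftrightarrow> to_chain s z \<in> chains_in M"
proof
  assume to_chain: "to_chain s z \<in> chains_in M"
  have "from_chain y \<in> null t s" if "y \<in> graded n p t s" "y \<in> chains_in M" for y
  proof (rule clinear_supported_on[OF clinear_from_chain])
    show "y \<in> supported_on {(u, F). u \<in> mons n s \<inter> M \<and> F \<subseteq> N \<and> card F = t}"
      using that by (auto simp: graded_def chains_in_def supported_on_def)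
    fix k assume "k \<in> {(u, F). u \<in> mons n s \<inter> M \<and> F \<subseteq> N \<and> card F = t}"
    then obtain u F where k: "k = (u, F)" "u \<in> mons n s" "u \<in> M" "F \<subseteq> N" "card F = t" by auto
    have contract: "sng u \<in> homogeneous n s" "0 \<in> homogeneous n s"
      using k by (auto simp: homogeneous_eq_supported_on)
    have "q (sng u) = q 0" using q_eq[of "sng u" 0] contract homogeneous_carrier k(3) by simp
    moreover have "diff_var ` F \<subseteq> V" using k(4) by (intro image_subsetI diff_var_V) auto
    then have "symb (q 0) (map diff_var (sorted_list_of_set F)) \<in> null t s"
      using k finite_sub_N[OF k(4)] by (intro symb_zero_null) auto
    ultimately show "from_chain (sng k) \<in> null t s" by (simp add: k(1) from_chain_sng)
  qed simp
  then have "from_chain (to_chain s z) \<in> null t s" using to_chain to_chain_graded[OF assms] by blast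
  then show "z \<in> null t s" using cong_mod_mem[OF subspace_null from_chain_to_chain[OF assms]] by blast
qed (rule to_chain_null)

section \<open>Agreement of cycles, boundaries and homology\<close>

abbreviation cyc where "cyc t s \<equiv> koszul_cycles A gr V t s"
abbreviation bnd where "bnd t s \<equiv> koszul_boundaries A gr V t s"

lemma cycles_iff:
  assumes "z \<in> free t s"
  shows "z \<in> cyc t s \<longleftrightarrow> to_chain s z \<in> rel_cycles n p UNIV M t s"
proof (cases t)
  case 0
  then show ?thesis using assms to_chain_graded[OF assms] kdiff_graded_0[of "to_chain s z" n p s] by (simp add: koszul_cycles_def rel_cycles_def)
next
  case (Suc t')
  have "koszul_diff A z \<in> null t' (Suc s) \<longleftrightarrow> to_chain (Suc s) (koszul_diff A z) \<in> chains_in M"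
    using null_iff koszul_diff_free assms Suc by blast
  also have "\<dots> \<longleftrightarrow> - kdiff n p (to_chain s z) \<in> chains_in M"
    by (rule cong_mod_mem[OF subspace_chains_in to_chain_koszul_diff[OF assms]])
  also have "\<dots> \<longleftrightarrow> kdiff n p (to_chain s z) \<in> chains_in M"
    using cvs.subspace_neg[OF subspace_chains_in] by (metis add.inverse_inverse)
  finally show ?thesis using assms to_chain_graded[OF assms] Suc by (simp add: koszul_cycles_def rel_cycles_def)
qed

lemma boundaries_free: "bnd t s \<subseteq> free t s"
proof
  fix x assume "x \<in> bnd t s"
  then obtain w z where x: "x = w + koszul_diff A z" "w \<in> null t s"
    "case s of 0 \<Rightarrow> z = 0 | Suc s' \<Rightarrow> z \<in> free (Suc t) s'" by (auto simp: koszul_boundaries_def)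
  have "koszul_diff A z \<in> free t s"
    using x(3) koszul_diff_free
    by (cases s) (auto simp: cvp.linear_0[OF clinear_koszul_diff] cvs.subspace_0)
  then show "x \<in> free t s"
    unfolding x(1) using x(2) null_free by (intro cvs.subspace_add[OF subspace_free]) auto
qed

lemma boundaries_iff:
  assumes "x \<in> free t s"
  shows "x \<in> bnd t s \<longleftrightarrow> to_chain s x \<in> rel_bounds n p UNIV M t s"
proof
  assume "x \<in> bnd t s"
  then obtain w z where x: "x = w + koszul_diff A z" "w \<in> null t s"
    "case s of 0 \<Rightarrow> z = 0 | Suc s' \<Rightarrow> z \<in> free (Suc t) s'" by (auto simp: koszul_boundaries_def)
  show "to_chain s x \<in> rel_bounds n p UNIV M t s"
  proof (cases s)
    case 0
    then have "to_chain s x \<in> chains_in M" using x to_chain_null by (simp add: cvp.linear_0[OF clinear_koszul_diff])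
    then show ?thesis using rel_boundsI[OF to_chain_graded[OF assms], of M 0 UNIV] by (simp add: kdiff_0)
  next
    case (Suc s')
    then have z: "z \<in> free (Suc t) s'" using x by simp
    \<comment> \<open>The sign of \<open>to_chain_koszul_diff\<close> is absorbed by the bounding
      chain.\<close>
    have "to_chain s x = to_chain s w + to_chain s (koszul_diff A z)" unfolding x(1) by (rule cvp.linear_add[OF clinear_to_chain])
    then have "to_chain s x - kdiff n p (- to_chain s' z) = to_chain s w + (to_chain s (koszul_diff A z) - (- kdiff n p (to_chain s' z)))"
      by (simp add: cvp.linear_neg[OF clinear_kdiff])
    also have "\<dots> \<in> chains_in M"
      using to_chain_null[OF x(2)] to_chain_koszul_diff[OF z] Suc by (intro chains_in_add) (auto simp: cong_mod_def)
    finally have K: "to_chain s x - kdiff n p (- to_chain s' z) \<in> chains_in M" .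
    have zG: "- to_chain s' z \<in> graded n p (Suc t) s'" using to_chain_graded[OF z] by (rule cvs.subspace_neg[OF subspace_graded])
    have "to_chain s x - kdiff n p (- to_chain s' z) \<in> graded n p t s"
      using to_chain_graded[OF assms] kdiff_graded[OF p zG] Suc by (auto intro: graded_diff)
    from rel_boundsI[OF this K, of "- to_chain s' z" UNIV] zG Suc show ?thesis by simp
  qed
next
  assume "to_chain s x \<in> rel_bounds n p UNIV M t s"
  then obtain w z where z: "to_chain s x = w + kdiff n p z" "w \<in> chains_in M" "z \<in> graded_pred n p (Suc t) s" by (rule rel_boundsE)
  show "x \<in> bnd t s"
  proof (cases s)
    case 0
    then have "to_chain s x \<in> chains_in M" using z by (simp add: graded_pred_def kdiff_0)
    then have "x \<in> null t s" using null_iff[OF assms] by simp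
    then show ?thesis unfolding koszul_boundaries_def mem_Collect_eq
      using 0 by (intro exI[of _ x] exI[of _ 0]) (simp add: cvp.linear_0[OF clinear_koszul_diff])
  next
    case (Suc s')
    then have zG: "z \<in> graded n p (Suc t) s'" using z by simp
    \<comment> \<open>The lift of \<open>z\<close> returns to \<open>z\<close> only modulo
      \<open>M\<close>, so its boundary is off by a chain over \<open>M\<close>;
      \<open>null_iff\<close> turns this error into relations.\<close>
    define y where "y = from_chain z"
    have y: "y \<in> free (Suc t) s'" unfolding y_def by (rule from_chain_free[OF zG])
    have dy: "koszul_diff A y \<in> free t s" using koszul_diff_free[OF y] Suc by simp
    have 1: "to_chain s (koszul_diff A y) - (- kdiff n p (to_chain s' y)) \<in> chains_in M"
      using to_chain_koszul_diff[OF y] Suc by (simp add: cong_mod_def)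
    have 2: "kdiff n p (to_chain s' y - z) \<in> chains_in M"
      using kdiff_chains_in[OF p M] to_chain_from_chain[OF zG] by (simp add: cong_mod_def y_def)
    have "to_chain s (x + koszul_diff A y) = w + (to_chain s (koszul_diff A y) - (- kdiff n p (to_chain s' y))) - kdiff n p (to_chain s' y - z)"
      by (simp add: cvp.linear_add[OF clinear_to_chain] z(1) kdiff_diff)
    also have "\<dots> \<in> chains_in M" by (rule chains_in_diff[OF chains_in_add[OF z(2) 1] 2])
    finally have "x + koszul_diff A y \<in> null t s"
      using null_iff cvs.subspace_add[OF subspace_free assms dy] by blast
    moreover have "- y \<in> free (Suc t) s'" using y by (rule cvs.subspace_neg[OF subspace_free])
    moreover have "x = (x + koszul_diff A y) + koszul_diff A (- y)"
      by (simp add: cvp.linear_neg[OF clinear_koszul_diff])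
    ultimately show ?thesis unfolding koszul_boundaries_def mem_Collect_eq using Suc
      by (intro exI[of _ "x + koszul_diff A y"] exI[of _ "- y"]) simp
  qed
qed

lemma cycles_free: "cyc t s \<subseteq> free t s" by (auto simp: koszul_cycles_def)

lemma cycles_eq: "cyc t s = free t s \<inter> to_chain s -` rel_cycles n p UNIV M t s"
  using cycles_iff cycles_free by blast

lemma boundaries_eq: "bnd t s = free t s \<inter> to_chain s -` rel_bounds n p UNIV M t s"
  using boundaries_iff boundaries_free by blast

lemma subspace_vimage_to_chain: "cvs.subspace W \<Longrightarrow> cvs.subspace (free t s \<inter> to_chain s -` W)"
  using cvp.linear_subspace_vimage[OF clinear_to_chain] by (intro cvs.subspace_inter) auto

lemma subspace_boundaries: "cvs.subspace (bnd t s)"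
  unfolding boundaries_eq by (intro subspace_vimage_to_chain subspace_rel_bounds)

lemma subspace_cycles: "cvs.subspace (cyc t s)"
  unfolding cycles_eq by (intro subspace_vimage_to_chain subspace_rel_cycles)

text \<open>Stated as an equivalence because the left side does not mention the root.\<close>

lemma qdim_presentation_iff:
  "qdim (cyc t s) (bnd t s) d \<longleftrightarrow> qdim (rel_cycles n p UNIV M t s) (rel_bounds n p UNIV M t s) d"
proof -
  have BZ: "rel_bounds n p UNIV M t s \<subseteq> rel_cycles n p UNIV M t s"
    by (rule rel_bounds_subset_rel_cycles) (use p M in \<open>auto simp: upset_def\<close>)
  have surj: "\<exists>u\<in>cyc t s. v - to_chain s u \<in> rel_bounds n p UNIV M t s" if v: "v \<in> rel_cycles n p UNIV M t s" for v
  proof -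
    have vG: "v \<in> graded n p t s" using v by (simp add: rel_cycles_def)
    let ?u = "from_chain v"
    have uf: "?u \<in> free t s" by (rule from_chain_free[OF vG])
    have "v - to_chain s ?u \<in> chains_in M" using cong_mod_sym[OF subspace_chains_in to_chain_from_chain[OF vG]] by (simp add: cong_mod_def)
    moreover have "v - to_chain s ?u \<in> graded n p t s" using vG to_chain_graded[OF uf] by (rule graded_diff)
    ultimately have B: "v - to_chain s ?u \<in> rel_bounds n p UNIV M t s"
      using rel_boundsI[of "v - to_chain s ?u" n p t s M 0 UNIV] by (simp add: kdiff_0)
    have "v - (v - to_chain s ?u) \<in> rel_cycles n p UNIV M t s"
      by (rule cvs.subspace_diff[OF subspace_rel_cycles v subsetD[OF BZ B]])
    then have "to_chain s ?u \<in> rel_cycles n p UNIV M t s" by simp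
    then show ?thesis using B cycles_iff[OF uf] by blast
  qed
  have inj: "u \<in> bnd t s" if "u \<in> cyc t s" "to_chain s u \<in> rel_bounds n p UNIV M t s" for u
    using that boundaries_iff cycles_free by blast
  show ?thesis
  proof
    assume "qdim (cyc t s) (bnd t s) d"
    then show "qdim (rel_cycles n p UNIV M t s) (rel_bounds n p UNIV M t s) d"
    proof (rule qdim_image[OF clinear_to_chain subspace_rel_bounds])
      have "cvs.span (cyc t s) = cyc t s" using subspace_cycles by (simp add: cvs.span_eq_iff)
      then show "u \<in> bnd t s" if "u \<in> cvs.span (cyc t s)" "to_chain s u \<in> rel_bounds n p UNIV M t s" for u
        using that inj by blast
    qed (use surj in \<open>auto simp: cycles_eq boundaries_eq\<close>)
  next
    assume "qdim (rel_cycles n p UNIV M t s) (rel_bounds n p UNIV M t s) d"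
    then show "qdim (cyc t s) (bnd t s) d"
      by (rule qdim_transfer[OF clinear_to_chain subspace_cycles subspace_boundaries subspace_rel_bounds])
         (use surj inj BZ in \<open>auto simp: cycles_eq boundaries_eq\<close>)
  qed
qed

lemma tor_dim_eq:
  "qdim (rel_cycles n p UNIV M t s) (rel_bounds n p UNIV M t s) d \<Longrightarrow> tor_dim A gr V t s = d"
  unfolding tor_dim_def qdim_presentation_iff[symmetric] by (rule quotient_dim_eq[OF subspace_boundaries])

end

section \<open>Monomial ideals\<close>

lemma upset_add:
  assumes "upset n M" "u \<in> M" "keys v \<subseteq> {1..n}"
  shows "u + v \<in> M"
  using assms(3)
proof (induction "monom_degree v" arbitrary: v)
  case 0
  then have "v = 0" by (simp add: monom_degree_eq_0_iff)
  then show ?case using assms(2) by simp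
next
  case (Suc d)
  have "v \<noteq> 0" using Suc.hyps(2) by auto
  then obtain i where i: "i \<in> keys v" by (metis all_not_in_conv keys_eq_empty)
  then obtain w where w: "v = w + xm i" by (rule monom_split_var)
  then have "u + w \<in> M" using Suc by (intro Suc.hyps(1)) auto
  then have "(u + w) + xm i \<in> M" using assms(1) i Suc.prems by (auto simp: upset_def)
  then show ?case by (simp add: w add.assoc)
qed

lemma poly_ring_simps [simp]:
  "f \<oplus>\<^bsub>poly_ring n\<^esub> g = f + g" "f \<otimes>\<^bsub>poly_ring n\<^esub> g = f * g" "\<one>\<^bsub>poly_ring n\<^esub> = 1" "\<zero>\<^bsub>poly_ring n\<^esub> = 0"
  by (simp_all add: poly_ring_def)

lemma poly_ring_mult_closed: "f \<in> carrier (poly_ring n) \<Longrightarrow> g \<in> carrier (poly_ring n) \<Longrightarrow> f * g \<in> carrier (poly_ring n)"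
  using keys_mult[of f g] by (fastforce simp: poly_ring_def)

lemma cring_poly_ring: "cring (poly_ring n)"
proof (rule cringI)
  show "abelian_group (poly_ring n)"
  proof (rule abelian_groupI)
    show "\<exists>y\<in>carrier (poly_ring n). y \<oplus>\<^bsub>poly_ring n\<^esub> x = \<zero>\<^bsub>poly_ring n\<^esub>" if "x \<in> carrier (poly_ring n)" for x
      using that by (intro bexI[of _ "- x"]) (auto simp: carrier_eq_supported_on intro: supported_on_neg)
  qed (auto simp: carrier_eq_supported_on ac_simps intro: supported_on_add)
  show "Group.comm_monoid (poly_ring n)"
    by (rule comm_monoidI) (auto simp: ac_simps poly_ring_mult_closed, simp add: poly_ring_def)
qed (auto simp: distrib_right)

lemma a_inv_poly_ring: "f \<in> carrier (poly_ring n) \<Longrightarrow> \<ominus>\<^bsub>poly_ring n\<^esub> f = - f"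
proof -
  assume f: "f \<in> carrier (poly_ring n)"
  interpret cring "poly_ring n" by (rule cring_poly_ring)
  show ?thesis by (rule minus_equality) (use f in \<open>auto simp: carrier_eq_supported_on intro: supported_on_neg\<close>)
qed

definition mono_ideal :: "nat \<Rightarrow> (nat \<Rightarrow>\<^sub>0 nat) set \<Rightarrow> mpoly set" where
  "mono_ideal n M = {f \<in> carrier (poly_ring n). keys f \<subseteq> M}"

lemma ideal_mono_ideal:
  assumes M: "upset n M"
  shows "ideal (mono_ideal n M) (poly_ring n)"
proof -
  interpret cring "poly_ring n" by (rule cring_poly_ring)
  have eq: "mono_ideal n M = supported_on {u. keys u \<subseteq> {1..n} \<and> u \<in> M}"
    by (auto simp: mono_ideal_def carrier_eq_supported_on supported_on_def)
  have mult: "g * f \<in> mono_ideal n M" if "f \<in> mono_ideal n M" "g \<in> carrier (poly_ring n)" for f g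
  proof -
    have "keys (g * f) \<subseteq> M"
    proof
      fix k assume "k \<in> keys (g * f)"
      then obtain a b where "k = a + b" "a \<in> keys g" "b \<in> keys f" using keys_mult[of g f] by blast
      then show "k \<in> M" using upset_add[OF M, of b a] that
        by (auto simp: mono_ideal_def poly_ring_def add.commute)
    qed
    then show ?thesis using that poly_ring_mult_closed by (simp add: mono_ideal_def)
  qed
  show ?thesis
  proof (rule idealI[OF ring_axioms])
    show "subgroup (mono_ideal n M) (add_monoid (poly_ring n))"
    proof (rule add.subgroupI)
      show "mono_ideal n M \<subseteq> carrier (poly_ring n)" by (auto simp: mono_ideal_def)
      show "mono_ideal n M \<noteq> {}" using supported_on_0 unfolding eq by blast
      show "\<ominus>\<^bsub>poly_ring n\<^esub> f \<in> mono_ideal n M" if "f \<in> mono_ideal n M" for f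
      proof -
        have "f \<in> carrier (poly_ring n)" using that by (simp add: mono_ideal_def)
        then show ?thesis using that supported_on_neg unfolding eq by (simp add: a_inv_poly_ring)
      qed
      show "f \<oplus>\<^bsub>poly_ring n\<^esub> g \<in> mono_ideal n M" if "f \<in> mono_ideal n M" "g \<in> mono_ideal n M" for f g
        using that unfolding eq by (simp add: supported_on_add)
    qed
  qed (use mult in \<open>auto simp: mult.commute\<close>)
qed

text \<open>The shape of \<open>fan_module\<close> for any monomial ideal, so that the comparison
  also applies to the intermediate ideals of the filtration.\<close>

definition quotient_module :: "nat \<Rightarrow> (nat \<Rightarrow>\<^sub>0 nat) set \<Rightarrow> (mpoly, mpoly set) module" where
  "quotient_module n M =
    (let S = poly_ring n; J = mono_ideal n M; Q = S Quot J in
     \<lparr>carrier = carrier Q, monoid.mult = monoid.mult Q, one = one Q, zero = zero Q, add = add Q,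
      module.smult = (\<lambda>f X. (J +>\<^bsub>S\<^esub> f) \<otimes>\<^bsub>Q\<^esub> X)\<rparr>)"

lemma koszul_quotient_mono_ideal:
  assumes "p \<in> {1..n}" and M: "upset n M"
  shows "koszul_quotient n p (quotient_module n M) (\<lambda>f. mono_ideal n M +>\<^bsub>poly_ring n\<^esub> f) M"
proof -
  interpret cring "poly_ring n" by (rule cring_poly_ring)
  interpret J: ideal "mono_ideal n M" "poly_ring n" by (rule ideal_mono_ideal[OF M])
  show ?thesis
  proof
    fix f g assume fg: "f \<in> carrier (poly_ring n)" "g \<in> carrier (poly_ring n)"
    show "(mono_ideal n M +>\<^bsub>poly_ring n\<^esub> f) \<oplus>\<^bsub>quotient_module n M\<^esub> (mono_ideal n M +>\<^bsub>poly_ring n\<^esub> g)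
        = mono_ideal n M +>\<^bsub>poly_ring n\<^esub> (f + g)"
      using J.a_rcos_sum[OF fg] by (simp add: quotient_module_def Let_def FactRing_def)
    show "f \<odot>\<^bsub>quotient_module n M\<^esub> (mono_ideal n M +>\<^bsub>poly_ring n\<^esub> g) = mono_ideal n M +>\<^bsub>poly_ring n\<^esub> (f * g)"
      using J.rcoset_mult_add[OF fg] by (simp add: quotient_module_def Let_def FactRing_def)
    have "f \<ominus>\<^bsub>poly_ring n\<^esub> g = f - g"
      unfolding a_minus_def a_inv_poly_ring[OF fg(2)] by simp
    moreover have "f - g \<in> carrier (poly_ring n)" using fg unfolding carrier_eq_supported_on by (rule supported_on_diff)
    then have "f - g \<in> mono_ideal n M \<longleftrightarrow> keys (f - g) \<subseteq> M" unfolding mono_ideal_def by blast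
    ultimately show "(mono_ideal n M +>\<^bsub>poly_ring n\<^esub> f = mono_ideal n M +>\<^bsub>poly_ring n\<^esub> g) \<longleftrightarrow> keys (f - g) \<subseteq> M"
      using quotient_eq_iff_same_a_r_cos[OF J.ideal_axioms fg] by metis
  qed (use assms in auto)
qed

text \<open>Both sides equal the dimension for the presented complex of
  \<open>quotient_module n M\<close>, where no root occurs.\<close>

lemma qdim_root_independent:
  assumes "p \<in> {1..n}" "p' \<in> {1..n}" "upset n M"
    and "qdim (rel_cycles n p UNIV M t s) (rel_bounds n p UNIV M t s) d"
  shows "qdim (rel_cycles n p' UNIV M t s) (rel_bounds n p' UNIV M t s) d"
  using koszul_quotient.qdim_presentation_iff[OF koszul_quotient_mono_ideal[OF assms(1,3)], of t s d]
    koszul_quotient.qdim_presentation_iff[OF koszul_quotient_mono_ideal[OF assms(2,3)], of t s d] assms(4)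
  by blast

section \<open>Squarefree monomials and the ideals they generate\<close>

definition set_mono :: "nat set \<Rightarrow> (nat \<Rightarrow>\<^sub>0 nat)" where "set_mono B = (\<Sum>i\<in>B. xm i)"

lemma lookup_set_mono: "finite B \<Longrightarrow> lookup (set_mono B) i = (if i \<in> B then 1 else 0)"
proof -
  assume B: "finite B"
  have "lookup (set_mono B) i = (\<Sum>j\<in>B. if j = i then 1 else 0)"
    unfolding set_mono_def lookup_sum by (intro sum.cong) (auto simp: xm_def lookup_single when_def)
  then show ?thesis using B by simp
qed

lemma keys_set_mono: "finite B \<Longrightarrow> keys (set_mono B) = B"
  by (auto simp: in_keys_iff lookup_set_mono split: if_splits)

lemma monom_degree_set_mono: "finite B \<Longrightarrow> monom_degree (set_mono B) = card B"
  by (simp add: monom_degree_def keys_set_mono lookup_set_mono)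

lemma prod_Var: "finite B \<Longrightarrow> (\<Prod>i\<in>B. Var i) = sng (set_mono B)"
  by (induction B rule: finite_induct) (simp_all add: set_mono_def Var_mult_sng add.commute)

definition gen_upset :: "nat \<Rightarrow> nat set set \<Rightarrow> (nat \<Rightarrow>\<^sub>0 nat) set" where
  "gen_upset n \<B> = {set_mono B + v | B v. B \<in> \<B> \<and> keys v \<subseteq> {1..n}}"

lemma upset_gen_upset: "upset n (gen_upset n \<B>)"
  unfolding upset_def
proof (intro ballI)
  fix u i assume "u \<in> gen_upset n \<B>" and i: "i \<in> {1..n}"
  then obtain B v where u: "u = set_mono B + v" "B \<in> \<B>" "keys v \<subseteq> {1..n}" by (auto simp: gen_upset_def)
  then show "u + xm i \<in> gen_upset n \<B>"
    using i unfolding gen_upset_def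
    by (intro CollectI exI[of _ B] exI[of _ "v + xm i"]) (auto simp: add.assoc)
qed

lemma genideal_monomials:
  assumes B: "\<And>B. B \<in> \<B> \<Longrightarrow> B \<subseteq> {1..n}"
  shows "Idl\<^bsub>poly_ring n\<^esub> ((\<lambda>B. \<Prod>i\<in>B. Var i) ` \<B>) = mono_ideal n (gen_upset n \<B>)"
proof
  interpret cring "poly_ring n" by (rule cring_poly_ring)
  have fin: "finite B" if "B \<in> \<B>" for B using B[OF that] finite_subset by blast
  have gens: "(\<lambda>B. \<Prod>i\<in>B. Var i) ` \<B> = (\<lambda>B. sng (set_mono B)) ` \<B>"
    using fin by (intro image_cong refl prod_Var)
  have carr: "sng (set_mono B) \<in> carrier (poly_ring n)" if "B \<in> \<B>" for B
    using B[OF that] fin[OF that] by (auto simp: carrier_eq_supported_on keys_set_mono)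
  have sub: "(\<lambda>B. sng (set_mono B)) ` \<B> \<subseteq> carrier (poly_ring n)" using carr by blast
  show "Idl\<^bsub>poly_ring n\<^esub> ((\<lambda>B. \<Prod>i\<in>B. Var i) ` \<B>) \<subseteq> mono_ideal n (gen_upset n \<B>)"
    unfolding gens
  proof (rule genideal_minimal[OF ideal_mono_ideal[OF upset_gen_upset]], rule image_subsetI)
    fix B assume "B \<in> \<B>"
    then have "set_mono B + 0 \<in> gen_upset n \<B>" unfolding gen_upset_def by (intro CollectI exI[of _ B] exI[of _ 0]) auto
    then show "sng (set_mono B) \<in> mono_ideal n (gen_upset n \<B>)"
      using carr \<open>B \<in> \<B>\<close> by (simp add: mono_ideal_def)
  qed
  show "mono_ideal n (gen_upset n \<B>) \<subseteq> Idl\<^bsub>poly_ring n\<^esub> ((\<lambda>B. \<Prod>i\<in>B. Var i) ` \<B>)"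
    unfolding gens
  proof
    let ?I = "Idl\<^bsub>poly_ring n\<^esub> ((\<lambda>B. sng (set_mono B)) ` \<B>)"
    interpret I: ideal ?I "poly_ring n" by (rule genideal_ideal[OF sub])
    fix f assume f: "f \<in> mono_ideal n (gen_upset n \<B>)"
    have term_mem: "csc c (sng k) \<in> ?I" if k: "k \<in> gen_upset n \<B>" for k c
    proof -
      from k obtain B v where k': "k = set_mono B + v" "B \<in> \<B>" "keys v \<subseteq> {1..n}" by (auto simp: gen_upset_def)
      have "csc c (sng v) \<in> carrier (poly_ring n)" using k' unfolding carrier_eq_supported_on by (intro supported_on_csc) auto
      moreover have "sng (set_mono B) \<in> ?I" using genideal_self[OF sub] k' by auto
      ultimately have "csc c (sng v) \<otimes>\<^bsub>poly_ring n\<^esub> sng (set_mono B) \<in> ?I" by (rule I.I_l_closed[rotated])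
      then show ?thesis by (simp add: mult_csc_left mult_single k' add.commute)
    qed
    have "(\<Sum>k\<in>A. csc (lookup f k) (sng k)) \<in> ?I" if "finite A" "A \<subseteq> gen_upset n \<B>" for A
      using that
    proof (induction A)
      case empty
      then show ?case using I.zero_closed by simp
    next
      case (insert k A)
      then show ?case using I.a_closed[OF term_mem[of k "lookup f k"]] by simp
    qed
    from this[of "keys f"] f show "f \<in> ?I"
      using poly_mapping_expand[of f] by (simp add: mono_ideal_def)
  qed
qed

section \<open>Matroids and linear quotients\<close>

lemma card_swap:
  assumes "finite B" "y \<in> B" "i \<notin> B"
  shows "card (insert i (B - {y})) = card B"
proof -
  have "card (insert i (B - {y})) = Suc (card (B - {y}))" using assms by simp
  also have "\<dots> = card B" using assms(1,2) by (rule card_Suc_Diff1)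
  finally show ?thesis .
qed

section \<open>Bases, exchange and fundamental circuits\<close>

context matroid
begin

lemma finite_indep: "X \<in> \<I> \<Longrightarrow> finite X"
  using indep_subset_ground finite_ground finite_subset by blast

lemma finite_indep_sets: "finite \<I>"
  using indep_subset_ground finite_ground by (intro finite_subset[of \<I> "Pow E"]) auto

lemma indep_card_le_rank: "X \<in> \<I> \<Longrightarrow> card X \<le> matroid_rank \<I>"
  unfolding matroid_rank_def using finite_indep_sets by (intro Max_ge) auto

lemma basis_indep: "B \<in> bases \<I> \<Longrightarrow> B \<in> \<I>"
  by (simp add: bases_def)

lemma basis_ground: "B \<in> bases \<I> \<Longrightarrow> B \<subseteq> E"
  using basis_indep indep_subset_ground by blast

lemma finite_bases: "finite (bases \<I>)"
  using finite_indep_sets by (rule finite_subset[rotated]) (auto simp: bases_def)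

lemma basis_card: 
  assumes "B \<in> bases \<I>"
  shows "card B = matroid_rank \<I>"
proof -
  have "Max (card ` \<I>) \<in> card ` \<I>" using finite_indep_sets empty_indep by (intro Max_in) auto
  then obtain Y where Y: "Y \<in> \<I>" "card Y = matroid_rank \<I>" by (auto simp: matroid_rank_def)
  have "\<not> card B < card Y"
  proof
    assume "card B < card Y"
    then obtain y where "y \<in> Y - B" "insert y B \<in> \<I>" using augment[OF basis_indep[OF assms] Y(1)] by blast
    then show False using assms by (auto simp: bases_def)
  qed
  then show ?thesis using Y indep_card_le_rank[OF basis_indep[OF assms]] by simp
qed

lemma basisI:
  assumes "B \<in> \<I>" "card B = matroid_rank \<I>"
  shows "B \<in> bases \<I>"
  unfolding bases_def
proof (intro CollectI conjI ballI impI)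
  fix X assume "X \<in> \<I>" "B \<subseteq> X"
  then show "X = B"
    using indep_card_le_rank[of X] assms finite_indep[of X] by (metis card_seteq)
qed fact

lemma bases_nonempty: "bases \<I> \<noteq> {}"
proof -
  have "Max (card ` \<I>) \<in> card ` \<I>" using finite_indep_sets empty_indep by (intro Max_in) auto
  then obtain Y where "Y \<in> \<I>" "card Y = matroid_rank \<I>" by (auto simp: matroid_rank_def)
  then show ?thesis using basisI by blast
qed

text \<open>Augment \<open>B - {y}\<close> from \<open>B'\<close>; the new element cannot be
  \<open>y\<close>, which is not in \<open>B'\<close>, and the size makes the result a
  basis.\<close>

lemma basis_exchange:
  assumes "B \<in> bases \<I>" "B' \<in> bases \<I>" "y \<in> B - B'"
  obtains i where "i \<in> B' - B" "insert i (B - {y}) \<in> bases \<I>"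
proof -
  have fin: "finite B" using assms finite_indep basis_indep by blast
  have "card (B - {y}) < card B'"
    using assms basis_card[OF assms(1)] basis_card[OF assms(2)] fin card_Diff1_less[of B y] by simp
  moreover have "B - {y} \<in> \<I>" using indep_subset[OF basis_indep[OF assms(1)]] by blast
  ultimately obtain i where i: "i \<in> B' - (B - {y})" "insert i (B - {y}) \<in> \<I>"
    using augment basis_indep[OF assms(2)] by blast
  then have iB: "i \<in> B' - B" using assms(3) by blast
  have "card (insert i (B - {y})) = card B" using iB assms(3) by (intro card_swap fin) auto
  then have "insert i (B - {y}) \<in> bases \<I>" using basisI i(2) basis_card[OF assms(1)] by simp
  then show ?thesis using that iB by blast
qed

text \<open>An element whose removal makes \<open>insert x B\<close> independent lies in every
  dependent subset of it. So the set of these elements is the least dependent subset, provided it is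
  dependent, and it is then the only circuit.\<close>

lemma fundamental_circuit_eq:
  assumes B: "B \<in> bases \<I>" and x: "x \<in> E - B"
  shows "fundamental_circuit E \<I> B x = {y \<in> insert x B. insert x B - {y} \<in> \<I>}"
proof -
  let ?U = "insert x B"
  let ?C = "{y \<in> ?U. ?U - {y} \<in> \<I>}"
  have fin: "finite B" using B finite_indep basis_indep by blast
  have dep: "?U \<notin> \<I>" using B x by (auto simp: bases_def)
  have U: "?U \<subseteq> E" using x basis_ground[OF B] by auto
  have sub: "?C \<subseteq> C" if "C \<subseteq> ?U" "C \<notin> \<I>" for C
  proof
    fix y assume "y \<in> ?C"
    then show "y \<in> C" using that indep_subset[of "?U - {y}" C] by blast
  qed
  have Cdep: "?C \<notin> \<I>"
  proof
    assume CI: "?C \<in> \<I>"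
    \<comment> \<open>A maximal independent set between \<open>?C\<close> and \<open>?U\<close> has
      as many elements as \<open>B\<close> by augmentation, so it omits exactly one
      \<open>y\<close>; then \<open>y\<close> belongs to \<open>?C\<close>, which it
      contains.\<close>
    let ?S = "{X \<in> \<I>. ?C \<subseteq> X \<and> X \<subseteq> ?U}"
    have "finite ?S" using finite_indep_sets by simp
    moreover have "?C \<in> ?S" using CI by auto
    ultimately have "\<exists>X\<in>?S. ?C \<subseteq> X \<and> (\<forall>Y\<in>?S. X \<subseteq> Y \<longrightarrow> X = Y)" by (rule finite_has_maximal2)
    then obtain X where X: "X \<in> ?S" and maximal: "\<forall>Y\<in>?S. X \<subseteq> Y \<longrightarrow> X = Y" by (elim bexE conjE)
    have "\<not> card X < card B"
    proof
      assume "card X < card B"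
      moreover have "X \<in> \<I>" using X by simp
      ultimately obtain y where y: "y \<in> B - X" "insert y X \<in> \<I>" using augment[of X B] basis_indep[OF B] by blast
      then have "insert y X \<in> ?S" using X by auto
      from bspec[OF maximal this] have "X = insert y X" by blast
      then show False using y(1) by blast
    qed
    moreover have "X \<noteq> ?U" using X(1) dep by auto
    then obtain y where y: "y \<in> ?U" "y \<notin> X" using X(1) by auto
    then have "X \<subseteq> ?U - {y}" using X(1) by auto
    moreover have "card (?U - {y}) = card B" using y(1) x fin by simp
    ultimately have "X = ?U - {y}" using fin by (intro card_seteq) auto
    then have "y \<in> ?C" using X(1) y by auto
    then show False using X(1) y by auto
  qed
  have "?C \<in> circuits E \<I>"
    unfolding circuits_def
  proof (intro CollectI conjI allI impI)
    fix X assume "X \<subset> ?C"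
    then show "X \<in> \<I>" using sub[of X] by blast
  qed (use U Cdep in auto)
  moreover have "C = ?C" if "C \<in> circuits E \<I>" "C \<subseteq> ?U" for C
  proof -
    have "?C \<subseteq> C" using sub that by (auto simp: circuits_def)
    then show ?thesis using that(1) Cdep unfolding circuits_def by blast
  qed
  ultimately show ?thesis
    unfolding fundamental_circuit_def by (intro the_equality) auto
qed

end

text \<open>Apart from \<open>x\<close>, the fundamental circuit consists of the elements of
  \<open>B\<close> that \<open>x\<close> can replace, so \<open>x\<close> fails to be its minimum
  exactly when it can replace a smaller element.\<close>

lemma externally_passive_iff:
  fixes E :: "'a::linorder set"
  assumes "matroid E \<I>" and B: "B \<in> bases \<I>"
  shows "x \<in> externally_passive E \<I> B \<longleftrightarrow> x \<in> E - B \<and> (\<exists>y\<in>B. y < x \<and> insert x (B - {y}) \<in> bases \<I>)"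
proof (cases "x \<in> E - B")
  case True
  interpret matroid E \<I> by fact
  let ?C = "{y \<in> insert x B. insert x B - {y} \<in> \<I>}"
  have fin: "finite B" using B finite_indep basis_indep by blast
  have xC: "x \<in> ?C" using True basis_indep[OF B] by simp
  have bas: "insert x (B - {y}) \<in> bases \<I> \<longleftrightarrow> y \<in> ?C" if "y \<in> B" for y
  proof -
    have eq: "insert x B - {y} = insert x (B - {y})" using that True by auto
    have "card (insert x (B - {y})) = card B" using that True by (intro card_swap fin) auto
    then show ?thesis using basisI[of "insert x (B - {y})"] basis_indep basis_card[OF B] that by (auto simp: eq)
  qed
  have finC: "finite ?C" by (rule finite_subset[of _ "insert x B"]) (use fin in auto)
  have "x \<noteq> Min ?C \<longleftrightarrow> (\<exists>y\<in>?C. y < x)"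
  proof
    assume "x \<noteq> Min ?C"
    then have "Min ?C < x" using Min_le[OF finC xC] by (metis order_le_imp_less_or_eq)
    moreover have "Min ?C \<in> ?C" using finC xC by (intro Min_in) blast+
    ultimately show "\<exists>y\<in>?C. y < x" by blast
  next
    assume "\<exists>y\<in>?C. y < x"
    then obtain y where "y \<in> ?C" "y < x" by blast
    then show "x \<noteq> Min ?C" using Min_le[OF finC, of y] by (metis leD)
  qed
  also have "\<dots> \<longleftrightarrow> (\<exists>y\<in>B. y < x \<and> insert x (B - {y}) \<in> bases \<I>)"
    using bas by auto
  finally show ?thesis
    using True by (simp add: externally_passive_def fundamental_circuit_eq[OF B True])
next
  case False
  then show ?thesis unfolding externally_passive_def by blast
qed

section \<open>The lexicographic order through binary weights\<close>

text \<open>The binary weight turns the lexicographic order into the (reversed) order of the naturals.\<close>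

definition weight :: "nat \<Rightarrow> nat set \<Rightarrow> nat" where "weight n B = (\<Sum>i\<in>B. 2 ^ (n - i))"

lemma sum_pow_tail: "i \<le> n \<Longrightarrow> Suc (\<Sum>j\<in>{i<..n}. 2 ^ (n - j)) = (2::nat) ^ (n - i)"
proof (induction "n - i" arbitrary: i)
  case 0
  then show ?case by simp
next
  case (Suc d)
  then have "{i<..n} = insert (Suc i) {Suc i<..n}" by auto
  moreover have "n - i = Suc (n - Suc i)" using Suc.hyps(2) by simp
  ultimately show ?case using Suc.hyps(1)[of "Suc i"] Suc.hyps(2) by simp
qed

text \<open>At the first difference \<open>i\<close>, the power for \<open>i\<close> exceeds the sum
  of all powers for later indices.\<close>

lemma weight_less:
  assumes B: "B \<subseteq> {1..n}" "B' \<subseteq> {1..n}" and i: "i \<in> B" "i \<notin> B'"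
    and eq: "\<And>j. j < i \<Longrightarrow> j \<in> B \<longleftrightarrow> j \<in> B'"
  shows "weight n B' < weight n B"
proof -
  let ?f = "\<lambda>j. (2::nat) ^ (n - j)"
  let ?L = "{j \<in> B. j < i}"
  have fin: "finite B" "finite B'" using B finite_subset by blast+
  have "B' \<subseteq> ?L \<union> {i<..n}"
  proof
    fix x assume x: "x \<in> B'"
    then have "x \<le> n" "x \<noteq> i" using B(2) i(2) by auto
    then show "x \<in> ?L \<union> {i<..n}" using x eq[of x] by (cases "x < i") auto
  qed
  then have "weight n B' \<le> sum ?f (?L \<union> {i<..n})"
    unfolding weight_def using fin by (intro sum_mono2) auto
  also have "\<dots> = sum ?f ?L + sum ?f {i<..n}" using fin by (intro sum.union_disjoint) auto
  also have "\<dots> < sum ?f ?L + ?f i" using sum_pow_tail[of i n] i B by fastforce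
  also have "\<dots> = sum ?f (insert i ?L)" using fin by simp
  also have "\<dots> \<le> weight n B" unfolding weight_def using fin i by (intro sum_mono2) auto
  finally show ?thesis .
qed

lemma lex_less_imp_weight:
  assumes B: "B \<subseteq> {1..n}" "B' \<subseteq> {1..n}" and lex: "lex_less B B'"
  shows "weight n B' < weight n B"
proof (rule weight_less[OF B])
  let ?D = "(B - B') \<union> (B' - B)"
  have fin: "finite ?D" by (rule finite_subset[of _ "{1..n}"]) (use B in auto)
  have ne: "?D \<noteq> {}" and M: "Min ?D \<in> B" using lex by (auto simp: lex_less_def)
  show "Min ?D \<in> B" by fact
  show "Min ?D \<notin> B'" using Min_in[OF fin ne] M by auto
  show "j \<in> B \<longleftrightarrow> j \<in> B'" if "j < Min ?D" for j
    using Min_le[OF fin, of j] that by (auto simp: leD)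
qed

lemma lex_less_total:
  fixes n :: nat
  assumes B: "B \<subseteq> {1..n}" "B' \<subseteq> {1..n}" "B \<noteq> B'"
  shows "lex_less B B' \<or> lex_less B' B"
proof -
  let ?D = "(B - B') \<union> (B' - B)"
  have "finite ?D" by (rule finite_subset[of _ "{1..n}"]) (use B in auto)
  moreover have "?D \<noteq> {}" using B by auto
  ultimately have "Min ?D \<in> ?D" by (rule Min_in)
  then have Min: "Min ?D \<in> ?D" by simp
  show ?thesis
  proof (cases "Min ?D \<in> B")
    case True
    then show ?thesis using B(3) unfolding lex_less_def by blast
  next
    case False
    then have "Min ?D \<in> B'" using Min by blast
    moreover have "?D = (B' - B) \<union> (B - B')" by (rule Un_commute)
    ultimately have "Min ((B' - B) \<union> (B - B')) \<in> B'" by simp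
    then show ?thesis using B(3) unfolding lex_less_def by blast
  qed
qed

lemma lex_less_iff_weight:
  assumes "B \<subseteq> {1..n}" "B' \<subseteq> {1..n}"
  shows "lex_less B B' \<longleftrightarrow> weight n B' < weight n B"
proof (cases "B = B'")
  case False
  then show ?thesis
    using lex_less_imp_weight[OF assms] lex_less_imp_weight[OF assms(2,1)] lex_less_total[OF assms] by auto
qed (simp add: lex_less_def)

lemma weight_inj:
  assumes "B \<subseteq> {1..n}" "B' \<subseteq> {1..n}" "weight n B = weight n B'"
  shows "B = B'"
  using lex_less_total[OF assms(1,2)] lex_less_iff_weight[OF assms(1,2)] lex_less_iff_weight[OF assms(2,1)] assms(3) by auto

text \<open>The lexicographic maximum is the basis of least weight; it is unique because the weight
  is injective, so the definite description denotes it.\<close>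

lemma max_basis:
  assumes "matroid {1..n} \<I>"
  shows "max_basis \<I> \<in> bases \<I>" "\<And>B. B \<in> bases \<I> \<Longrightarrow> B \<noteq> max_basis \<I> \<Longrightarrow> weight n (max_basis \<I>) < weight n B"
proof -
  interpret matroid "{1..n}" \<I> by fact
  have lex: "lex_less B' B \<longleftrightarrow> weight n B < weight n B'" if "B \<in> bases \<I>" "B' \<in> bases \<I>" for B B'
    using lex_less_iff_weight[of B' n B] basis_ground that by auto
  obtain B where B: "B \<in> bases \<I>" "\<And>B'. B' \<in> bases \<I> \<Longrightarrow> weight n B \<le> weight n B'"
    using finite_bases bases_nonempty arg_min_if_finite[of "bases \<I>" "weight n"] by (metis leI)
  have less: "weight n B < weight n B'" if "B' \<in> bases \<I>" "B' \<noteq> B" for B'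
    using B that weight_inj[of B n B'] basis_ground by (metis le_neq_implies_less)
  have "max_basis \<I> = B"
    unfolding max_basis_def
  proof (rule the_equality)
    show "B \<in> bases \<I> \<and> (\<forall>B'\<in>bases \<I> - {B}. lex_less B' B)" using B less lex by auto
    show "B' = B" if "B' \<in> bases \<I> \<and> (\<forall>B''\<in>bases \<I> - {B'}. lex_less B'' B')" for B'
    proof (rule ccontr)
      assume "B' \<noteq> B"
      then have "lex_less B B'" using that B by auto
      then have "weight n B' < weight n B" using lex that B by auto
      then show False using less \<open>B' \<noteq> B\<close> that by force
    qed
  qed
  then show "max_basis \<I> \<in> bases \<I>" "\<And>B. B \<in> bases \<I> \<Longrightarrow> B \<noteq> max_basis \<I> \<Longrightarrow> weight n (max_basis \<I>) < weight n B"
    using B less by auto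
qed

text \<open>Quantifying over all roots lets each step of the filtration choose the root that suits it.\<close>

definition tor_is :: "nat \<Rightarrow> (nat \<Rightarrow>\<^sub>0 nat) set \<Rightarrow> nat \<Rightarrow> nat \<Rightarrow> nat \<Rightarrow> bool" where
  "tor_is n M t s d \<longleftrightarrow> (\<forall>p\<in>{1..n}. qdim (rel_cycles n p UNIV M t s) (rel_bounds n p UNIV M t s) d)"

lemma tor_isI:
  assumes "p \<in> {1..n}" "upset n M" "qdim (rel_cycles n p UNIV M t s) (rel_bounds n p UNIV M t s) d"
  shows "tor_is n M t s d"
  unfolding tor_is_def using qdim_root_independent[OF assms(1) _ assms(2,3)] by blast

lemma tor_isD: "tor_is n M t s d \<Longrightarrow> p \<in> {1..n} \<Longrightarrow> qdim (rel_cycles n p UNIV M t s) (rel_bounds n p UNIV M t s) d"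
  by (simp add: tor_is_def)

section \<open>Homology of principal ideals and of lexicographic segments\<close>

lemma set_mono_insert: "finite A \<Longrightarrow> b \<notin> A \<Longrightarrow> set_mono (insert b A) = set_mono A + xm b"
  by (simp add: set_mono_def add.commute)

lemma set_mono_mons: "A \<subseteq> {1..n} \<Longrightarrow> set_mono A \<in> mons n (card A)"
  using finite_subset[of A "{1..n}"] by (simp add: mons_def keys_set_mono monom_degree_set_mono)

text \<open>Enlarging \<open>A\<close> by \<open>b\<close> shrinks the ideal, so the quotient by the
  larger ideal is the known one and \<open>step_restrict\<close> applies. With
  \<open>Q = {b}\<close> and root \<open>b\<close> the exterior algebra has no generators, and each
  variable adds one class at exterior degree 0 and polynomial degree \<open>card A\<close>.\<close>

lemma tor_principal:
  assumes "finite A" "A \<subseteq> {1..n}"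
  shows "tor_is n (gen_upset n {A}) t s (if t = 0 \<and> s < card A then 1 else 0)"
  using assms
proof (induction A arbitrary: t s rule: finite_induct)
  case empty
  have "rel_cycles n p UNIV (gen_upset n {{}}) t s \<subseteq> rel_bounds n p UNIV (gen_upset n {{}}) t s" for p
  proof
    fix z assume "z \<in> rel_cycles n p UNIV (gen_upset n {{}}) t s"
    then have z: "z \<in> graded n p t s" by (simp add: rel_cycles_def)
    then have "z \<in> chains_in (gen_upset n {{}})"
      by (force simp: graded_def chains_in_def supported_on_def gen_upset_def set_mono_def mons_def)
    from rel_boundsI[OF z this, of 0] show "z \<in> rel_bounds n p UNIV (gen_upset n {{}}) t s" by (simp add: kdiff_0)
  qed
  then show ?case by (simp add: tor_is_def qdim_0_iff)
next
  case (insert b A)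
  let ?M = "gen_upset n {insert b A}" and ?M' = "gen_upset n {A}"
  let ?R = "{set_mono A + u | u. keys u \<subseteq> {1..n} - {b}}"
  have b: "b \<in> {1..n}" and A: "A \<subseteq> {1..n}" using insert.prems by auto
  have IH: "tor_is n ?M' t s (if t = 0 \<and> s < card A then 1 else 0)" for t s by (rule insert.IH[OF A])
  have mem: "set_mono A + xm b + v \<in> ?M" if "keys v \<subseteq> {1..n}" for v
    using that insert.hyps by (auto simp: gen_upset_def set_mono_insert)
  interpret relative_step n b "card A" "{b}" "set_mono A" ?M ?R
  proof
    show "?M \<inter> ?R = {}"
    proof (rule equals0I)
      fix u assume "u \<in> ?M \<inter> ?R"
      then obtain v v' where v0: "u = set_mono (insert b A) + v"
        and v: "u = set_mono A + v'" "keys v' \<subseteq> {1..n} - {b}"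
        unfolding gen_upset_def by blast
      from v0 have "u = set_mono A + (xm b + v)" using insert.hyps by (simp add: set_mono_insert add.assoc)
      then have "xm b + v = v'" using v(1) by simp
      moreover have "b \<in> keys (xm b + v)" by simp
      ultimately have "b \<in> keys v'" by simp
      then show False using v by auto
    qed
    show "w + xm j \<in> ?M" if w: "w \<in> ?R" and j: "j \<in> {b}" for w j
    proof -
      from w obtain u where "w = set_mono A + u" "keys u \<subseteq> {1..n}" by auto
      then show ?thesis using mem[of u] j by (simp add: ac_simps)
    qed
  qed (use b A set_mono_mons upset_gen_upset in auto)
  have M': "?M' = ?M \<union> ?R"
  proof (intro equalityI subsetI)
    fix u assume "u \<in> ?M'"
    then obtain v where v: "u = set_mono A + v" "keys v \<subseteq> {1..n}" by (auto simp: gen_upset_def)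
    show "u \<in> ?M \<union> ?R"
    proof (cases "b \<in> keys v")
      case True
      then obtain v' where "v = v' + xm b" by (rule monom_split_var)
      then show ?thesis using mem[of v'] v by (simp add: ac_simps)
    qed (use v in auto)
  next
    fix u assume "u \<in> ?M \<union> ?R"
    then show "u \<in> ?M'"
    proof
      assume "u \<in> ?M"
      then obtain v where v: "u = set_mono A + (xm b + v)" "keys v \<subseteq> {1..n}"
        using insert.hyps by (auto simp: gen_upset_def set_mono_insert add.assoc)
      then show ?thesis using b unfolding gen_upset_def by (intro CollectI exI[of _ A] exI[of _ "xm b + v"]) auto
    qed (auto simp: gen_upset_def)
  qed
  have "qdim (rel_cycles n b UNIV ?M t s) (rel_bounds n b UNIV ?M t s)
     ((if s = card A then (card {b} - 1) choose t else 0) + (if t = 0 \<and> s < card A then 1 else 0))"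
  proof (rule step_restrict[OF b upset_gen_upset upset_gen_upset])
    show "?M \<subseteq> ?M'" using M' by blast
    show "rel_cycles n b UNIV ?M' (Suc t) s \<subseteq> rel_bounds n b UNIV ?M' (Suc t) s" for t s
      using tor_isD[OF IH[of "Suc t" s] b] by (simp add: qdim_0_iff)
    show "qdim (rel_cycles n b ?M' ?M t s) (rel_bounds n b ?M' ?M t s) (if s = card A then (card {b} - 1) choose t else 0)"
      unfolding M' by (rule relative_homology)
    show "qdim (rel_cycles n b UNIV ?M' t s) (rel_bounds n b UNIV ?M' t s) (if t = 0 \<and> s < card A then 1 else 0)"
      using tor_isD[OF IH b] .
  qed
  moreover have "(if s = card A then (card {b} - 1) choose t else 0) + (if t = 0 \<and> s < card A then 1 else 0)
      = (if t = 0 \<and> s < card (insert b A) then 1 else (0::nat))"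
    using insert.hyps by (cases t) auto
  ultimately show ?case using tor_isI[OF b upset_gen_upset, of "{insert b A}" t s] by (simp only:)
qed

text \<open>If \<open>B'\<close> has smaller weight, the least element y of the symmetric difference
  lies in \<open>B\<close>, and exchanging y against some i of \<open>B'\<close> gives i > y. So i
  is externally passive: \<open>Q\<close> is nonempty, and a multiple of the monomial of
  \<open>B\<close> that lies in \<open>M\<close> has a quotient involving a variable of
  \<open>Q\<close>.\<close>

lemma linear_quotients:
  assumes mat: "matroid {1..n} \<I>" and B: "B \<in> bases \<I>"
  defines "M \<equiv> gen_upset n {B' \<in> bases \<I>. weight n B' < weight n B}"
    and "Q \<equiv> externally_passive {1..n} \<I> B"
  defines "R \<equiv> {set_mono B + u | u. keys u \<subseteq> {1..n} - Q}"
  shows "M \<inter> R = {}"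
    and "\<And>w j. w \<in> R \<Longrightarrow> j \<in> Q \<Longrightarrow> w + xm j \<in> M"
    and "gen_upset n {B' \<in> bases \<I>. weight n B' \<le> weight n B} = M \<union> R"
    and "B' \<in> bases \<I> \<Longrightarrow> weight n B' < weight n B \<Longrightarrow> Q \<noteq> {}"
proof -
  interpret matroid "{1..n}" \<I> by fact
  note ep_iff = externally_passive_iff[OF mat B]
  have Bn: "B \<subseteq> {1..n}" using basis_ground[OF B] .
  have finB: "finite B" using Bn finite_subset by blast
  have step: "\<exists>i\<in>B' - B. i \<in> Q" if B': "B' \<in> bases \<I>" "weight n B' < weight n B" for B'
  proof -
    have B'n: "B' \<subseteq> {1..n}" using basis_ground[OF B'(1)] .
    let ?D = "(B - B') \<union> (B' - B)"
    have lex: "lex_less B B'" using lex_less_iff_weight[OF Bn B'n] B'(2) by simp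
    have fin: "finite ?D" by (rule finite_subset[of _ "{1..n}"]) (use Bn B'n in auto)
    have ne: "?D \<noteq> {}" and y: "Min ?D \<in> B" using lex by (auto simp: lex_less_def)
    then have y': "Min ?D \<in> B - B'" using Min_in[OF fin ne] by auto
    obtain i where i: "i \<in> B' - B" "insert i (B - {Min ?D}) \<in> bases \<I>"
      by (rule basis_exchange[OF B B'(1) y'])
    have "Min ?D \<le> i" using i(1) by (intro Min_le fin) auto
    moreover have "Min ?D \<noteq> i" using i(1) y by auto
    ultimately have "Min ?D < i" by simp
    then show ?thesis using i y B'n unfolding Q_def ep_iff by blast
  qed
  show "M \<inter> R = {}"
  proof (rule equals0I)
    fix u assume "u \<in> M \<inter> R"
    then obtain B' v v' where u: "u = set_mono B' + v" "B' \<in> bases \<I>" "weight n B' < weight n B"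
      "u = set_mono B + v'" "keys v' \<subseteq> {1..n} - Q" by (auto simp: M_def R_def gen_upset_def)
    then obtain i where i: "i \<in> B'" "i \<notin> B" "i \<in> Q" using step by blast
    have "finite B'" using finite_indep basis_indep u(2) by blast
    then have "i \<in> keys u" using u(1) i by (simp add: keys_set_mono)
    then have "i \<in> keys v'" using u(4) i finB by (simp add: keys_set_mono)
    then show False using u i by auto
  qed
  \<comment> \<open>If \<open>j\<close> replaces a smaller \<open>y\<close> of \<open>B\<close>, the
    new basis has smaller weight, and its monomial times \<open>x_y\<close> is the monomial of
    \<open>B\<close> times \<open>x_j\<close>.\<close>
  have QM: "set_mono B + u + xm j \<in> M" if u: "keys u \<subseteq> {1..n}" and j: "j \<in> Q" for u j
  proof -
    from j obtain y where y: "j \<in> {1..n} - B" "y \<in> B" "y < j" "insert j (B - {y}) \<in> bases \<I>"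
      unfolding Q_def ep_iff by blast
    let ?B = "insert j (B - {y})"
    have "weight n ?B < weight n B"
      using y Bn by (intro weight_less[of _ _ _ y]) auto
    moreover have "set_mono B = set_mono (B - {y}) + xm y"
      using set_mono_insert[of "B - {y}" y] finB y(2) by (simp add: insert_absorb)
    moreover have "set_mono ?B = set_mono (B - {y}) + xm j"
      using set_mono_insert[of "B - {y}" j] finB y(1) by simp
    ultimately show ?thesis unfolding M_def gen_upset_def using y u Bn
      by (intro CollectI exI[of _ ?B] exI[of _ "u + xm y"]) (auto simp: ac_simps)
  qed
  show "w + xm j \<in> M" if "w \<in> R" "j \<in> Q" for w j
    using that QM by (auto simp: R_def)
  show "gen_upset n {B' \<in> bases \<I>. weight n B' \<le> weight n B} = M \<union> R"
  proof (intro equalityI subsetI)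
    fix u assume "u \<in> gen_upset n {B' \<in> bases \<I>. weight n B' \<le> weight n B}"
    then obtain B' v where u: "u = set_mono B' + v" "B' \<in> bases \<I>" "weight n B' \<le> weight n B" "keys v \<subseteq> {1..n}"
      by (auto simp: gen_upset_def)
    show "u \<in> M \<union> R"
    proof (cases "weight n B' < weight n B")
      case True
      then show ?thesis using u by (auto simp: M_def gen_upset_def)
    next
      case False
      then have B': "B' = B" using u weight_inj[OF basis_ground Bn] by auto
      show ?thesis
      proof (cases "keys v \<inter> Q = {}")
        case True
        then show ?thesis using u B' by (auto simp: R_def)
      next
        case False
        then obtain j where j: "j \<in> keys v" "j \<in> Q" by auto
        obtain v' where v': "v = v' + xm j" using j(1) by (rule monom_split_var)
        then show ?thesis using QM[of v' j] j u B' by (simp add: ac_simps)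
      qed
    qed
  next
    fix u assume "u \<in> M \<union> R"
    then obtain B' v where "u = set_mono B' + v" "B' \<in> bases \<I>" "weight n B' \<le> weight n B" "keys v \<subseteq> {1..n}"
      using B less_imp_le[of "weight n _" "weight n B"] unfolding M_def R_def gen_upset_def by blast
    then show "u \<in> gen_upset n {B' \<in> bases \<I>. weight n B' \<le> weight n B}" unfolding gen_upset_def by blast
  qed
  show "Q \<noteq> {}" if "B' \<in> bases \<I>" "weight n B' < weight n B" using step[OF that] by blast
qed

text \<open>Induction on a bound for the weight instead of a position in a list: a weight that no
  basis attains changes nothing. Every basis but the largest has a passive element by
  \<open>linear_quotients\<close>, so \<open>ep - 1\<close> is a true difference.\<close>

lemma tor_lex_segment:
  assumes mat: "matroid {1..n} \<I>" and k: "weight n (max_basis \<I>) < k" and n: "0 < n"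
  shows "tor_is n (gen_upset n {B \<in> bases \<I>. weight n B < k}) t s
    ((if t = 0 \<and> s < matroid_rank \<I> then 1 else 0)
     + (case t of 0 \<Rightarrow> 0 | Suc t' \<Rightarrow> if Suc s = matroid_rank \<I>
        then \<Sum>B\<in>{B \<in> bases \<I> - {max_basis \<I>}. weight n B < k}. (ep {1..n} \<I> B - 1) choose t' else 0))"
  using k
proof (induction k arbitrary: t s)
  case 0
  then show ?case by simp
next
  case (Suc k)
  interpret matroid "{1..n}" \<I> by fact
  let ?r = "matroid_rank \<I>" and ?Bm = "max_basis \<I>"
  let ?bs = "\<lambda>k. {B \<in> bases \<I>. weight n B < k}"
  let ?bs' = "\<lambda>k. {B \<in> bases \<I> - {?Bm}. weight n B < k}"
  let ?M = "\<lambda>k. gen_upset n (?bs k)"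
  let ?d = "\<lambda>k t s. (if t = 0 \<and> s < ?r then 1 else 0)
     + (case t of 0 \<Rightarrow> 0 | Suc t' \<Rightarrow> if Suc s = ?r then \<Sum>B\<in>?bs' k. (ep {1..n} \<I> B - 1) choose t' else 0)"
  note Bm = max_basis[OF mat]
  show ?case
  proof (cases "weight n ?Bm = k")
    case True
    \<comment> \<open>The start of the filtration: only the largest basis has weight at most
      \<open>k\<close>.\<close>
    then have bs: "?bs (Suc k) = {?Bm}" using Bm by (force simp: less_Suc_eq_le)
    have bs': "?bs' (Suc k) = {}" using True Bm by (force simp: less_Suc_eq_le)
    have d: "?d (Suc k) t s = (if t = 0 \<and> s < ?r then 1 else 0)"
      unfolding bs' by (simp split: nat.split)
    have "tor_is n (gen_upset n {?Bm}) t s (if t = 0 \<and> s < ?r then 1 else 0)"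
      using tor_principal[of ?Bm n t s] basis_card[OF Bm(1)] basis_ground[OF Bm(1)] finite_indep[OF basis_indep[OF Bm(1)]]
      by simp
    then show ?thesis unfolding d bs .
  next
    case False
    then have k: "weight n ?Bm < k" using Suc.prems by simp
    note IH = Suc.IH[OF k]
    show ?thesis
    proof (cases "\<exists>B\<in>bases \<I>. weight n B = k")
      case False
      then have "?bs (Suc k) = ?bs k" "?bs' (Suc k) = ?bs' k" by (auto simp: less_Suc_eq)
      then show ?thesis using IH[of t s] by (simp only:)
    next
      case True
      then obtain B where B: "B \<in> bases \<I>" "weight n B = k" by auto
      define Q where "Q = externally_passive {1..n} \<I> B"
      define R where "R = {set_mono B + u | u. keys u \<subseteq> {1..n} - Q}"
      have BBm: "B \<noteq> ?Bm" using B k by auto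
      note lq = linear_quotients[OF mat B(1), unfolded B(2), folded Q_def R_def]
      have Q: "Q \<subseteq> {1..n}" by (auto simp: Q_def externally_passive_def)
      \<comment> \<open>The root for this step: since \<open>B\<close> is not the largest basis, it
        has an externally passive element.\<close>
      obtain p where p: "p \<in> Q" using lq(4)[OF Bm(1) k] by blast
      then have pn: "p \<in> {1..n}" using Q by auto
      interpret relative_step n p ?r Q "set_mono B" "?M k" R
        using p Q set_mono_mons[OF basis_ground[OF B(1)]] basis_card[OF B(1)] lq upset_gen_upset
        by unfold_locales (auto simp: R_def)
      have M': "?M (Suc k) = ?M k \<union> R" unfolding R_def using lq(3) by (simp only: less_Suc_eq_le)
      \<comment> \<open>The relative homology of polynomial degree \<open>?r\<close> enters one
        polynomial degree lower and one exterior degree higher, hence \<open>Suc s = ?r\<close> and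
        the predecessor of \<open>t\<close>.\<close>
      have qdim_step: "qdim (rel_cycles n p UNIV (?M (Suc k)) t s) (rel_bounds n p UNIV (?M (Suc k)) t s)
         (?d k t s + (case t of 0 \<Rightarrow> 0 | Suc t' \<Rightarrow> if Suc s = ?r then (card Q - 1) choose t' else 0))"
      proof (rule step_extend[OF pn upset_gen_upset upset_gen_upset, where r = ?r])
        show "?M k \<subseteq> ?M (Suc k)" using M' by blast
        show "rel_cycles n p UNIV (?M k) t s \<subseteq> rel_bounds n p UNIV (?M k) t s" if "?r \<le> s" for t s
        proof -
          \<comment> \<open>Both terms of the formula live in degrees below \<open>?r\<close>, which
            is the vanishing that \<open>step_extend\<close> asks for.\<close>
          have "?d k t s = 0" using that by (simp split: nat.split)
          then show ?thesis using tor_isD[OF IH[of t s] pn] by (simp add: qdim_0_iff)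
        qed
        show "?r \<le> monom_degree u" if u: "u \<in> ?M (Suc k)" for u
        proof -
          from u obtain B' v where "u = set_mono B' + v" "B' \<in> bases \<I>" by (auto simp: gen_upset_def)
          then show ?thesis
            using basis_card finite_indep basis_indep by (simp add: monom_degree_set_mono)
        qed
        show "qdim (rel_cycles n p UNIV (?M k) t s) (rel_bounds n p UNIV (?M k) t s) (?d k t s)"
          by (rule tor_isD[OF IH pn])
        show "case t of 0 \<Rightarrow> (case t of 0 \<Rightarrow> 0 | Suc t' \<Rightarrow> if Suc s = ?r then (card Q - 1) choose t' else 0) = 0
          | Suc t' \<Rightarrow> qdim (rel_cycles n p (?M (Suc k)) (?M k) t' (Suc s)) (rel_bounds n p (?M (Suc k)) (?M k) t' (Suc s))
             (case t of 0 \<Rightarrow> 0 | Suc t' \<Rightarrow> if Suc s = ?r then (card Q - 1) choose t' else 0)"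
          unfolding M' using relative_homology[of _ "Suc s"] by (simp split: nat.split)
      qed
      have uniq: "B' = B" if "B' \<in> bases \<I>" "weight n B' = k" for B'
        using weight_inj[OF basis_ground[OF that(1)] basis_ground[OF B(1)]] that(2) B(2) by simp
      have "?bs' (Suc k) = insert B (?bs' k)"
      proof (intro equalityI subsetI)
        fix B' assume "B' \<in> ?bs' (Suc k)"
        then show "B' \<in> insert B (?bs' k)" using uniq[of B'] by (auto simp: less_Suc_eq)
      qed (use B BBm in auto)
      then have bs'_sum: "(\<Sum>B\<in>?bs' (Suc k). (ep {1..n} \<I> B - 1) choose t')
          = (\<Sum>B\<in>?bs' k. (ep {1..n} \<I> B - 1) choose t') + ((card Q - 1) choose t')" for t'
        using B finite_bases by (simp add: ep_def Q_def)
      have "?d (Suc k) t s = ?d k t s + (case t of 0 \<Rightarrow> 0 | Suc t' \<Rightarrow> if Suc s = ?r then (card Q - 1) choose t' else 0)"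
        unfolding bs'_sum by (simp split: nat.split)
      with qdim_step show ?thesis using tor_isI[OF pn upset_gen_upset, of "?bs (Suc k)" t s] by (simp only:)
    qed
  qed
qed

section \<open>Dimensions for the full ideal and the Hilbert series\<close>

lemma tor_dim_fan:
  assumes mat: "matroid {1..n} \<I>" and n: "0 < n"
  shows "tor_dim (fan_module n \<I>) (fan_grading n \<I>) (diff_forms n) t s
    = (if t = 0 \<and> s < matroid_rank \<I> then 1 else 0)
     + (case t of 0 \<Rightarrow> 0 | Suc t' \<Rightarrow> if Suc s = matroid_rank \<I>
        then \<Sum>B\<in>bases \<I> - {max_basis \<I>}. (ep {1..n} \<I> B - 1) choose t' else 0)"
proof -
  interpret matroid "{1..n}" \<I> by fact
  \<comment> \<open>A bound above all weights, so that the segment contains every basis.\<close>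
  define k where "k = Suc (Max (weight n ` bases \<I>))"
  have k: "weight n B < k" if "B \<in> bases \<I>" for B
    using finite_bases that by (auto simp: k_def less_Suc_eq_le)
  have bs: "{B \<in> bases \<I>. weight n B < k} = bases \<I>" "{B \<in> bases \<I> - {max_basis \<I>}. weight n B < k} = bases \<I> - {max_basis \<I>}"
    using k by auto
  let ?M = "gen_upset n (bases \<I>)"
  have J: "basis_ideal n \<I> = mono_ideal n ?M"
    unfolding basis_ideal_def by (rule genideal_monomials[OF basis_ground])
  \<comment> \<open>Any root serves, as \<open>tor_is\<close> holds for all of them.\<close>
  have p: "1 \<in> {1..n}" using n by simp
  interpret koszul_quotient n 1 "quotient_module n ?M" "\<lambda>f. mono_ideal n ?M +>\<^bsub>poly_ring n\<^esub> f" ?M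
    by (rule koszul_quotient_mono_ideal[OF p upset_gen_upset])
  have "fan_module n \<I> = quotient_module n ?M"
    by (simp add: fan_module_def quotient_module_def J)
  moreover have "fan_grading n \<I> = gr"
    by (rule ext) (simp add: fan_grading_def J)
  ultimately show ?thesis
    using tor_dim_eq[OF tor_isD[OF tor_lex_segment[OF mat k[OF max_basis(1)[OF mat]] n, of t s, unfolded bs] p]]
    by simp
qed

lemma one_plus_hilb_x_power_nth: "fps_nth ((1 + hilb_x) ^ k) t = of_nat (k choose t)"
  unfolding hilb_x_def
proof (induction k arbitrary: t)
  case (Suc k)
  then show ?case by (cases t) (simp_all add: algebra_simps)
qed simp

theorem theorem4p4:
  fixes n r :: nat and \<I> :: "nat set set"
  assumes "matroid {1..n} \<I>"
    and "matroid_rank \<I> = r"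
    and "r > 0"
  shows "tor_hilb (fan_module n \<I>) (fan_grading n \<I>) (diff_forms n) =
    (\<Sum>i = 0..r - 1. hilb_y ^ i)
    + hilb_x * hilb_y ^ (r - 1)
      * (\<Sum>B \<in> bases \<I> - {max_basis \<I>}. (1 + hilb_x) ^ (ep {1..n} \<I> B - 1))"
proof (intro fps_ext)
  fix t s
  interpret matroid "{1..n}" \<I> by fact
  \<comment> \<open>Positive rank makes a basis nonempty and with it the ground set, so a root
    exists.\<close>
  obtain B where B: "B \<in> bases \<I>" using bases_nonempty by blast
  have "B \<noteq> {}" using basis_card[OF B] assms by auto
  then have n: "0 < n" using basis_ground[OF B] by auto
  let ?S = "\<Sum>B \<in> bases \<I> - {max_basis \<I>}. (1 + hilb_x) ^ (ep {1..n} \<I> B - 1)"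
  have y_power: "hilb_y ^ i = fps_const (fps_X ^ i)" for i by (simp add: hilb_y_def)
  have first: "fps_nth (fps_nth (\<Sum>i = 0..r - 1. hilb_y ^ i) t) s = (if t = 0 \<and> s < r then 1 else 0)"
  proof -
    have "fps_nth (fps_nth (\<Sum>i = 0..r - 1. hilb_y ^ i) t) s = (\<Sum>i = 0..r - 1. if t = 0 \<and> i = s then 1 else 0)"
      unfolding y_power fps_sum_nth by (intro sum.cong) auto
    also have "\<dots> = (if t = 0 \<and> s < r then 1 else 0)" using assms(3) by (cases "t = 0") auto
    finally show ?thesis .
  qed
  \<comment> \<open>\<open>hilb_x\<close> shifts the outer index, and powers of
    \<open>hilb_y\<close> are constants in the outer variable, so the two indices can be read off
    one after the other.\<close>
  have "fps_nth (fps_nth (hilb_x * hilb_y ^ (r - 1) * ?S) t) s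
     = (case t of 0 \<Rightarrow> 0 | Suc t' \<Rightarrow> fps_nth (fps_X ^ (r - 1) * fps_nth ?S t') s)"
    unfolding y_power by (simp add: hilb_x_def mult.assoc split: nat.split)
  also have "\<dots> = (case t of 0 \<Rightarrow> 0 | Suc t' \<Rightarrow> if Suc s = r
        then int (\<Sum>B\<in>bases \<I> - {max_basis \<I>}. (ep {1..n} \<I> B - 1) choose t') else 0)"
  proof (cases t)
    case (Suc t')
    obtain r' where r: "r = Suc r'" using assms(3) by (cases r) auto
    have "fps_nth ?S t' = fps_const (int (\<Sum>B\<in>bases \<I> - {max_basis \<I>}. (ep {1..n} \<I> B - 1) choose t'))"
      unfolding fps_sum_nth one_plus_hilb_x_power_nth of_nat_sum[symmetric] by (simp only: fps_of_nat[symmetric])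
    then show ?thesis using Suc r by (simp add: fps_X_power_mult_nth)
  qed simp
  finally show "fps_nth (fps_nth (tor_hilb (fan_module n \<I>) (fan_grading n \<I>) (diff_forms n)) t) s
      = fps_nth (fps_nth ((\<Sum>i = 0..r - 1. hilb_y ^ i) + hilb_x * hilb_y ^ (r - 1) * ?S) t) s"
    using first by (simp add: tor_hilb_def tor_dim_fan[OF assms(1) n] assms(2) split: nat.split)
qed

end
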